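(* Let $\alpha=(D_g,\alpha_g)_{g\in G}$ be a unital partial action of a group $G$ on a commutative ring $R$. For $g\in G$ let $X_g=[D_g]\mathbf{PicS}(R)=\{[E]\in\mathbf{PicS}(R):E=1_gE\}$. Then the family $\alpha^*=(X_g,\alpha_g^* )_{g\in G}$, where $$\alpha_g^*\colon X_{g^{-1}}\to X_g,\qquad [E]\mapsto[E_g],$$ defines a partial action of $G$ on $\mathbf{PicS}(R)$.
   Context: A unital partial action $\alpha=(D_g,\alpha_g)_{g\in G}$ of a group $G$ on a commutative ring $R$ consists of ideals $D_g=R1_g$ generated by idempotents $1_g$ (possibly zero) and ring isomorphisms $\alpha_g\colon D_{g^{-1}}\to D_g$ such that $D_1=R$, $\alpha_1=\mathrm{id}_R$, $\alpha_g(D_{g^{-1}}D_h)=D_gD_{gh}$, and $\alpha_g(\alpha_h(t))=\alpha_{gh}(t)$ for all $t\in D_{h^{-1}}D_{(gh)^{-1}}$. A partial action on a commutative monoid $T$ is defined in the same way, with ideals $T_g$ of the monoid and semigroup isomorphisms $T_{g^{-1}}\to T_g$ in place of ring isomorphisms. Modules over $R$ are regarded as central bimodules. $\mathbf{PicS}(R)$ is the commutative monoid, under $[E][F]=[E\otimes_R F]$, of isomorphism classes of finitely generated projective $R$-modules $E$ admitting a surjective $R$-algebra homomorphism $R\to\mathrm{End}_R(E)$ (equivalently, for every prime $\mathfrak p$ of $R$ either $E_{\mathfrak p}=0$ or $E_{\mathfrak p}\cong R_{\mathfrak p}$). For an $R$-module $E$ with $1_{g^{-1}}x=x$ for all $x\in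 E$, $E_g$ denotes the abelian group $E$ with the $R$-action $r\bullet x=\alpha_{g^{-1}}(r1_g)x$. *)

theory Defs
  imports "HOL-Algebra.Module" "HOL-Algebra.QuotRing" "HOL-Algebra.Ideal_Product"
begin

section \<open>Partial actions\<close>

text \<open>
  The ideal \<open>D g\<close> is a ring with identity \<open>u g\<close> (the idempotent written \<open>1\<^sub>g\<close> on paper), so the
  ring isomorphisms between the ideals are isomorphisms of the records with carrier \<open>D g\<close> and
  one \<open>u g\<close>. The functions \<open>\<alpha> g\<close> are total; only their values on \<open>D (inv g)\<close> are meaningful.
\<close>

locale unital_partial_action = G?: group G + R?: cring R
  for G :: "('g, 'x) monoid_scheme" and R :: "('a, 'b) ring_scheme" +
  fixes D :: "'g \<Rightarrow> 'a set" and u :: "'g \<Rightarrow> 'a" and \<alpha> :: "'g \<Rightarrow> 'a \<Rightarrow> 'a"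
  assumes unit_closed: "g \<in> carrier G \<Longrightarrow> u g \<in> carrier R"
    and unit_idem: "g \<in> carrier G \<Longrightarrow> u g \<otimes>\<^bsub>R\<^esub> u g = u g"
    and dom_def: "g \<in> carrier G \<Longrightarrow> D g = PIdl\<^bsub>R\<^esub> (u g)"
    and act_iso: "g \<in> carrier G \<Longrightarrow>
      \<alpha> g \<in> ring_iso (R\<lparr>carrier := D (inv\<^bsub>G\<^esub> g), one := u (inv\<^bsub>G\<^esub> g)\<rparr>)
                     (R\<lparr>carrier := D g, one := u g\<rparr>)"
    and dom_one: "D \<one>\<^bsub>G\<^esub> = carrier R"
    and act_one: "r \<in> carrier R \<Longrightarrow> \<alpha> \<one>\<^bsub>G\<^esub> r = r"
    and act_dom: "\<lbrakk>g \<in> carrier G; h \<in> carrier G\<rbrakk> \<Longrightarrow>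
      \<alpha> g ` (D (inv\<^bsub>G\<^esub> g) \<cdot>\<^bsub>R\<^esub> D h) = D g \<cdot>\<^bsub>R\<^esub> D (g \<otimes>\<^bsub>G\<^esub> h)"
    and act_act: "\<lbrakk>g \<in> carrier G; h \<in> carrier G;
        t \<in> D (inv\<^bsub>G\<^esub> h) \<cdot>\<^bsub>R\<^esub> D (inv\<^bsub>G\<^esub> (g \<otimes>\<^bsub>G\<^esub> h))\<rbrakk> \<Longrightarrow>
      \<alpha> g (\<alpha> h t) = \<alpha> (g \<otimes>\<^bsub>G\<^esub> h) t"

text \<open>\<^const>\<open>iso\<close> only speaks about multiplication, so on ideals it means semigroup isomorphism.\<close>

locale monoid_partial_action = G?: group G + T?: comm_monoid T
  for G :: "('g, 'x) monoid_scheme" and T :: "('t, 'y) monoid_scheme" +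
  fixes X :: "'g \<Rightarrow> 't set" and \<beta> :: "'g \<Rightarrow> 't \<Rightarrow> 't"
  assumes dom_subset: "g \<in> carrier G \<Longrightarrow> X g \<subseteq> carrier T"
    and dom_nonempty: "g \<in> carrier G \<Longrightarrow> X g \<noteq> {}"
    and dom_ideal: "\<lbrakk>g \<in> carrier G; t \<in> carrier T; x \<in> X g\<rbrakk> \<Longrightarrow> t \<otimes>\<^bsub>T\<^esub> x \<in> X g"
    and act_iso: "g \<in> carrier G \<Longrightarrow>
      \<beta> g \<in> iso (T\<lparr>carrier := X (inv\<^bsub>G\<^esub> g)\<rparr>) (T\<lparr>carrier := X g\<rparr>)"
    and dom_one: "X \<one>\<^bsub>G\<^esub> = carrier T"
    and act_one: "t \<in> carrier T \<Longrightarrow> \<beta> \<one>\<^bsub>G\<^esub> t = t"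
    and act_dom: "\<lbrakk>g \<in> carrier G; h \<in> carrier G\<rbrakk> \<Longrightarrow>
      \<beta> g ` (X (inv\<^bsub>G\<^esub> g) <#>\<^bsub>T\<^esub> X h) = X g <#>\<^bsub>T\<^esub> X (g \<otimes>\<^bsub>G\<^esub> h)"
    and act_act: "\<lbrakk>g \<in> carrier G; h \<in> carrier G;
        t \<in> X (inv\<^bsub>G\<^esub> h) <#>\<^bsub>T\<^esub> X (inv\<^bsub>G\<^esub> (g \<otimes>\<^bsub>G\<^esub> h))\<rbrakk> \<Longrightarrow>
      \<beta> g (\<beta> h t) = \<beta> (g \<otimes>\<^bsub>G\<^esub> h) t"


section \<open>Modules\<close>

text \<open>
  Module records inherit fields \<^const>\<open>mult\<close> and \<^const>\<open>one\<close> from rings; they play no role for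
  modules and are left \<^const>\<open>undefined\<close> below.
\<close>

definition module_homs ::
    "('a, 'b) ring_scheme \<Rightarrow> ('a, 'm) module \<Rightarrow> ('a, 'n) module \<Rightarrow> ('m \<Rightarrow> 'n) set" where
  "module_homs R M N = {f \<in> carrier M \<rightarrow> carrier N.
     (\<forall>x\<in>carrier M. \<forall>y\<in>carrier M. f (x \<oplus>\<^bsub>M\<^esub> y) = f x \<oplus>\<^bsub>N\<^esub> f y) \<and>
     (\<forall>r\<in>carrier R. \<forall>x\<in>carrier M. f (r \<odot>\<^bsub>M\<^esub> x) = r \<odot>\<^bsub>N\<^esub> f x)}"

definition module_isomorphic ::
    "('a, 'b) ring_scheme \<Rightarrow> ('a, 'm) module \<Rightarrow> ('a, 'n) module \<Rightarrow> bool" where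
  "module_isomorphic R M N \<longleftrightarrow>
     (\<exists>f \<in> module_homs R M N. bij_betw f (carrier M) (carrier N))"

definition ideal_module :: "('a, 'b) ring_scheme \<Rightarrow> 'a set \<Rightarrow> ('a, 'a) module" where
  "ideal_module R I =
     \<lparr>carrier = I, mult = undefined, one = undefined, zero = \<zero>\<^bsub>R\<^esub>, add = add R, smult = mult R\<rparr>"

definition gen_submodule ::
    "('a, 'b) ring_scheme \<Rightarrow> ('a, 'm) module \<Rightarrow> 'm set \<Rightarrow> 'm set" where
  "gen_submodule R M S = \<Inter>{N. submodule N R M \<and> S \<subseteq> N}"

definition quot_module :: "('a, 'm) module \<Rightarrow> 'm set \<Rightarrow> ('a, 'm set) module" where
  "quot_module M N =
     \<lparr>carrier = a_rcosets\<^bsub>M\<^esub> N, mult = undefined, one = undefined, zero = N, add = set_add M,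
      smult = (\<lambda>r A. \<Union>x\<in>A. N +>\<^bsub>M\<^esub> (r \<odot>\<^bsub>M\<^esub> x))\<rparr>"

text \<open>The free module with basis \<open>S\<close>: finitely supported functions on \<open>S\<close>, extended by zero.\<close>

definition free_module :: "('a, 'b) ring_scheme \<Rightarrow> 's set \<Rightarrow> ('a, 's \<Rightarrow> 'a) module" where
  "free_module R S =
     \<lparr>carrier = {f. (\<forall>s. f s \<in> carrier R) \<and> (\<forall>s. s \<notin> S \<longrightarrow> f s = \<zero>\<^bsub>R\<^esub>) \<and>
                    finite {s. f s \<noteq> \<zero>\<^bsub>R\<^esub>}},
      mult = undefined, one = undefined, zero = (\<lambda>_. \<zero>\<^bsub>R\<^esub>),
      add = (\<lambda>f g s. f s \<oplus>\<^bsub>R\<^esub> g s), smult = (\<lambda>r f s. r \<otimes>\<^bsub>R\<^esub> f s)\<rparr>"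

definition free_basis :: "('a, 'b) ring_scheme \<Rightarrow> 's \<Rightarrow> 's \<Rightarrow> 'a" where
  "free_basis R s = (\<lambda>t. if t = s then \<one>\<^bsub>R\<^esub> else \<zero>\<^bsub>R\<^esub>)"

definition tensor_relations ::
    "('a, 'b) ring_scheme \<Rightarrow> ('a, 'm) module \<Rightarrow> ('a, 'n) module \<Rightarrow> ('m \<times> 'n \<Rightarrow> 'a) set" where
  "tensor_relations R M N =
     (let F = free_module R (carrier M \<times> carrier N); b = (\<lambda>x y. free_basis R (x, y)) in
       {b (x \<oplus>\<^bsub>M\<^esub> x') y \<ominus>\<^bsub>F\<^esub> (b x y \<oplus>\<^bsub>F\<^esub> b x' y) | x x' y.
          x \<in> carrier M \<and> x' \<in> carrier M \<and> y \<in> carrier N} \<union>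
       {b x (y \<oplus>\<^bsub>N\<^esub> y') \<ominus>\<^bsub>F\<^esub> (b x y \<oplus>\<^bsub>F\<^esub> b x y') | x y y'.
          x \<in> carrier M \<and> y \<in> carrier N \<and> y' \<in> carrier N} \<union>
       {b (r \<odot>\<^bsub>M\<^esub> x) y \<ominus>\<^bsub>F\<^esub> (r \<odot>\<^bsub>F\<^esub> b x y) | r x y.
          r \<in> carrier R \<and> x \<in> carrier M \<and> y \<in> carrier N} \<union>
       {b x (r \<odot>\<^bsub>N\<^esub> y) \<ominus>\<^bsub>F\<^esub> (r \<odot>\<^bsub>F\<^esub> b x y) | r x y.
          r \<in> carrier R \<and> x \<in> carrier M \<and> y \<in> carrier N})"

definition tensor_module ::
    "('a, 'b) ring_scheme \<Rightarrow> ('a, 'm) module \<Rightarrow> ('a, 'n) module \<Rightarrow>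
     ('a, ('m \<times> 'n \<Rightarrow> 'a) set) module" where
  "tensor_module R M N =
     (let F = free_module R (carrier M \<times> carrier N)
      in quot_module F (gen_submodule R F (tensor_relations R M N)))"

definition fin_gen_module :: "('a, 'b) ring_scheme \<Rightarrow> ('a, 'm) module \<Rightarrow> bool" where
  "fin_gen_module R E \<longleftrightarrow>
     (\<exists>S. finite S \<and> S \<subseteq> carrier E \<and> gen_submodule R E S = carrier E)"

text \<open>
  Projective means: isomorphic to a direct summand \<open>P\<close> of a free module \<open>F\<close>. The basis of \<open>F\<close> can
  be taken in the type of the elements of \<open>E\<close>, since the canonical surjection onto \<open>E\<close> from the
  free module with basis \<open>carrier E\<close> splits when \<open>E\<close> is projective.
\<close>

definition projective_module :: "('a, 'b) ring_scheme \<Rightarrow> ('a, 'm) module \<Rightarrow> bool" where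
  "projective_module R E \<longleftrightarrow>
     (\<exists>(S :: 'm set) P Q. let F = free_module R S in
        submodule P R F \<and> submodule Q R F \<and> P \<inter> Q = {\<zero>\<^bsub>F\<^esub>} \<and> P <+>\<^bsub>F\<^esub> Q = carrier F \<and>
        module_isomorphic R E (F\<lparr>carrier := P\<rparr>))"

text \<open>The algebra of \<open>R\<close>-endomorphisms of \<open>E\<close>, with composition as multiplication.\<close>

definition End_algebra ::
    "('a, 'b) ring_scheme \<Rightarrow> ('a, 'm) module \<Rightarrow> ('a, 'm \<Rightarrow> 'm) module" where
  "End_algebra R E =
     \<lparr>carrier = module_homs R E E \<inter> extensional (carrier E),
      mult = compose (carrier E), one = (\<lambda>x\<in>carrier E. x),
      zero = (\<lambda>x\<in>carrier E. \<zero>\<^bsub>E\<^esub>), add = (\<lambda>f g. \<lambda>x\<in>carrier E. f x \<oplus>\<^bsub>E\<^esub> g x),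
      smult = (\<lambda>r f. \<lambda>x\<in>carrier E. r \<odot>\<^bsub>E\<^esub> f x)\<rparr>"

definition picS_module :: "('a, 'b) ring_scheme \<Rightarrow> ('a, 'm) module \<Rightarrow> bool" where
  "picS_module R E \<longleftrightarrow>
     module R E \<and> fin_gen_module R E \<and> projective_module R E \<and>
     (\<exists>\<phi> \<in> ring_hom R (End_algebra R E).
        (\<forall>r\<in>carrier R. \<forall>s\<in>carrier R. \<phi> (r \<otimes>\<^bsub>R\<^esub> s) = r \<odot>\<^bsub>End_algebra R E\<^esub> \<phi> s) \<and>
        \<phi> ` carrier R = carrier (End_algebra R E))"


section \<open>The monoid of isomorphism classes\<close>

text \<open>
  Isomorphism classes are taken among modules whose elements are lists over \<open>R\<close>. This loses no
  finitely generated module \<open>E\<close>, whatever the type of its elements: sending \<open>x\<close> to a list of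
  coefficients expressing \<open>x\<close> in fixed generators is an injection of \<open>E\<close> into the lists over \<open>R\<close>,
  along which the structure of \<open>E\<close> can be transported. So \<open>module_class R E\<close> makes sense
  for modules such as tensor products, whose elements are not lists.
\<close>

type_synonym 'a module_class = "('a, 'a list) module set"

definition module_class :: "('a, 'b) ring_scheme \<Rightarrow> ('a, 'm) module \<Rightarrow> 'a module_class" where
  "module_class R E = {M. module R M \<and> module_isomorphic R M E}"

text \<open>
  The union over all representatives is a union of equal sets, so the product of the classes
  of \<open>E\<close> and \<open>F\<close> is the class of their tensor product.
\<close>

definition PicS :: "('a, 'b) ring_scheme \<Rightarrow> 'a module_class monoid" where
  "PicS R =
     \<lparr>carrier = {module_class R E | E :: ('a, 'a list) module. picS_module R E},
      mult = (\<lambda>c d. \<Union>E\<in>c. \<Union>F\<in>d. module_class R (tensor_module R E F)),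
      one = module_class R (ideal_module R (carrier R))\<rparr>"

text \<open>\<open>E = 1\<^sub>g E\<close>, with \<open>e\<close> in the role of \<open>1\<^sub>g\<close>.\<close>

definition unital_for :: "'a \<Rightarrow> ('a, 'm) module \<Rightarrow> bool" where
  "unital_for e E \<longleftrightarrow> carrier E = (\<lambda>x. e \<odot>\<^bsub>E\<^esub> x) ` carrier E"

text \<open>The module \<open>E\<^sub>g\<close>.\<close>

definition twist_module ::
    "('g, 'x) monoid_scheme \<Rightarrow> ('a, 'b) ring_scheme \<Rightarrow> ('g \<Rightarrow> 'a) \<Rightarrow> ('g \<Rightarrow> 'a \<Rightarrow> 'a) \<Rightarrow>
     'g \<Rightarrow> ('a, 'm) module \<Rightarrow> ('a, 'm) module" where
  "twist_module G R u \<alpha> g E =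
     E\<lparr>smult := (\<lambda>r x. \<alpha> (inv\<^bsub>G\<^esub> g) (r \<otimes>\<^bsub>R\<^esub> u g) \<odot>\<^bsub>E\<^esub> x)\<rparr>"

definition picS_dom :: "('a, 'b) ring_scheme \<Rightarrow> ('g \<Rightarrow> 'a set) \<Rightarrow> 'g \<Rightarrow> 'a module_class set" where
  "picS_dom R D g = module_class R (ideal_module R (D g)) <#\<^bsub>PicS R\<^esub> carrier (PicS R)"

text \<open>As for the product, the union ranges over all representatives of the class.\<close>

definition picS_act ::
    "('g, 'x) monoid_scheme \<Rightarrow> ('a, 'b) ring_scheme \<Rightarrow> ('g \<Rightarrow> 'a) \<Rightarrow> ('g \<Rightarrow> 'a \<Rightarrow> 'a) \<Rightarrow>
     'g \<Rightarrow> 'a module_class \<Rightarrow> 'a module_class" where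
  "picS_act G R u \<alpha> g c = (\<Union>E\<in>c. module_class R (twist_module G R u \<alpha> g E))"

end

theory Submission
  imports Defs
begin

text \<open>
  The classes in \<open>PicS(R)\<close> are handled through dual bases. A module \<open>E\<close> is finitely generated and
  projective iff there are finitely many vectors \<open>x\<^sub>i\<close> and functionals \<open>f\<^sub>i\<close> with
  \<open>v = \<Sum> f\<^sub>i(v) x\<^sub>i\<close> for all \<open>v\<close> (\<open>dual_basis_of_projective\<close>, \<open>projective_of_dual_basis\<close>). An
  algebra homomorphism \<open>R \<rightarrow> End(E)\<close> can only send \<open>r\<close> to multiplication by \<open>r\<close>, so the remaining
  condition says that all endomorphisms of \<open>E\<close> are scalars. Both conditions are statements about
  elements of \<open>E\<close> and \<open>R\<close> that are easy to transport.

  Between modules with dual bases, a tensor product \<open>T\<close> is recognized by three properties: the map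
  \<open>(x, y) \<mapsto> x \<otimes> y\<close> is bilinear, the elements \<open>x \<otimes> y\<close> generate \<open>T\<close> additively, and for functionals \<open>f\<close>,
  \<open>g\<close> there is a functional \<open>f \<otimes> g\<close> on \<open>T\<close>. These imply the universal property (\<open>tensor_lift\<close>), hence
  uniqueness and associativity, and they hold for the quotient of the free module on \<open>E \<times> F\<close>
  (\<open>tensor_module_is_tensor\<close>). Tensor products of modules with scalar endomorphisms have scalar
  endomorphisms (\<open>picS_tensor\<close>), so \<open>PicS(R)\<close> is a commutative monoid (\<open>PicS_comm_monoid\<close>).

  For an idempotent \<open>e\<close> and \<open>E = eE\<close> one has \<open>Re \<otimes> E = E\<close>. Thus \<open>[Re]\<close> is an idempotent of the
  monoid, its ideal consists of the classes on which \<open>e\<close> acts as the identity, and a product of two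
  such ideals is their intersection (\<open>unital_classes_product\<close>).

  The module \<open>E\<^sub>g\<close> is \<open>E\<close> with scalars restricted along \<open>\<rho>\<^sub>g(r) = \<alpha>\<^bsub>g\<inverse>\<^esub>(r 1\<^sub>g)\<close>. Since \<open>\<rho>\<^sub>g\<close> identifies
  \<open>R 1\<^sub>g\<close> with \<open>R 1\<^bsub>g\<inverse>\<^esub>\<close>, the restriction preserves dual bases, scalar endomorphisms and tensor
  products, and is undone by \<open>\<rho>\<^bsub>g\<inverse>\<^esub>\<close>. What is left are two identities in \<open>R\<close>:
  \<open>\<rho>\<^sub>g(1\<^sub>h) = 1\<^bsub>g\<inverse>\<^esub> 1\<^bsub>g\<inverse>h\<^esub>\<close> (\<open>twist_scalar_unit\<close>), which locates the image of the domains, and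
  \<open>\<rho>\<^sub>h(\<rho>\<^sub>g(r)) = \<rho>\<^bsub>gh\<^esub>(r) 1\<^bsub>h\<inverse>\<^esub>\<close> (\<open>twist_scalar_compose\<close>), which gives \<open>(E\<^sub>h)\<^sub>g = E\<^bsub>gh\<^esub>\<close> because \<open>1\<^bsub>h\<inverse>\<^esub>\<close>
  acts on \<open>E\<close> as the identity.
\<close>

section \<open>Module homomorphisms and isomorphisms\<close>

lemma module_hom_closed: "h \<in> module_homs R M N \<Longrightarrow> x \<in> carrier M \<Longrightarrow> h x \<in> carrier N"
  by (auto simp: module_homs_def)

lemma module_hom_add:
  "\<lbrakk>h \<in> module_homs R M N; x \<in> carrier M; y \<in> carrier M\<rbrakk> \<Longrightarrow> h (x \<oplus>\<^bsub>M\<^esub> y) = h x \<oplus>\<^bsub>N\<^esub> h y"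
  by (auto simp: module_homs_def)

lemma module_hom_smult:
  "\<lbrakk>h \<in> module_homs R M N; r \<in> carrier R; x \<in> carrier M\<rbrakk> \<Longrightarrow> h (r \<odot>\<^bsub>M\<^esub> x) = r \<odot>\<^bsub>N\<^esub> h x"
  by (auto simp: module_homs_def)

lemma module_homI:
  "\<lbrakk>\<And>x. x \<in> carrier M \<Longrightarrow> h x \<in> carrier N;
    \<And>x y. \<lbrakk>x \<in> carrier M; y \<in> carrier M\<rbrakk> \<Longrightarrow> h (x \<oplus>\<^bsub>M\<^esub> y) = h x \<oplus>\<^bsub>N\<^esub> h y;
    \<And>r x. \<lbrakk>r \<in> carrier R; x \<in> carrier M\<rbrakk> \<Longrightarrow> h (r \<odot>\<^bsub>M\<^esub> x) = r \<odot>\<^bsub>N\<^esub> h x\<rbrakk>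
   \<Longrightarrow> h \<in> module_homs R M N"
  by (auto simp: module_homs_def)

lemma module_hom_compose:
  "\<lbrakk>h \<in> module_homs R M N; k \<in> module_homs R N P\<rbrakk> \<Longrightarrow> (\<lambda>x. k (h x)) \<in> module_homs R M P"
  by (auto simp: module_homs_def Pi_def)

lemma module_hom_zero:
  assumes "module R M" "module R N" "h \<in> module_homs R M N"
  shows "h \<zero>\<^bsub>M\<^esub> = \<zero>\<^bsub>N\<^esub>"
proof -
  interpret M: module R M by fact
  interpret N: module R N by fact
  have "h (\<zero>\<^bsub>R\<^esub> \<odot>\<^bsub>M\<^esub> \<zero>\<^bsub>M\<^esub>) = \<zero>\<^bsub>R\<^esub> \<odot>\<^bsub>N\<^esub> h \<zero>\<^bsub>M\<^esub>"
    using assms(3) by (rule module_hom_smult) auto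
  then show ?thesis using module_hom_closed[OF assms(3)] by simp
qed

lemma module_hom_finsum:
  assumes M: "module R M" and N: "module R N" and h: "h \<in> module_homs R M N"
    and x: "\<And>i. i \<in> I \<Longrightarrow> x i \<in> carrier M"
  shows "h (finsum M x I) = finsum N (\<lambda>i. h (x i)) I"
proof -
  interpret M: module R M by fact
  interpret N: module R N by fact
  show ?thesis using x
  proof (induction I rule: infinite_finite_induct)
    case (insert i I)
    then show ?case
      by (simp add: Pi_def module_hom_closed[OF h] module_hom_add[OF h])
  qed (simp_all add: module_hom_zero[OF M N h])
qed

lemma module_isomorphicI:
  assumes "h \<in> module_homs R M N" "k \<in> module_homs R N M"
    and "\<And>x. x \<in> carrier M \<Longrightarrow> k (h x) = x" "\<And>y. y \<in> carrier N \<Longrightarrow> h (k y) = y"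
  shows "module_isomorphic R M N"
  unfolding module_isomorphic_def
  by (rule bexI[OF _ assms(1)], rule bij_betw_byWitness[where f' = k])
     (use assms module_hom_closed in \<open>fastforce+\<close>)

lemma module_isomorphicE:
  assumes "module_isomorphic R M N" "module R M"
  obtains h k where "h \<in> module_homs R M N" "k \<in> module_homs R N M"
    "\<And>x. x \<in> carrier M \<Longrightarrow> k (h x) = x" "\<And>y. y \<in> carrier N \<Longrightarrow> h (k y) = y"
proof -
  interpret M: module R M by fact
  obtain h where h: "h \<in> module_homs R M N" and b: "bij_betw h (carrier M) (carrier N)"
    using assms(1) by (auto simp: module_isomorphic_def)
  define k where "k = the_inv_into (carrier M) h"
  have kh: "k (h x) = x" if "x \<in> carrier M" for x
    using b that by (simp add: k_def bij_betw_def the_inv_into_f_f)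
  have hk: "h (k y) = y" if "y \<in> carrier N" for y
    using b that by (simp add: k_def bij_betw_def f_the_inv_into_f)
  have kc: "k y \<in> carrier M" if "y \<in> carrier N" for y
    using b that by (metis bij_betw_def image_iff kh)
  have "k \<in> module_homs R N M"
  proof (rule module_homI)
    fix y z assume y: "y \<in> carrier N" and z: "z \<in> carrier N"
    show "k (y \<oplus>\<^bsub>N\<^esub> z) = k y \<oplus>\<^bsub>M\<^esub> k z"
      using kh[of "k y \<oplus>\<^bsub>M\<^esub> k z"] module_hom_add[OF h, of "k y" "k z"] kc hk y z by simp
  next
    fix r y assume r: "r \<in> carrier R" and y: "y \<in> carrier N"
    show "k (r \<odot>\<^bsub>N\<^esub> y) = r \<odot>\<^bsub>M\<^esub> k y"
      using kh[of "r \<odot>\<^bsub>M\<^esub> k y"] module_hom_smult[OF h r, of "k y"] kc hk r y by simp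
  qed (rule kc)
  then show thesis using that h kh hk by blast
qed

lemma module_isomorphic_refl: "module_isomorphic R M M"
  by (rule module_isomorphicI[where h = "\<lambda>x. x" and k = "\<lambda>x. x"]) (auto intro: module_homI)

lemma module_isomorphic_sym:
  "module_isomorphic R M N \<Longrightarrow> module R M \<Longrightarrow> module_isomorphic R N M"
  by (erule module_isomorphicE) (auto intro: module_isomorphicI)

lemma module_isomorphic_trans:
  assumes "module_isomorphic R M N" "module_isomorphic R N P"
  shows "module_isomorphic R M P"
proof -
  obtain h k where "h \<in> module_homs R M N" "bij_betw h (carrier M) (carrier N)"
    "k \<in> module_homs R N P" "bij_betw k (carrier N) (carrier P)"
    using assms by (auto simp: module_isomorphic_def)
  then have "(\<lambda>x. k (h x)) \<in> module_homs R M P" "bij_betw (k \<circ> h) (carrier M) (carrier P)"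
    by (auto intro: module_hom_compose bij_betw_trans)
  then show ?thesis unfolding module_isomorphic_def comp_def by blast
qed

section \<open>Dual bases\<close>

abbreviation dual :: "('a, 'b) ring_scheme \<Rightarrow> ('a, 'm) module \<Rightarrow> ('m \<Rightarrow> 'a) set" where
  "dual R E \<equiv> module_homs R E (ideal_module R (carrier R))"

lemma ideal_module_simps [simp]:
  "carrier (ideal_module R I) = I" "add (ideal_module R I) = add R"
  "zero (ideal_module R I) = zero R" "smult (ideal_module R I) = mult R"
  by (simp_all add: ideal_module_def)

lemma (in cring) ideal_module_is_module:
  assumes "ideal I R"
  shows "module R (ideal_module R I)"
proof -
  interpret ideal I R by fact
  show ?thesis
  proof (rule moduleI)
    show "abelian_group (ideal_module R I)"
    proof (rule abelian_groupI)
      fix x assume "x \<in> carrier (ideal_module R I)"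
      then show "\<exists>y\<in>carrier (ideal_module R I). y \<oplus>\<^bsub>ideal_module R I\<^esub> x = \<zero>\<^bsub>ideal_module R I\<^esub>"
        by (intro bexI[of _ "\<ominus> x"]) (auto simp: l_neg)
    qed (auto simp: a_ac)
  qed (auto simp: is_cring I_l_closed l_distr r_distr m_assoc)
qed

lemma (in cring) regular_module_is_module: "module R (ideal_module R (carrier R))"
  by (rule ideal_module_is_module) (rule oneideal)

text \<open>
  The index type \<open>'i\<close> is independent of the type of the vectors: tensor products come with dual
  bases that are indexed by pairs.
\<close>

definition dual_basis ::
    "('a, 'b) ring_scheme \<Rightarrow> ('a, 'm) module \<Rightarrow> 'i set \<Rightarrow> ('i \<Rightarrow> 'm) \<Rightarrow> ('i \<Rightarrow> 'm \<Rightarrow> 'a) \<Rightarrow> bool" where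
  "dual_basis R E I x f \<longleftrightarrow> finite I \<and> x \<in> I \<rightarrow> carrier E \<and> f \<in> I \<rightarrow> dual R E \<and>
     (\<forall>v\<in>carrier E. v = finsum E (\<lambda>i. f i v \<odot>\<^bsub>E\<^esub> x i) I)"

lemma dual_basisD:
  assumes "dual_basis R E I x f"
  shows "finite I" "\<And>i. i \<in> I \<Longrightarrow> x i \<in> carrier E" "\<And>i. i \<in> I \<Longrightarrow> f i \<in> dual R E"
    "\<And>i v. i \<in> I \<Longrightarrow> v \<in> carrier E \<Longrightarrow> f i v \<in> carrier R"
    "\<And>v. v \<in> carrier E \<Longrightarrow> finsum E (\<lambda>i. f i v \<odot>\<^bsub>E\<^esub> x i) I = v"
  using assms by (auto simp: dual_basis_def module_homs_def Pi_def)

lemma (in module) smult_finsum_left: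
  assumes "\<And>i. i \<in> I \<Longrightarrow> r i \<in> carrier R" "v \<in> carrier M"
  shows "finsum R r I \<odot>\<^bsub>M\<^esub> v = finsum M (\<lambda>i. r i \<odot>\<^bsub>M\<^esub> v) I"
  using assms(1)
proof (induction I rule: infinite_finite_induct)
  case (insert i I)
  then show ?case using assms(2) by (simp add: Pi_def smult_l_distr)
qed (use assms(2) in simp_all)

lemma finsum_ideal_module:
  "finsum (ideal_module R (carrier R)) f I = finsum R f I"
  by (simp add: finsum_def finprod_def)

lemma (in abelian_monoid) finsum_Times:
  assumes "finite I" "finite J" "\<And>i j. \<lbrakk>i \<in> I; j \<in> J\<rbrakk> \<Longrightarrow> f (i, j) \<in> carrier G"
  shows "finsum G f (I \<times> J) = finsum G (\<lambda>i. finsum G (\<lambda>j. f (i, j)) J) I"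
  using assms(1,3)
proof (induction I)
  case (insert i I)
  have "insert i I \<times> J = Pair i ` J \<union> I \<times> J" by auto
  moreover have "finsum G f (Pair i ` J \<union> I \<times> J) = finsum G f (Pair i ` J) \<oplus> finsum G f (I \<times> J)"
    using insert assms(2) by (intro finsum_Un_disjoint) auto
  moreover have "finsum G f (Pair i ` J) = finsum G (\<lambda>j. f (i, j)) J"
    using insert by (intro finsum_reindex) (auto simp: inj_on_def)
  ultimately show ?case
    using insert by (simp add: Pi_def)
qed simp

text \<open>
  Given a dual basis, every linear map \<open>h\<close> has this form with \<open>w\<^sub>i = h(x\<^sub>i)\<close>; conversely, a choice of
  vectors \<open>w\<^sub>i\<close> for some functionals produces a linear map.
\<close>

lemma dual_combination_hom:
  assumes E: "module R E" and W: "module R W"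
    and f: "\<And>i. i \<in> I \<Longrightarrow> f i \<in> dual R E" and w: "\<And>i. i \<in> I \<Longrightarrow> w i \<in> carrier W"
  shows "(\<lambda>v. finsum W (\<lambda>i. f i v \<odot>\<^bsub>W\<^esub> w i) I) \<in> module_homs R E W"
proof (cases "finite I")
  case True
  interpret E: module R E by fact
  interpret W: module R W by fact
  note [simp] = w and fc = module_hom_closed[OF f, simplified]
  show ?thesis
  proof (rule module_homI)
    fix u v assume "u \<in> carrier E" "v \<in> carrier E"
    then show "finsum W (\<lambda>i. f i (u \<oplus>\<^bsub>E\<^esub> v) \<odot>\<^bsub>W\<^esub> w i) I
      = finsum W (\<lambda>i. f i u \<odot>\<^bsub>W\<^esub> w i) I \<oplus>\<^bsub>W\<^esub> finsum W (\<lambda>i. f i v \<odot>\<^bsub>W\<^esub> w i) I"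
      by (intro trans[OF W.finsum_cong' W.finsum_addf])
         (auto simp: fc module_hom_add[OF f] W.smult_l_distr)
  next
    fix r v assume "r \<in> carrier R" "v \<in> carrier E"
    then show "finsum W (\<lambda>i. f i (r \<odot>\<^bsub>E\<^esub> v) \<odot>\<^bsub>W\<^esub> w i) I
      = r \<odot>\<^bsub>W\<^esub> finsum W (\<lambda>i. f i v \<odot>\<^bsub>W\<^esub> w i) I"
      by (subst W.finsum_smult_ldistr[OF True])
         (auto simp: fc module_hom_smult[OF f] W.smult_assoc1 intro!: W.finsum_cong')
  qed (auto simp: fc)
next
  case False
  interpret W: module R W by fact
  show ?thesis using False by (auto intro!: module_homI)
qed

section \<open>Free modules and finitely generated projective modules\<close>

lemma free_module_simps [simp]:
  "carrier (free_module R S) = {f. (\<forall>s. f s \<in> carrier R) \<and> (\<forall>s. s \<notin> S \<longrightarrow> f s = \<zero>\<^bsub>R\<^esub>) \<and>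
     finite {s. f s \<noteq> \<zero>\<^bsub>R\<^esub>}}"
  "add (free_module R S) = (\<lambda>f g s. f s \<oplus>\<^bsub>R\<^esub> g s)"
  "zero (free_module R S) = (\<lambda>_. \<zero>\<^bsub>R\<^esub>)"
  "smult (free_module R S) = (\<lambda>r f s. r \<otimes>\<^bsub>R\<^esub> f s)"
  by (simp_all add: free_module_def)

lemma (in cring) free_module_is_module:
  fixes S :: "'s set"
  shows "module R (free_module R S)"
proof (rule moduleI)
  have fin_add: "finite {s. f s \<oplus> g s \<noteq> \<zero>}"
    if "finite {s. f s \<noteq> \<zero>}" "finite {s. g s \<noteq> \<zero>}" for f g :: "'s \<Rightarrow> 'a"
    by (rule finite_subset[OF _ finite_UnI[OF that]]) auto
  show "abelian_group (free_module R S)"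
  proof (rule abelian_groupI)
    fix f assume f: "f \<in> carrier (free_module R S)"
    have "finite {s. \<ominus> f s \<noteq> \<zero>}"
      by (rule finite_subset[of _ "{s. f s \<noteq> \<zero>}"]) (use f in auto)
    with f show "\<exists>g\<in>carrier (free_module R S). g \<oplus>\<^bsub>free_module R S\<^esub> f = \<zero>\<^bsub>free_module R S\<^esub>"
      by (intro bexI[of _ "\<lambda>s. \<ominus> f s"]) (auto simp: l_neg)
  qed (auto simp: a_ac fin_add)
  show "a \<odot>\<^bsub>free_module R S\<^esub> f \<in> carrier (free_module R S)"
    if "a \<in> carrier R" "f \<in> carrier (free_module R S)" for a f
  proof -
    have "finite {s. a \<otimes> f s \<noteq> \<zero>}"
      by (rule finite_subset[of _ "{s. f s \<noteq> \<zero>}"]) (use that in auto)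
    then show ?thesis using that by auto
  qed
qed (auto simp: is_cring l_distr r_distr m_assoc)

lemma (in cring) free_basis_closed: "s \<in> S \<Longrightarrow> free_basis R s \<in> carrier (free_module R S)"
  by (auto simp: free_basis_def)

lemma (in cring) evaluation_in_dual: "(\<lambda>v. v s) \<in> dual R (free_module R S)"
  by (auto intro!: module_homI)

lemma (in cring) free_module_expansion:
  assumes v: "v \<in> carrier (free_module R S)" and I: "finite I" "{s. v s \<noteq> \<zero>} \<subseteq> I" "I \<subseteq> S"
  shows "v = finsum (free_module R S) (\<lambda>s. v s \<odot>\<^bsub>free_module R S\<^esub> free_basis R s) I"
proof
  fix t
  interpret F: module R "free_module R S" by (rule free_module_is_module)
  note ev = module_hom_finsum[OF free_module_is_module regular_module_is_module evaluation_in_dual,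
      unfolded finsum_ideal_module]
  have vc: "v s \<in> carrier R" for s using v by auto
  have "finsum (free_module R S) (\<lambda>s. v s \<odot>\<^bsub>free_module R S\<^esub> free_basis R s) I t
    = finsum R (\<lambda>s. (v s \<odot>\<^bsub>free_module R S\<^esub> free_basis R s) t) I"
    using I by (intro ev F.smult_closed free_basis_closed vc) auto
  also have "\<dots> = finsum R (\<lambda>s. if t = s then v s else \<zero>) I"
    by (rule finsum_cong') (auto simp: free_basis_def vc)
  also have "\<dots> = v t"
  proof (cases "t \<in> I")
    case True
    then show ?thesis using I by (intro finsum_singleton) (auto simp: vc)
  next
    case False
    then have "finsum R (\<lambda>s. if t = s then v s else \<zero>) I = finsum R (\<lambda>s. \<zero>) I"
      by (intro finsum_cong') auto
    then show ?thesis using False I by (auto simp: eq_commute)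
  qed
  finally show "v t = finsum (free_module R S) (\<lambda>s. v s \<odot>\<^bsub>free_module R S\<^esub> free_basis R s) I t" ..
qed

lemma (in module) submodule_finsum:
  assumes "submodule N R M" "\<And>i. i \<in> I \<Longrightarrow> x i \<in> N"
  shows "finsum M x I \<in> N"
proof -
  note N = submoduleE[OF assms(1)]
  have zero: "\<zero>\<^bsub>M\<^esub> \<in> N"
    using N(2) N(4)[OF R.zero_closed] N(1) by (metis ex_in_conv smult_l_null subset_iff)
  show ?thesis using assms(2)
  proof (induction I rule: infinite_finite_induct)
    case (insert i I)
    have "x i \<in> carrier M" "x \<in> I \<rightarrow> carrier M" using insert N(1) by auto
    then have "finsum M x (insert i I) = x i \<oplus>\<^bsub>M\<^esub> finsum M x I"
      using insert by (intro finsum_insert)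
    then show ?case using insert N(5) by auto
  qed (simp_all add: zero)
qed

lemma (in module) carrier_is_submodule: "submodule (carrier M) R M"
  by (rule submoduleI) auto

text \<open>
  The decomposition of \<open>x\<close> into parts from \<open>P\<close> and \<open>Q\<close> is unique, so its first part depends linearly on
  \<open>x\<close>.
\<close>

lemma complement_projection:
  fixes M :: "('a, 'm) module"
  assumes M: "module R M" and P: "submodule P R M" and Q: "submodule Q R M"
    and PQ: "P \<inter> Q = {\<zero>\<^bsub>M\<^esub>}" "P <+>\<^bsub>M\<^esub> Q = carrier M"
  obtains p where "p \<in> module_homs R M (M\<lparr>carrier := P\<rparr>)" "\<And>v. v \<in> P \<Longrightarrow> p v = v"
proof -
  interpret module R M by (rule M)
  note P' = submoduleE[OF P] and Q' = submoduleE[OF Q]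
  have Pc: "v \<in> carrier M" if "v \<in> P" for v using that P'(1) by auto
  have Qc: "v \<in> carrier M" if "v \<in> Q" for v using that Q'(1) by auto
  have "\<exists>v. \<exists>w. v \<in> P \<and> w \<in> Q \<and> x = v \<oplus>\<^bsub>M\<^esub> w" if "x \<in> carrier M" for x
    using that unfolding PQ(2)[symmetric] set_add_def' by blast
  then obtain p q where pq: "\<And>x. x \<in> carrier M \<Longrightarrow> p x \<in> P"
    "\<And>x. x \<in> carrier M \<Longrightarrow> q x \<in> Q" "\<And>x. x \<in> carrier M \<Longrightarrow> x = p x \<oplus>\<^bsub>M\<^esub> q x"
    by metis
  have uniq: "v = v'" if v: "v \<in> P" "v' \<in> P" "w \<in> Q" "w' \<in> Q" "v \<oplus>\<^bsub>M\<^esub> w = v' \<oplus>\<^bsub>M\<^esub> w'" for v v' w w'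
  proof -
    note c = Pc[OF v(1)] Pc[OF v(2)] Qc[OF v(3)] Qc[OF v(4)]
    have "v \<ominus>\<^bsub>M\<^esub> v' = (v \<oplus>\<^bsub>M\<^esub> w) \<ominus>\<^bsub>M\<^esub> w \<ominus>\<^bsub>M\<^esub> v'"
      using c by (simp add: a_minus_def M.a_assoc M.r_neg)
    also have "\<dots> = (v' \<ominus>\<^bsub>M\<^esub> v') \<oplus>\<^bsub>M\<^esub> (w' \<ominus>\<^bsub>M\<^esub> w)"
      unfolding v(5) a_minus_def using c by (simp add: M.a_ac)
    also have "\<dots> = w' \<ominus>\<^bsub>M\<^esub> w"
      using c by (simp add: a_minus_def M.r_neg)
    finally have eq: "v \<ominus>\<^bsub>M\<^esub> v' = w' \<ominus>\<^bsub>M\<^esub> w" .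
    have "v \<ominus>\<^bsub>M\<^esub> v' \<in> P" "w' \<ominus>\<^bsub>M\<^esub> w \<in> Q"
      using v P' Q' by (auto simp: a_minus_def)
    then have "v \<ominus>\<^bsub>M\<^esub> v' = \<zero>\<^bsub>M\<^esub>" using PQ(1) eq by auto
    moreover have "v = (v \<ominus>\<^bsub>M\<^esub> v') \<oplus>\<^bsub>M\<^esub> v'"
      using c by (simp add: a_minus_def M.a_assoc M.l_neg)
    ultimately show ?thesis using c by simp
  qed
  have "p \<in> module_homs R M (M\<lparr>carrier := P\<rparr>)"
  proof (rule module_homI, simp_all add: pq(1))
    fix x y assume x: "x \<in> carrier M" and y: "y \<in> carrier M"
    have "x \<oplus>\<^bsub>M\<^esub> y = (p x \<oplus>\<^bsub>M\<^esub> q x) \<oplus>\<^bsub>M\<^esub> (p y \<oplus>\<^bsub>M\<^esub> q y)"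
      using pq(3) x y by simp
    also have "\<dots> = (p x \<oplus>\<^bsub>M\<^esub> p y) \<oplus>\<^bsub>M\<^esub> (q x \<oplus>\<^bsub>M\<^esub> q y)"
      using Pc[OF pq(1)[OF x]] Pc[OF pq(1)[OF y]] Qc[OF pq(2)[OF x]] Qc[OF pq(2)[OF y]]
      by (simp add: M.a_ac)
    finally have eq: "p (x \<oplus>\<^bsub>M\<^esub> y) \<oplus>\<^bsub>M\<^esub> q (x \<oplus>\<^bsub>M\<^esub> y) = (p x \<oplus>\<^bsub>M\<^esub> p y) \<oplus>\<^bsub>M\<^esub> (q x \<oplus>\<^bsub>M\<^esub> q y)"
      using pq(3)[of "x \<oplus>\<^bsub>M\<^esub> y"] x y by (metis M.add.m_closed)
    then show "p (x \<oplus>\<^bsub>M\<^esub> y) = p x \<oplus>\<^bsub>M\<^esub> p y"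
      using x y by (intro uniq[OF _ _ _ _ eq]) (auto intro: pq P' Q')
  next
    fix r x assume r: "r \<in> carrier R" and x: "x \<in> carrier M"
    have "r \<odot>\<^bsub>M\<^esub> x = r \<odot>\<^bsub>M\<^esub> (p x \<oplus>\<^bsub>M\<^esub> q x)"
      using pq(3) x by simp
    also have "\<dots> = r \<odot>\<^bsub>M\<^esub> p x \<oplus>\<^bsub>M\<^esub> r \<odot>\<^bsub>M\<^esub> q x"
      using Pc[OF pq(1)[OF x]] Qc[OF pq(2)[OF x]] r by (simp add: smult_r_distr)
    finally have eq: "p (r \<odot>\<^bsub>M\<^esub> x) \<oplus>\<^bsub>M\<^esub> q (r \<odot>\<^bsub>M\<^esub> x) = r \<odot>\<^bsub>M\<^esub> p x \<oplus>\<^bsub>M\<^esub> r \<odot>\<^bsub>M\<^esub> q x"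
      using pq(3)[of "r \<odot>\<^bsub>M\<^esub> x"] r x by (metis smult_closed)
    then show "p (r \<odot>\<^bsub>M\<^esub> x) = r \<odot>\<^bsub>M\<^esub> p x"
      using r x by (intro uniq[OF _ _ _ _ eq]) (auto intro: pq P' Q')
  qed
  moreover have "p v = v" if "v \<in> P" for v
  proof -
    have "\<zero>\<^bsub>M\<^esub> \<in> Q" using PQ(1) by auto
    then show ?thesis
      using pq(3)[of v] Pc[OF that] by (intro uniq[of "p v" v "q v" "\<zero>\<^bsub>M\<^esub>"]) (auto intro: pq that)
  qed
  ultimately show thesis using that by blast
qed

text \<open>
  Let \<open>h\<close> embed \<open>E\<close> as a summand \<open>P\<close> of a free module, let \<open>p\<close> project onto \<open>P\<close> and let \<open>k\<close> invert \<open>h\<close>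
  on \<open>P\<close>. Applying \<open>k \<circ> p\<close> to the expansion of \<open>h(v)\<close> writes \<open>v\<close> as a combination of the images of the
  basis vectors with the coordinates of \<open>h(v)\<close> as coefficients. Finite generation makes it finite.
\<close>

lemma dual_basis_of_projective:
  fixes E :: "('a, 'm) module"
  assumes E: "module R E" and fg: "fin_gen_module R E" and pr: "projective_module R E"
  obtains I :: "'m set" and x f where "dual_basis R E I x f"
proof -
  interpret E: module R E by fact
  obtain S :: "'m set" and P Q where
    PQ: "submodule P R (free_module R S)" "submodule Q R (free_module R S)"
    "P \<inter> Q = {\<zero>\<^bsub>free_module R S\<^esub>}" "P <+>\<^bsub>free_module R S\<^esub> Q = carrier (free_module R S)"
    and iso: "module_isomorphic R E ((free_module R S)\<lparr>carrier := P\<rparr>)"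
    using pr unfolding projective_module_def Let_def by blast
  define F where "F = free_module R S"
  define FP where "FP = F\<lparr>carrier := P\<rparr>"
  have F: "module R F" unfolding F_def by (rule E.free_module_is_module)
  interpret F: module R F by (rule F)
  have PF: "P \<subseteq> carrier F" using F.submoduleE(1)[of P] PQ(1) by (simp add: F_def)
  obtain p where p: "p \<in> module_homs R F FP" "\<And>v. v \<in> P \<Longrightarrow> p v = v"
    using complement_projection[OF F, of P Q] PQ unfolding F_def FP_def by metis
  obtain h k where hk: "h \<in> module_homs R E FP" "k \<in> module_homs R FP E"
    "\<And>v. v \<in> carrier E \<Longrightarrow> k (h v) = v"
    using module_isomorphicE[OF iso E] unfolding F_def FP_def by metis
  have kp: "(\<lambda>v. k (p v)) \<in> module_homs R F E"
    using p(1) hk(2) by (rule module_hom_compose)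
  have hP: "h v \<in> P" if "v \<in> carrier E" for v
    using module_hom_closed[OF hk(1) that] by (simp add: FP_def)
  then have hF: "h v \<in> carrier F" if "v \<in> carrier E" for v
    using that PF by blast
  have h: "h \<in> module_homs R E F"
    using hk(1) hF by (auto simp: module_homs_def FP_def)
  obtain T where T: "finite T" "T \<subseteq> carrier E" "gen_submodule R E T = carrier E"
    using fg by (auto simp: fin_gen_module_def)
  \<comment> \<open>Only finitely many basis vectors occur in the images of the generators, hence in the
      image of any vector.\<close>
  define I where "I = (\<Union>t\<in>T. {s. h t s \<noteq> \<zero>\<^bsub>R\<^esub>})"
  have finI: "finite I"
    using T hF by (auto simp: I_def F_def)
  have IS: "I \<subseteq> S"
  proof
    fix s assume "s \<in> I"
    then obtain t where "t \<in> T" "h t s \<noteq> \<zero>\<^bsub>R\<^esub>" by (auto simp: I_def)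
    then show "s \<in> S" using hF[of t] T(2) by (auto simp: F_def)
  qed
  have sub: "submodule {v \<in> carrier E. \<forall>s. s \<notin> I \<longrightarrow> h v s = \<zero>\<^bsub>R\<^esub>} R E" (is "submodule ?N R E")
  proof (rule E.submoduleI)
    show "\<zero>\<^bsub>E\<^esub> \<in> ?N" using module_hom_zero[OF E F h] by (simp add: F_def)
    show "\<ominus>\<^bsub>E\<^esub> a \<in> ?N" if "a \<in> ?N" for a
    proof -
      have "\<ominus>\<^bsub>E\<^esub> a = (\<ominus>\<^bsub>R\<^esub> \<one>\<^bsub>R\<^esub>) \<odot>\<^bsub>E\<^esub> a" using that by (simp add: E.smult_l_minus)
      then show ?thesis using that module_hom_smult[OF h, of "\<ominus>\<^bsub>R\<^esub> \<one>\<^bsub>R\<^esub>" a] by (auto simp: F_def)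
    qed
  qed (auto simp: module_hom_add[OF h] module_hom_smult[OF h], auto simp: F_def)
  have "T \<subseteq> ?N" using T(2) by (auto simp: I_def)
  with sub have "gen_submodule R E T \<subseteq> ?N" by (auto simp: gen_submodule_def)
  then have supp: "{s. h v s \<noteq> \<zero>\<^bsub>R\<^esub>} \<subseteq> I" if "v \<in> carrier E" for v
    using that T(3) by auto
  have fb: "free_basis R s \<in> carrier F" if "s \<in> I" for s
    using that IS unfolding F_def by (intro E.free_basis_closed) auto
  have hc: "h v s \<in> carrier R" if "v \<in> carrier E" for v s
    using hF[OF that] by (auto simp: F_def)
  have "dual_basis R E I (\<lambda>s. k (p (free_basis R s))) (\<lambda>s v. h v s)"
    unfolding dual_basis_def
  proof (intro conjI ballI)
    show "(\<lambda>s. k (p (free_basis R s))) \<in> I \<rightarrow> carrier E"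
      using fb module_hom_closed[OF kp] by auto
    show "(\<lambda>s v. h v s) \<in> I \<rightarrow> dual R E"
      using module_hom_compose[OF h E.evaluation_in_dual[of _ S, folded F_def]] by auto
    fix v assume v: "v \<in> carrier E"
    have "v = k (p (h v))" using hk(3) p(2) hP v by simp
    also have "h v = finsum F (\<lambda>s. h v s \<odot>\<^bsub>F\<^esub> free_basis R s) I"
      using E.free_module_expansion[of "h v" S I] hF[OF v] supp[OF v] finI IS by (simp only: F_def)
    also have "k (p \<dots>) = finsum E (\<lambda>s. k (p (h v s \<odot>\<^bsub>F\<^esub> free_basis R s))) I"
      by (rule module_hom_finsum[OF F E kp]) (use fb hc[OF v] in auto)
    also have "\<dots> = finsum E (\<lambda>s. h v s \<odot>\<^bsub>E\<^esub> k (p (free_basis R s))) I"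
      using fb hc[OF v] module_hom_closed[OF kp]
      by (intro E.M.finsum_cong') (auto simp: module_hom_smult[OF kp])
    finally show "v = \<dots>" .
  qed (rule finI)
  then show thesis by (rule that)
qed

text \<open>
  Functionals that belong to the same vector can be added up, so a dual basis can be indexed by
  its own vectors. This matters because the free modules that test projectivity have a basis
  inside the type of \<open>E\<close>.
\<close>

lemma dual_basis_index_by_vectors:
  assumes E: "module R E" and b: "dual_basis R E I x f"
  shows "\<exists>g. dual_basis R E (x ` I) (\<lambda>s. s) g"
proof -
  interpret E: module R E by fact
  note b = dual_basisD[OF b]
  let ?R = "ideal_module R (carrier R)"
  define J where "J s = {i \<in> I. x i = s}" for s
  define g where "g = (\<lambda>s v. finsum ?R (\<lambda>i. f i v \<odot>\<^bsub>?R\<^esub> \<one>\<^bsub>R\<^esub>) (J s))"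
  have g_dual: "g s \<in> dual R E" for s
    unfolding g_def
    by (rule dual_combination_hom[OF E E.regular_module_is_module]) (auto simp: J_def b)
  have g: "g s v \<odot>\<^bsub>E\<^esub> s = finsum E (\<lambda>i. f i v \<odot>\<^bsub>E\<^esub> x i) (J s)"
    if "v \<in> carrier E" "s \<in> x ` I" for s v
  proof -
    have s: "s \<in> carrier E" using that b(2) by auto
    have "g s v = finsum R (\<lambda>i. f i v) (J s)"
      unfolding g_def finsum_ideal_module
      by (rule E.R.finsum_cong') (auto simp: J_def b that)
    then have "g s v \<odot>\<^bsub>E\<^esub> s = finsum E (\<lambda>i. f i v \<odot>\<^bsub>E\<^esub> s) (J s)"
      using s that by (simp only:) (rule E.smult_finsum_left, auto simp: J_def b)
    also have "\<dots> = finsum E (\<lambda>i. f i v \<odot>\<^bsub>E\<^esub> x i) (J s)"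
      by (rule E.M.finsum_cong') (auto simp: J_def b that)
    finally show ?thesis .
  qed
  have "dual_basis R E (x ` I) (\<lambda>s. s) g"
    unfolding dual_basis_def
  proof (intro conjI ballI)
    fix v assume v: "v \<in> carrier E"
    have "finsum E (\<lambda>s. g s v \<odot>\<^bsub>E\<^esub> s) (x ` I) = finsum E (\<lambda>s. finsum E (\<lambda>i. f i v \<odot>\<^bsub>E\<^esub> x i) (J s)) (x ` I)"
      by (rule E.M.finsum_cong') (auto simp: g v J_def b intro!: E.M.finsum_closed)
    also have "\<dots> = finsum E (\<lambda>i. f i v \<odot>\<^bsub>E\<^esub> x i) (\<Union>(J ` (x ` I)))"
      by (rule E.M.add.finprod_UN_disjoint[symmetric])
         (auto simp: J_def b v pairwise_def disjnt_def)
    also have "\<Union>(J ` (x ` I)) = I" by (auto simp: J_def)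
    finally show "v = finsum E (\<lambda>s. g s v \<odot>\<^bsub>E\<^esub> s) (x ` I)" using b(5)[OF v] by simp
  qed (use b g_dual in auto)
  then show ?thesis by blast
qed

lemma fin_gen_of_dual_basis:
  assumes E: "module R E" and b: "dual_basis R E I x f"
  shows "fin_gen_module R E"
proof -
  interpret E: module R E by fact
  note b = dual_basisD[OF b]
  have "v \<in> N" if "v \<in> carrier E" "submodule N R E" "x ` I \<subseteq> N" for v N
  proof -
    have "f i v \<odot>\<^bsub>E\<^esub> x i \<in> N" if "i \<in> I" for i
      using that \<open>v \<in> carrier E\<close> \<open>x ` I \<subseteq> N\<close> by (intro E.submoduleE(4)[OF \<open>submodule N R E\<close>] b) auto
    then have "finsum E (\<lambda>i. f i v \<odot>\<^bsub>E\<^esub> x i) I \<in> N"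
      by (rule E.submodule_finsum[OF that(2)])
    then show ?thesis using b(5)[OF that(1)] by simp
  qed
  then have "gen_submodule R E (x ` I) = carrier E"
    using E.carrier_is_submodule b(2) unfolding gen_submodule_def by blast
  then show ?thesis
    unfolding fin_gen_module_def using b by (intro exI[of _ "x ` I"]) auto
qed

text \<open>
  The coordinates \<open>h(v) = (f\<^sub>s(v))\<^sub>s\<close> and the linear combinations \<open>k(w) = \<Sum> w\<^sub>s s\<close> satisfy \<open>k(h(v)) = v\<close>, so
  the free module is the direct sum of the image of \<open>h\<close> and the kernel of \<open>k\<close>.
\<close>

lemma projective_of_dual_basis:
  fixes E :: "('a, 'm) module"
  assumes E: "module R E" and b: "dual_basis R E I x f"
  shows "projective_module R E"
proof -
  interpret E: module R E by fact
  define S where "S = x ` I"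
  obtain g where g: "dual_basis R E S (\<lambda>s. s) g"
    using dual_basis_index_by_vectors[OF E b] unfolding S_def by blast
  note g = dual_basisD[OF g]
  define F where "F = free_module R S"
  have F: "module R F" unfolding F_def by (rule E.free_module_is_module)
  interpret F: module R F by (rule F)
  define h where "h = (\<lambda>v s. if s \<in> S then g s v else \<zero>\<^bsub>R\<^esub>)"
  define k where "k = (\<lambda>w. finsum E (\<lambda>s. w s \<odot>\<^bsub>E\<^esub> s) S)"
  have hF: "h v \<in> carrier F" if "v \<in> carrier E" for v
  proof -
    have "finite {s. h v s \<noteq> \<zero>\<^bsub>R\<^esub>}"
      by (rule finite_subset[OF _ g(1)]) (auto simp: h_def)
    then show ?thesis using that g by (auto simp: F_def h_def)
  qed
  have h: "h \<in> module_homs R E F"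
    by (rule module_homI)
       (auto simp: hF, auto simp: F_def h_def fun_eq_iff module_hom_add[OF g(3)] module_hom_smult[OF g(3)])
  have k: "k \<in> module_homs R F E"
    unfolding k_def
    by (rule dual_combination_hom[OF F E]) (auto simp: g E.evaluation_in_dual F_def)
  have kh: "k (h v) = v" if "v \<in> carrier E" for v
  proof -
    have "k (h v) = finsum E (\<lambda>s. g s v \<odot>\<^bsub>E\<^esub> s) S"
      unfolding k_def h_def by (rule E.M.finsum_cong') (auto simp: g that)
    then show ?thesis using g(5) that by simp
  qed
  note hc = module_hom_closed[OF h] and kc = module_hom_closed[OF k]
  define P where "P = h ` carrier E"
  define Q where "Q = {w \<in> carrier F. k w = \<zero>\<^bsub>E\<^esub>}"
  \<comment> \<open>Negation is multiplication by \<open>-1\<close>, so linear maps respect it.\<close>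
  have minus: "a_inv M a = (\<ominus>\<^bsub>R\<^esub> \<one>\<^bsub>R\<^esub>) \<odot>\<^bsub>M\<^esub> a" if "module R M" "a \<in> carrier M" for a and M :: "('a, 'n) module"
    using module.smult_l_minus[OF that(1) _ that(2), of "\<one>\<^bsub>R\<^esub>"] module.smult_one[OF that] by auto
  have P: "submodule P R F"
  proof (rule F.submoduleI)
    show "\<zero>\<^bsub>F\<^esub> \<in> P" unfolding P_def
      using module_hom_zero[OF E F h] by (metis E.M.zero_closed image_eqI)
    show smult: "r \<odot>\<^bsub>F\<^esub> a \<in> P" if "r \<in> carrier R" "a \<in> P" for r a
      using that module_hom_smult[OF h] unfolding P_def by (metis (no_types, lifting) E.smult_closed imageE image_eqI)
    show "a \<oplus>\<^bsub>F\<^esub> b \<in> P" if "a \<in> P" "b \<in> P" for a b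
      using that module_hom_add[OF h] unfolding P_def by (metis (no_types, lifting) E.M.add.m_closed imageE image_eqI)
    show "\<ominus>\<^bsub>F\<^esub> a \<in> P" if "a \<in> P" for a
      using smult[of "\<ominus>\<^bsub>R\<^esub> \<one>\<^bsub>R\<^esub>" a] minus[OF F, of a] that hc by (auto simp: P_def)
  qed (auto simp: P_def hc)
  have Q: "submodule Q R F"
  proof (rule F.submoduleI)
    show "\<ominus>\<^bsub>F\<^esub> a \<in> Q" if "a \<in> Q" for a
      using that minus[OF F, of a] module_hom_smult[OF k, of "\<ominus>\<^bsub>R\<^esub> \<one>\<^bsub>R\<^esub>" a] by (auto simp: Q_def)
  qed (auto simp: Q_def module_hom_zero[OF F E k] module_hom_add[OF k] module_hom_smult[OF k])
  have PQ: "P \<inter> Q = {\<zero>\<^bsub>F\<^esub>}"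
  proof -
    have "a = \<zero>\<^bsub>F\<^esub>" if "a \<in> P" "a \<in> Q" for a
      using that kh module_hom_zero[OF E F h] by (auto simp: P_def Q_def)
    moreover have "\<zero>\<^bsub>F\<^esub> \<in> P" "\<zero>\<^bsub>F\<^esub> \<in> Q"
      using P Q by (metis F.submodule_finsum F.M.finsum_empty empty_iff)+
    ultimately show ?thesis by blast
  qed
  have PQ': "P <+>\<^bsub>F\<^esub> Q = carrier F"
  proof
    show "P <+>\<^bsub>F\<^esub> Q \<subseteq> carrier F"
      using F.setadd_subset_G F.submoduleE(1)[OF P] F.submoduleE(1)[OF Q] by blast
    show "carrier F \<subseteq> P <+>\<^bsub>F\<^esub> Q"
    proof
      fix w assume w: "w \<in> carrier F"
      have hk: "h (k w) \<in> carrier F" using w hc kc by blast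
      have "w = h (k w) \<oplus>\<^bsub>F\<^esub> (w \<ominus>\<^bsub>F\<^esub> h (k w))"
        using w hk by (simp add: a_minus_def F.M.a_lcomm F.M.r_neg)
      moreover have "k (w \<ominus>\<^bsub>F\<^esub> h (k w)) = k w \<oplus>\<^bsub>E\<^esub> (\<ominus>\<^bsub>R\<^esub> \<one>\<^bsub>R\<^esub>) \<odot>\<^bsub>E\<^esub> k w"
        unfolding a_minus_def minus[OF F hk]
        using w hk by (simp add: module_hom_add[OF k] module_hom_smult[OF k] kh kc)
      then have "w \<ominus>\<^bsub>F\<^esub> h (k w) \<in> Q"
        using w hk kc[OF w] by (simp add: Q_def E.M.r_neg minus[OF E kc[OF w], symmetric])
      moreover have "h (k w) \<in> P" using w kc by (auto simp: P_def)
      ultimately show "w \<in> P <+>\<^bsub>F\<^esub> Q" unfolding set_add_def' by blast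
    qed
  qed
  have "module_isomorphic R E (F\<lparr>carrier := P\<rparr>)"
  proof (rule module_isomorphicI)
    show "h \<in> module_homs R E (F\<lparr>carrier := P\<rparr>)"
      using h by (auto simp: module_homs_def P_def)
    show "k \<in> module_homs R (F\<lparr>carrier := P\<rparr>) E"
      using k hc by (auto simp: module_homs_def P_def)
  qed (auto simp: P_def kh)
  then show ?thesis
    unfolding projective_module_def Let_def using P Q PQ PQ' unfolding F_def by blast
qed

section \<open>Modules whose endomorphisms are scalars\<close>

definition scalar_endos :: "('a, 'b) ring_scheme \<Rightarrow> ('a, 'm) module \<Rightarrow> bool" where
  "scalar_endos R E \<longleftrightarrow> (\<forall>h\<in>module_homs R E E. \<exists>r\<in>carrier R. \<forall>v\<in>carrier E. h v = r \<odot>\<^bsub>E\<^esub> v)"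

text \<open>
  An algebra homomorphism from \<open>R\<close> must send \<open>r\<close> to multiplication by \<open>r\<close>, so its
  surjectivity is a statement about endomorphisms alone.
\<close>

lemma surjective_algebra_hom_iff_scalar_endos:
  assumes E: "module R E"
  shows "(\<exists>\<phi>\<in>ring_hom R (End_algebra R E).
        (\<forall>r\<in>carrier R. \<forall>s\<in>carrier R. \<phi> (r \<otimes>\<^bsub>R\<^esub> s) = r \<odot>\<^bsub>End_algebra R E\<^esub> \<phi> s) \<and>
        \<phi> ` carrier R = carrier (End_algebra R E)) \<longleftrightarrow> scalar_endos R E" (is "?L \<longleftrightarrow> _")
proof
  interpret E: module R E by fact
  {
    assume ?L
    then obtain \<phi> where \<phi>: "\<phi> \<in> ring_hom R (End_algebra R E)"
      "\<And>r s. r \<in> carrier R \<Longrightarrow> s \<in> carrier R \<Longrightarrow> \<phi> (r \<otimes>\<^bsub>R\<^esub> s) = r \<odot>\<^bsub>End_algebra R E\<^esub> \<phi> s"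
      "\<phi> ` carrier R = carrier (End_algebra R E)" by blast
    have \<phi>_eq: "\<phi> r v = r \<odot>\<^bsub>E\<^esub> v" if "r \<in> carrier R" "v \<in> carrier E" for r v
    proof -
      have "\<phi> r = r \<odot>\<^bsub>End_algebra R E\<^esub> \<one>\<^bsub>End_algebra R E\<^esub>"
        using \<phi>(2)[OF that(1) E.one_closed] ring_hom_one[OF \<phi>(1)] that by simp
      then show ?thesis using that by (simp add: End_algebra_def)
    qed
    show "scalar_endos R E"
      unfolding scalar_endos_def
    proof
      fix h assume h: "h \<in> module_homs R E E"
      then have "restrict h (carrier E) \<in> carrier (End_algebra R E)"
        by (auto simp: End_algebra_def module_homs_def)
      then obtain r where r: "r \<in> carrier R" "restrict h (carrier E) = \<phi> r"
        using \<phi>(3) by (metis imageE)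
      then have "h v = r \<odot>\<^bsub>E\<^esub> v" if "v \<in> carrier E" for v
        using \<phi>_eq[OF r(1) that] that by (metis restrict_apply')
      then show "\<exists>r\<in>carrier R. \<forall>v\<in>carrier E. h v = r \<odot>\<^bsub>E\<^esub> v" using r by blast
    qed
  next
    assume sc: "scalar_endos R E"
    define \<phi> where "\<phi> = (\<lambda>r. \<lambda>v\<in>carrier E. r \<odot>\<^bsub>E\<^esub> v)"
    have endo: "\<phi> r \<in> carrier (End_algebra R E)" if "r \<in> carrier R" for r
      using that
      by (auto simp: \<phi>_def End_algebra_def E.smult_r_distr E.smult_assoc1[symmetric] E.m_comm
          intro!: module_homI)
    have hom: "\<phi> \<in> ring_hom R (End_algebra R E)"
    proof (rule ring_hom_memI)
      show "\<phi> (r \<otimes>\<^bsub>R\<^esub> s) = \<phi> r \<otimes>\<^bsub>End_algebra R E\<^esub> \<phi> s" if "r \<in> carrier R" "s \<in> carrier R" for r s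
        using that by (auto simp: \<phi>_def End_algebra_def compose_def E.smult_assoc1 fun_eq_iff)
      show "\<phi> (r \<oplus>\<^bsub>R\<^esub> s) = \<phi> r \<oplus>\<^bsub>End_algebra R E\<^esub> \<phi> s" if "r \<in> carrier R" "s \<in> carrier R" for r s
        using that by (auto simp: \<phi>_def End_algebra_def E.smult_l_distr fun_eq_iff)
      show "\<phi> \<one>\<^bsub>R\<^esub> = \<one>\<^bsub>End_algebra R E\<^esub>"
        by (auto simp: \<phi>_def End_algebra_def fun_eq_iff)
    qed (rule endo)
    have "carrier (End_algebra R E) \<subseteq> \<phi> ` carrier R"
    proof
      fix h assume h: "h \<in> carrier (End_algebra R E)"
      then obtain r where r: "r \<in> carrier R" "\<forall>v\<in>carrier E. h v = r \<odot>\<^bsub>E\<^esub> v"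
        using sc by (auto simp: scalar_endos_def End_algebra_def)
      then have "h = \<phi> r"
        using h by (auto simp: \<phi>_def End_algebra_def extensional_def fun_eq_iff)
      then show "h \<in> \<phi> ` carrier R" using r by blast
    qed
    then show ?L
      using endo hom
      by (intro bexI[OF _ hom]) (auto simp: \<phi>_def End_algebra_def E.smult_assoc1 fun_eq_iff)
  }
qed

lemma picS_module_iff:
  "picS_module R E \<longleftrightarrow>
     module R E \<and> fin_gen_module R E \<and> projective_module R E \<and> scalar_endos R E"
  unfolding picS_module_def
  by (intro conj_cong refl) (rule surjective_algebra_hom_iff_scalar_endos)

lemma picS_module_of_dual_basis:
  "\<lbrakk>module R E; dual_basis R E I x f; scalar_endos R E\<rbrakk> \<Longrightarrow> picS_module R E"
  by (simp add: picS_module_iff fin_gen_of_dual_basis projective_of_dual_basis)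

lemma picS_moduleE:
  fixes E :: "('a, 'm) module"
  assumes "picS_module R E"
  obtains I :: "'m set" and x f where "dual_basis R E I x f"
proof -
  have "module R E" "fin_gen_module R E" "projective_module R E"
    using assms by (simp_all add: picS_module_iff)
  then show thesis by (rule dual_basis_of_projective) (rule that)
qed

lemma picS_moduleD:
  assumes "picS_module R E"
  shows "module R E" "scalar_endos R E"
  using assms by (simp_all add: picS_module_iff)

section \<open>Tensor products of modules with dual bases\<close>

definition bilinear ::
    "('a, 'b) ring_scheme \<Rightarrow> ('a, 'm) module \<Rightarrow> ('a, 'n) module \<Rightarrow> ('a, 't) module \<Rightarrow>
     ('m \<Rightarrow> 'n \<Rightarrow> 't) \<Rightarrow> bool" where
  "bilinear R E F T b \<longleftrightarrow>
     (\<forall>x\<in>carrier E. (\<lambda>y. b x y) \<in> module_homs R F T) \<and>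
     (\<forall>y\<in>carrier F. (\<lambda>x. b x y) \<in> module_homs R E T)"

text \<open>
  The universal property of a tensor product quantifies over target modules of every type. For
  modules with dual bases it is enough to ask for the functionals \<open>f \<otimes> g\<close>, so that the notion
  becomes a predicate. Generation by the elements \<open>b x y\<close> is stated as an induction principle that
  mentions addition only: scalars can be moved into \<open>x\<close>, and a condition without scalars is not
  affected by a change of the scalar action.
\<close>

definition is_tensor ::
    "('a, 'b) ring_scheme \<Rightarrow> ('a, 'm) module \<Rightarrow> ('a, 'n) module \<Rightarrow> ('a, 't) module \<Rightarrow>
     ('m \<Rightarrow> 'n \<Rightarrow> 't) \<Rightarrow> bool" where
  "is_tensor R E F T b \<longleftrightarrow> module R T \<and> bilinear R E F T b \<and>
     (\<forall>P. (\<forall>x\<in>carrier E. \<forall>y\<in>carrier F. P (b x y)) \<longrightarrow>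
          (\<forall>s\<in>carrier T. \<forall>t\<in>carrier T. P s \<longrightarrow> P t \<longrightarrow> P (s \<oplus>\<^bsub>T\<^esub> t)) \<longrightarrow> (\<forall>t\<in>carrier T. P t)) \<and>
     (\<forall>f\<in>dual R E. \<forall>g\<in>dual R F.
        \<exists>k\<in>dual R T. \<forall>x\<in>carrier E. \<forall>y\<in>carrier F. k (b x y) = f x \<otimes>\<^bsub>R\<^esub> g y)"

lemma bilinear_closed:
  "\<lbrakk>bilinear R E F T b; x \<in> carrier E; y \<in> carrier F\<rbrakk> \<Longrightarrow> b x y \<in> carrier T"
  by (auto simp: bilinear_def module_homs_def)

lemma bilinearD:
  assumes "bilinear R E F T b"
  shows "\<And>x. x \<in> carrier E \<Longrightarrow> b x \<in> module_homs R F T"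
    and "\<And>y. y \<in> carrier F \<Longrightarrow> (\<lambda>x. b x y) \<in> module_homs R E T"
  using assms by (auto simp: bilinear_def)

lemma is_tensorD:
  assumes "is_tensor R E F T b"
  shows "module R T" "bilinear R E F T b"
    and "\<And>x y. \<lbrakk>x \<in> carrier E; y \<in> carrier F\<rbrakk> \<Longrightarrow> b x y \<in> carrier T"
    and "\<And>f g. \<lbrakk>f \<in> dual R E; g \<in> dual R F\<rbrakk> \<Longrightarrow>
      \<exists>k\<in>dual R T. \<forall>x\<in>carrier E. \<forall>y\<in>carrier F. k (b x y) = f x \<otimes>\<^bsub>R\<^esub> g y"
proof -
  show 1: "bilinear R E F T b" using assms unfolding is_tensor_def by (elim conjE)
  show "\<And>x y. \<lbrakk>x \<in> carrier E; y \<in> carrier F\<rbrakk> \<Longrightarrow> b x y \<in> carrier T"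
    using 1 by (rule bilinear_closed)
  show "module R T" using assms unfolding is_tensor_def by (elim conjE)
  have "\<forall>f\<in>dual R E. \<forall>g\<in>dual R F.
      \<exists>k\<in>dual R T. \<forall>x\<in>carrier E. \<forall>y\<in>carrier F. k (b x y) = f x \<otimes>\<^bsub>R\<^esub> g y"
    using assms unfolding is_tensor_def by (elim conjE)
  then show "\<And>f g. \<lbrakk>f \<in> dual R E; g \<in> dual R F\<rbrakk> \<Longrightarrow>
      \<exists>k\<in>dual R T. \<forall>x\<in>carrier E. \<forall>y\<in>carrier F. k (b x y) = f x \<otimes>\<^bsub>R\<^esub> g y"
    by blast
qed

lemma tensor_induct:
  assumes "is_tensor R E F T b" "t \<in> carrier T"
    and "\<And>x y. \<lbrakk>x \<in> carrier E; y \<in> carrier F\<rbrakk> \<Longrightarrow> P (b x y)"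
    and "\<And>s t. \<lbrakk>s \<in> carrier T; t \<in> carrier T; P s; P t\<rbrakk> \<Longrightarrow> P (s \<oplus>\<^bsub>T\<^esub> t)"
  shows "P t"
proof -
  have "\<forall>P. (\<forall>x\<in>carrier E. \<forall>y\<in>carrier F. P (b x y)) \<longrightarrow>
      (\<forall>s\<in>carrier T. \<forall>t\<in>carrier T. P s \<longrightarrow> P t \<longrightarrow> P (s \<oplus>\<^bsub>T\<^esub> t)) \<longrightarrow> (\<forall>t\<in>carrier T. P t)"
    using assms(1) unfolding is_tensor_def by (elim conjE)
  from this[THEN spec, of P] show ?thesis using assms(2-) by simp
qed

lemma tensor_hom_eqI:
  assumes "is_tensor R E F T b" "h \<in> module_homs R T W" "k \<in> module_homs R T W"
    and "\<And>x y. \<lbrakk>x \<in> carrier E; y \<in> carrier F\<rbrakk> \<Longrightarrow> h (b x y) = k (b x y)" "t \<in> carrier T"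
  shows "h t = k t"
  by (rule tensor_induct[OF assms(1,5)])
     (simp_all add: assms(4) module_hom_add[OF assms(2)] module_hom_add[OF assms(3)])

lemma bilinear_expansion:
  assumes E: "module R E" and F: "module R F" and W: "module R W"
    and c: "bilinear R E F W c"
    and bE: "dual_basis R E I x f" and bF: "dual_basis R F J y g"
    and u: "u \<in> carrier E" and v: "v \<in> carrier F"
  shows "c u v = finsum W (\<lambda>p. (f (fst p) u \<otimes>\<^bsub>R\<^esub> g (snd p) v) \<odot>\<^bsub>W\<^esub> c (x (fst p)) (y (snd p))) (I \<times> J)"
proof -
  interpret E: module R E by fact
  interpret F: module R F by fact
  interpret W: module R W by fact
  note bE = dual_basisD[OF bE] and bF = dual_basisD[OF bF]
  note c1 = bilinearD(1)[OF c] and c2 = bilinearD(2)[OF c] and cc = bilinear_closed[OF c]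
  have inner: "c (x i) v = finsum W (\<lambda>j. g j v \<odot>\<^bsub>W\<^esub> c (x i) (y j)) J" if i: "i \<in> I" for i
  proof -
    have "c (x i) v = c (x i) (finsum F (\<lambda>j. g j v \<odot>\<^bsub>F\<^esub> y j) J)"
      using bF v by simp
    also have "\<dots> = finsum W (\<lambda>j. c (x i) (g j v \<odot>\<^bsub>F\<^esub> y j)) J"
      by (rule module_hom_finsum[OF F W c1]) (auto simp: i v bE bF)
    also have "\<dots> = finsum W (\<lambda>j. g j v \<odot>\<^bsub>W\<^esub> c (x i) (y j)) J"
      by (rule W.M.finsum_cong') (auto simp: i v bE bF cc module_hom_smult[OF c1])
    finally show ?thesis .
  qed
  have "c u v = c (finsum E (\<lambda>i. f i u \<odot>\<^bsub>E\<^esub> x i) I) v"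
    using bE u by simp
  also have "\<dots> = finsum W (\<lambda>i. c (f i u \<odot>\<^bsub>E\<^esub> x i) v) I"
    by (rule module_hom_finsum[OF E W c2]) (auto simp: u v bE)
  also have "\<dots> = finsum W (\<lambda>i. finsum W (\<lambda>j. (f i u \<otimes>\<^bsub>R\<^esub> g j v) \<odot>\<^bsub>W\<^esub> c (x i) (y j)) J) I"
  proof (rule W.M.finsum_cong')
    fix i assume i: "i \<in> I"
    have "c (f i u \<odot>\<^bsub>E\<^esub> x i) v = f i u \<odot>\<^bsub>W\<^esub> c (x i) v"
      by (rule module_hom_smult[OF c2]) (auto simp: i u v bE)
    also have "\<dots> = finsum W (\<lambda>j. f i u \<odot>\<^bsub>W\<^esub> (g j v \<odot>\<^bsub>W\<^esub> c (x i) (y j))) J"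
      unfolding inner[OF i] by (rule W.finsum_smult_ldistr) (auto simp: i u v bE bF cc)
    also have "\<dots> = finsum W (\<lambda>j. (f i u \<otimes>\<^bsub>R\<^esub> g j v) \<odot>\<^bsub>W\<^esub> c (x i) (y j)) J"
      by (rule W.M.finsum_cong') (auto simp: i u v bE bF cc W.smult_assoc1)
    finally show "c (f i u \<odot>\<^bsub>E\<^esub> x i) v = finsum W (\<lambda>j. (f i u \<otimes>\<^bsub>R\<^esub> g j v) \<odot>\<^bsub>W\<^esub> c (x i) (y j)) J" .
  qed (auto simp: u v bE bF cc intro!: W.M.finsum_closed)
  also have "\<dots> = finsum W (\<lambda>p. (f (fst p) u \<otimes>\<^bsub>R\<^esub> g (snd p) v) \<odot>\<^bsub>W\<^esub> c (x (fst p)) (y (snd p))) (I \<times> J)"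
    by (subst W.M.finsum_Times) (auto simp: u v bE bF cc)
  finally show ?thesis .
qed

lemma tensor_functionals:
  assumes T: "is_tensor R E F T b" and bE: "dual_basis R E I x f" and bF: "dual_basis R F J y g"
  obtains k where "\<And>p. p \<in> I \<times> J \<Longrightarrow> k p \<in> dual R T"
    "\<And>p u v. \<lbrakk>p \<in> I \<times> J; u \<in> carrier E; v \<in> carrier F\<rbrakk> \<Longrightarrow> k p (b u v) = f (fst p) u \<otimes>\<^bsub>R\<^esub> g (snd p) v"
proof -
  have "\<forall>p\<in>I \<times> J. \<exists>k. k \<in> dual R T \<and>
      (\<forall>u\<in>carrier E. \<forall>v\<in>carrier F. k (b u v) = f (fst p) u \<otimes>\<^bsub>R\<^esub> g (snd p) v)"
  proof
    fix p assume p: "p \<in> I \<times> J"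
    have "f (fst p) \<in> dual R E" "g (snd p) \<in> dual R F"
      using p dual_basisD(3)[OF bE] dual_basisD(3)[OF bF] by auto
    from is_tensorD(4)[OF T this]
    show "\<exists>k. k \<in> dual R T \<and>
      (\<forall>u\<in>carrier E. \<forall>v\<in>carrier F. k (b u v) = f (fst p) u \<otimes>\<^bsub>R\<^esub> g (snd p) v)" by blast
  qed
  from bchoice[OF this] obtain k where k: "\<forall>p\<in>I \<times> J. k p \<in> dual R T \<and>
      (\<forall>u\<in>carrier E. \<forall>v\<in>carrier F. k p (b u v) = f (fst p) u \<otimes>\<^bsub>R\<^esub> g (snd p) v)" ..
  show thesis
  proof (rule that)
    show "k p \<in> dual R T" if "p \<in> I \<times> J" for p
      using k[rule_format, OF that] by (rule conjunct1)
    show "k p (b u v) = f (fst p) u \<otimes>\<^bsub>R\<^esub> g (snd p) v"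
      if "p \<in> I \<times> J" "u \<in> carrier E" "v \<in> carrier F" for p u v
      using k[rule_format, OF that(1)] that(2,3) by simp
  qed
qed

text \<open>
  The universal property: by the dual bases, a bilinear map \<open>c\<close> is the finite combination
  \<open>\<Sum> (f\<^sub>i \<otimes> g\<^sub>j) c(x\<^sub>i, y\<^sub>j)\<close>, and this expression makes sense on all of \<open>T\<close>.
\<close>

lemma tensor_lift:
  assumes E: "module R E" and F: "module R F" and W: "module R W"
    and T: "is_tensor R E F T b"
    and bE: "dual_basis R E I x f" and bF: "dual_basis R F J y g"
    and c: "bilinear R E F W c"
  obtains h where "h \<in> module_homs R T W"
    "\<And>u v. \<lbrakk>u \<in> carrier E; v \<in> carrier F\<rbrakk> \<Longrightarrow> h (b u v) = c u v"
proof -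
  interpret E: module R E by fact
  interpret W: module R W by fact
  note dE = dual_basisD[OF bE] and dF = dual_basisD[OF bF]
  obtain k where k: "\<And>p. p \<in> I \<times> J \<Longrightarrow> k p \<in> dual R T"
    "\<And>p u v. \<lbrakk>p \<in> I \<times> J; u \<in> carrier E; v \<in> carrier F\<rbrakk> \<Longrightarrow> k p (b u v) = f (fst p) u \<otimes>\<^bsub>R\<^esub> g (snd p) v"
    using tensor_functionals[OF T bE bF] by metis
  define h where "h = (\<lambda>t. finsum W (\<lambda>p. k p t \<odot>\<^bsub>W\<^esub> c (x (fst p)) (y (snd p))) (I \<times> J))"
  have "h \<in> module_homs R T W"
    unfolding h_def
    by (rule dual_combination_hom[OF is_tensorD(1)[OF T] W k(1)])
       (auto intro!: bilinear_closed[OF c] dE dF)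
  moreover have "h (b u v) = c u v" if "u \<in> carrier E" "v \<in> carrier F" for u v
    unfolding h_def bilinear_expansion[OF E F W c bE bF that]
    by (rule W.M.finsum_cong') (auto simp: k that dE dF bilinear_closed[OF c])
  ultimately show thesis by (rule that)
qed

lemma tensor_dual_basis:
  assumes E: "module R E" and F: "module R F" and T: "is_tensor R E F T b"
    and bE: "dual_basis R E I x f" and bF: "dual_basis R F J y g"
  obtains k where "dual_basis R T (I \<times> J) (\<lambda>p. b (x (fst p)) (y (snd p))) k"
    "\<And>p u v. \<lbrakk>p \<in> I \<times> J; u \<in> carrier E; v \<in> carrier F\<rbrakk> \<Longrightarrow> k p (b u v) = f (fst p) u \<otimes>\<^bsub>R\<^esub> g (snd p) v"
proof -
  interpret E: module R E by fact
  have TM: "module R T" using is_tensorD(1)[OF T] .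
  interpret T: module R T by fact
  note dE = dual_basisD[OF bE] and dF = dual_basisD[OF bF]
  obtain k where k: "\<And>p. p \<in> I \<times> J \<Longrightarrow> k p \<in> dual R T"
    "\<And>p u v. \<lbrakk>p \<in> I \<times> J; u \<in> carrier E; v \<in> carrier F\<rbrakk> \<Longrightarrow> k p (b u v) = f (fst p) u \<otimes>\<^bsub>R\<^esub> g (snd p) v"
    using tensor_functionals[OF T bE bF] by metis
  have w: "b (x (fst p)) (y (snd p)) \<in> carrier T" if "p \<in> I \<times> J" for p
    using that by (auto intro!: is_tensorD(3)[OF T] dE dF)
  have "t = finsum T (\<lambda>p. k p t \<odot>\<^bsub>T\<^esub> b (x (fst p)) (y (snd p))) (I \<times> J)" if "t \<in> carrier T" for t
  proof (rule tensor_hom_eqI[OF T _ _ _ that, where h = "\<lambda>t. t"])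
    show "(\<lambda>t. t) \<in> module_homs R T T" by (auto intro: module_homI)
    show "(\<lambda>t. finsum T (\<lambda>p. k p t \<odot>\<^bsub>T\<^esub> b (x (fst p)) (y (snd p))) (I \<times> J)) \<in> module_homs R T T"
      by (rule dual_combination_hom[OF TM TM k(1) w])
    fix u v assume uv: "u \<in> carrier E" "v \<in> carrier F"
    show "b u v = finsum T (\<lambda>p. k p (b u v) \<odot>\<^bsub>T\<^esub> b (x (fst p)) (y (snd p))) (I \<times> J)"
      unfolding bilinear_expansion[OF E F TM is_tensorD(2)[OF T] bE bF uv]
      by (rule T.M.finsum_cong'[symmetric])
         (auto simp: k uv dE dF is_tensorD(3)[OF T] bilinear_expansion[OF E F TM is_tensorD(2)[OF T] bE bF uv, symmetric])
  qed
  then have "dual_basis R T (I \<times> J) (\<lambda>p. b (x (fst p)) (y (snd p))) k"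
    using dE(1) dF(1) k(1) w by (auto simp: dual_basis_def)
  then show thesis using that k(2) by blast
qed

lemma tensor_unique:
  assumes E: "module R E" and F: "module R F"
    and bE: "dual_basis R E I x f" and bF: "dual_basis R F J y g"
    and T: "is_tensor R E F T b" and T': "is_tensor R E F T' b'"
  shows "module_isomorphic R T T'"
proof -
  note TD = is_tensorD[OF T] and TD' = is_tensorD[OF T']
  obtain h where h: "h \<in> module_homs R T T'"
    "\<And>u v. \<lbrakk>u \<in> carrier E; v \<in> carrier F\<rbrakk> \<Longrightarrow> h (b u v) = b' u v"
    using tensor_lift[OF E F TD'(1) T bE bF TD'(2)] by metis
  obtain k where k: "k \<in> module_homs R T' T"
    "\<And>u v. \<lbrakk>u \<in> carrier E; v \<in> carrier F\<rbrakk> \<Longrightarrow> k (b' u v) = b u v"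
    using tensor_lift[OF E F TD(1) T' bE bF TD(2)] by metis
  show ?thesis
  proof (rule module_isomorphicI[OF h(1) k(1)])
    show "k (h t) = t" if "t \<in> carrier T" for t
      by (rule tensor_hom_eqI[OF T module_hom_compose[OF h(1) k(1)] _ _ that])
         (auto simp: h k intro: module_homI)
    show "h (k t) = t" if "t \<in> carrier T'" for t
      by (rule tensor_hom_eqI[OF T' module_hom_compose[OF k(1) h(1)] _ _ that])
         (auto simp: h k intro: module_homI)
  qed
qed

lemma tensor_flip:
  assumes E: "module R E" and T: "is_tensor R E F T b"
  shows "is_tensor R F E T (\<lambda>y x. b x y)"
proof -
  interpret E: module R E by fact
  have "\<exists>k\<in>dual R T. \<forall>y\<in>carrier F. \<forall>x\<in>carrier E. k (b x y) = g y \<otimes>\<^bsub>R\<^esub> f x"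
    if fg: "f \<in> dual R E" "g \<in> dual R F" for f g
  proof -
    obtain k where "k \<in> dual R T" "\<forall>x\<in>carrier E. \<forall>y\<in>carrier F. k (b x y) = f x \<otimes>\<^bsub>R\<^esub> g y"
      using is_tensorD(4)[OF T fg] by blast
    moreover have "f x \<in> carrier R" "g y \<in> carrier R" if "x \<in> carrier E" "y \<in> carrier F" for x y
      using module_hom_closed[OF fg(1)] module_hom_closed[OF fg(2)] that by auto
    ultimately show ?thesis by (auto simp: E.m_comm)
  qed
  moreover have "P t" if "\<forall>y\<in>carrier F. \<forall>x\<in>carrier E. P (b x y)"
    "\<forall>s\<in>carrier T. \<forall>t\<in>carrier T. P s \<longrightarrow> P t \<longrightarrow> P (s \<oplus>\<^bsub>T\<^esub> t)" "t \<in> carrier T" for P t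
    by (rule tensor_induct[OF T that(3)]) (simp_all add: that(1,2))
  moreover have "bilinear R F E T (\<lambda>y x. b x y)"
    using is_tensorD(2)[OF T] by (simp add: bilinear_def)
  ultimately show ?thesis
    unfolding is_tensor_def
    using is_tensorD(1)[OF T] by (intro conjI ballI allI impI)
qed

text \<open>
  Precomposition with an isomorphism. Products in \<open>PicS\<close> are formed with arbitrary representatives of
  the classes, and these differ by isomorphisms in either factor.
\<close>

lemma tensor_iso_left:
  assumes iso: "module_isomorphic R E' E" and E': "module R E'" and T: "is_tensor R E F T b"
  obtains b' where "is_tensor R E' F T b'"
proof -
  obtain h k where h: "h \<in> module_homs R E' E" and k: "k \<in> module_homs R E E'"
    and kh: "\<And>x. x \<in> carrier E' \<Longrightarrow> k (h x) = x" and hk: "\<And>x. x \<in> carrier E \<Longrightarrow> h (k x) = x"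
    using module_isomorphicE[OF iso E'] by metis
  note TD = is_tensorD[OF T]
  have "is_tensor R E' F T (\<lambda>x y. b (h x) y)"
    unfolding is_tensor_def
  proof (intro conjI allI impI ballI)
    show "bilinear R E' F T (\<lambda>x. b (h x))"
      unfolding bilinear_def
      using bilinearD(1)[OF TD(2)] module_hom_closed[OF h] module_hom_compose[OF h bilinearD(2)[OF TD(2)]]
      by simp
    show "P t" if "\<forall>x\<in>carrier E'. \<forall>y\<in>carrier F. P (b (h x) y)"
      "\<forall>s\<in>carrier T. \<forall>t\<in>carrier T. P s \<longrightarrow> P t \<longrightarrow> P (s \<oplus>\<^bsub>T\<^esub> t)" "t \<in> carrier T" for P t
    proof (rule tensor_induct[OF T that(3)])
      fix x y assume "x \<in> carrier E" "y \<in> carrier F"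
      then show "P (b x y)" using that(1) hk[of x] module_hom_closed[OF k, of x] by metis
    qed (use that(2) in auto)
    show "\<exists>l\<in>dual R T. \<forall>x\<in>carrier E'. \<forall>y\<in>carrier F. l (b (h x) y) = f x \<otimes>\<^bsub>R\<^esub> g y"
      if "f \<in> dual R E'" "g \<in> dual R F" for f g
      using TD(4)[OF module_hom_compose[OF k that(1)] that(2)] module_hom_closed[OF h] kh by metis
  qed (rule TD(1))
  then show thesis by (rule that)
qed

lemma tensor_iso_right:
  assumes E: "module R E" and iso: "module_isomorphic R F' F" and F': "module R F'" and T: "is_tensor R E F T b"
  obtains b' where "is_tensor R E F' T b'"
  using tensor_iso_left[OF iso F' tensor_flip[OF E T]] tensor_flip[OF F'] by metis

text \<open>
  One half of associativity. For each \<open>z\<close> the map \<open>(x, y) \<mapsto> x \<otimes> (y \<otimes> z)\<close> lifts to \<open>E \<otimes> F\<close>; the lift is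
  linear in \<open>z\<close> because this can be tested on the generators \<open>x \<otimes> y\<close>.
\<close>

lemma tensor_assoc_hom:
  assumes E: "module R E" and F: "module R F" and L: "module R L"
    and bE: "dual_basis R E I x f" and bF: "dual_basis R F J y g" and bL: "dual_basis R L K z l"
    and T1: "is_tensor R E F T1 b1" and T2: "is_tensor R T1 L T2 b2"
    and T3: "is_tensor R F L T3 b3" and T4: "is_tensor R E T3 T4 b4"
  obtains h where "h \<in> module_homs R T2 T4"
    "\<And>u v w. \<lbrakk>u \<in> carrier E; v \<in> carrier F; w \<in> carrier L\<rbrakk> \<Longrightarrow> h (b2 (b1 u v) w) = b4 u (b3 v w)"
proof -
  note D1 = is_tensorD[OF T1] and D2 = is_tensorD[OF T2] and D3 = is_tensorD[OF T3]
    and D4 = is_tensorD[OF T4]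
  interpret L: module R L by fact
  interpret T1: module R T1 by (rule D1(1))
  interpret T4: module R T4 by (rule D4(1))
  note b3 = bilinearD[OF D3(2)] and b4 = bilinearD[OF D4(2)]
  have "\<exists>h. h \<in> module_homs R T1 T4 \<and> (\<forall>u\<in>carrier E. \<forall>v\<in>carrier F. h (b1 u v) = b4 u (b3 v w))"
    if w: "w \<in> carrier L" for w
  proof -
    have "bilinear R E F T4 (\<lambda>u v. b4 u (b3 v w))"
      unfolding bilinear_def
      using module_hom_compose[OF b3(2)[OF w] b4(1)] b4(2) D3(3)[OF _ w] by auto
    from tensor_lift[OF E F D4(1) T1 bE bF this] show ?thesis by metis
  qed
  then obtain H where H: "\<And>w. w \<in> carrier L \<Longrightarrow> H w \<in> module_homs R T1 T4"
    "\<And>w u v. \<lbrakk>w \<in> carrier L; u \<in> carrier E; v \<in> carrier F\<rbrakk> \<Longrightarrow> H w (b1 u v) = b4 u (b3 v w)"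
    by metis
  have "(\<lambda>w. H w t) \<in> module_homs R L T4" if t: "t \<in> carrier T1" for t
  proof (rule module_homI)
    show "H w t \<in> carrier T4" if "w \<in> carrier L" for w
      using module_hom_closed[OF H(1)[OF that] t] .
    show "H (w \<oplus>\<^bsub>L\<^esub> w') t = H w t \<oplus>\<^bsub>T4\<^esub> H w' t" if w: "w \<in> carrier L" "w' \<in> carrier L" for w w'
      using t
    proof (rule tensor_induct[OF T1])
      fix u v assume uv: "u \<in> carrier E" "v \<in> carrier F"
      then show "H (w \<oplus>\<^bsub>L\<^esub> w') (b1 u v) = H w (b1 u v) \<oplus>\<^bsub>T4\<^esub> H w' (b1 u v)"
        using w by (simp add: H module_hom_add[OF b3(1)] module_hom_add[OF b4(1)] D3(3))
    next
      fix s t assume "s \<in> carrier T1" "t \<in> carrier T1"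
        "H (w \<oplus>\<^bsub>L\<^esub> w') s = H w s \<oplus>\<^bsub>T4\<^esub> H w' s" "H (w \<oplus>\<^bsub>L\<^esub> w') t = H w t \<oplus>\<^bsub>T4\<^esub> H w' t"
      then show "H (w \<oplus>\<^bsub>L\<^esub> w') (s \<oplus>\<^bsub>T1\<^esub> t) = H w (s \<oplus>\<^bsub>T1\<^esub> t) \<oplus>\<^bsub>T4\<^esub> H w' (s \<oplus>\<^bsub>T1\<^esub> t)"
        using w module_hom_closed[OF H(1)[OF w(1)]] module_hom_closed[OF H(1)[OF w(2)]]
        by (simp add: module_hom_add[OF H(1)] T4.M.a_ac)
    qed
    show "H (r \<odot>\<^bsub>L\<^esub> w) t = r \<odot>\<^bsub>T4\<^esub> H w t" if w: "r \<in> carrier R" "w \<in> carrier L" for r w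
      using t
    proof (rule tensor_induct[OF T1])
      fix u v assume uv: "u \<in> carrier E" "v \<in> carrier F"
      then show "H (r \<odot>\<^bsub>L\<^esub> w) (b1 u v) = r \<odot>\<^bsub>T4\<^esub> H w (b1 u v)"
        using w by (simp add: H module_hom_smult[OF b3(1)] module_hom_smult[OF b4(1)] D3(3))
    next
      fix s t assume "s \<in> carrier T1" "t \<in> carrier T1"
        "H (r \<odot>\<^bsub>L\<^esub> w) s = r \<odot>\<^bsub>T4\<^esub> H w s" "H (r \<odot>\<^bsub>L\<^esub> w) t = r \<odot>\<^bsub>T4\<^esub> H w t"
      then show "H (r \<odot>\<^bsub>L\<^esub> w) (s \<oplus>\<^bsub>T1\<^esub> t) = r \<odot>\<^bsub>T4\<^esub> H w (s \<oplus>\<^bsub>T1\<^esub> t)"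
        using w module_hom_closed[OF H(1)[OF w(2)]]
        by (simp add: module_hom_add[OF H(1)] T4.smult_r_distr)
    qed
  qed
  then have c: "bilinear R T1 L T4 (\<lambda>t w. H w t)"
    unfolding bilinear_def using H(1) by blast
  obtain k where "dual_basis R T1 (I \<times> J) (\<lambda>p. b1 (x (fst p)) (y (snd p))) k"
    using tensor_dual_basis[OF E F T1 bE bF] by metis
  from tensor_lift[OF D1(1) L D4(1) T2 this bL c]
  obtain h where "h \<in> module_homs R T2 T4"
    "\<And>t w. \<lbrakk>t \<in> carrier T1; w \<in> carrier L\<rbrakk> \<Longrightarrow> h (b2 t w) = H w t" by metis
  then show thesis using that H(2) D1(3) by simp
qed

lemma tensor_assoc:
  assumes E: "module R E" and F: "module R F" and L: "module R L"
    and bE: "dual_basis R E I x f" and bF: "dual_basis R F J y g" and bL: "dual_basis R L K z l"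
    and T1: "is_tensor R E F T1 b1" and T2: "is_tensor R T1 L T2 b2"
    and T3: "is_tensor R F L T3 b3" and T4: "is_tensor R E T3 T4 b4"
  shows "module_isomorphic R T2 T4"
proof -
  note D1 = is_tensorD[OF T1] and D2 = is_tensorD[OF T2] and D3 = is_tensorD[OF T3]
    and D4 = is_tensorD[OF T4]
  obtain h where h: "h \<in> module_homs R T2 T4"
    "\<And>u v w. \<lbrakk>u \<in> carrier E; v \<in> carrier F; w \<in> carrier L\<rbrakk> \<Longrightarrow> h (b2 (b1 u v) w) = b4 u (b3 v w)"
    using tensor_assoc_hom[OF E F L bE bF bL T1 T2 T3 T4] by metis
  \<comment> \<open>The inverse is the same map for the factors in reverse order.\<close>
  obtain k where k: "k \<in> module_homs R T4 T2"
    "\<And>u v w. \<lbrakk>w \<in> carrier L; v \<in> carrier F; u \<in> carrier E\<rbrakk> \<Longrightarrow> k (b4 u (b3 v w)) = b2 (b1 u v) w"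
    using tensor_assoc_hom[OF L F E bL bF bE tensor_flip[OF F T3] tensor_flip[OF E T4]
          tensor_flip[OF E T1] tensor_flip[OF D1(1) T2]] by metis
  have kh: "k (h t) = t" if "t \<in> carrier T2" for t
  proof (rule tensor_hom_eqI[OF T2 module_hom_compose[OF h(1) k(1)] _ _ that])
    fix s w assume s: "s \<in> carrier T1" and w: "w \<in> carrier L"
    note b2 = bilinearD(2)[OF D2(2) w]
    show "k (h (b2 s w)) = b2 s w"
      by (rule tensor_hom_eqI[OF T1 module_hom_compose[OF b2 module_hom_compose[OF h(1) k(1)]] b2 _ s])
         (simp add: h k w)
  qed (auto intro: module_homI)
  have hk: "h (k t) = t" if "t \<in> carrier T4" for t
  proof (rule tensor_hom_eqI[OF T4 module_hom_compose[OF k(1) h(1)] _ _ that])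
    fix u s assume u: "u \<in> carrier E" and s: "s \<in> carrier T3"
    note b4 = bilinearD(1)[OF D4(2) u]
    show "h (k (b4 u s)) = b4 u s"
      by (rule tensor_hom_eqI[OF T3 module_hom_compose[OF b4 module_hom_compose[OF k(1) h(1)]] b4 _ s])
         (simp add: h k u)
  qed (auto intro: module_homI)
  show ?thesis by (rule module_isomorphicI[OF h(1) k(1) kh hk])
qed

text \<open>
  If every \<open>v \<mapsto> f\<^sub>i(v) w\<close> is a scalar, then so is every endomorphism \<open>h\<close>, because
  \<open>h(v) = \<Sum> f\<^sub>i(v) h(x\<^sub>i)\<close>.
\<close>

lemma scalar_endos_of_dual_basis:
  assumes E: "module R E" and b: "dual_basis R E I x f"
    and sc: "\<And>i w. \<lbrakk>i \<in> I; w \<in> carrier E\<rbrakk> \<Longrightarrow> \<exists>r\<in>carrier R. \<forall>v\<in>carrier E. f i v \<odot>\<^bsub>E\<^esub> w = r \<odot>\<^bsub>E\<^esub> v"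
  shows "scalar_endos R E"
  unfolding scalar_endos_def
proof
  interpret E: module R E by fact
  note b = dual_basisD[OF b]
  fix h assume h: "h \<in> module_homs R E E"
  have "\<forall>i\<in>I. \<exists>r. r \<in> carrier R \<and> (\<forall>v\<in>carrier E. f i v \<odot>\<^bsub>E\<^esub> h (x i) = r \<odot>\<^bsub>E\<^esub> v)"
    using sc module_hom_closed[OF h] b(2) by blast
  from bchoice[OF this] obtain r where r: "\<And>i. i \<in> I \<Longrightarrow> r i \<in> carrier R"
    "\<And>i v. \<lbrakk>i \<in> I; v \<in> carrier E\<rbrakk> \<Longrightarrow> f i v \<odot>\<^bsub>E\<^esub> h (x i) = r i \<odot>\<^bsub>E\<^esub> v" by blast
  have "h v = finsum R r I \<odot>\<^bsub>E\<^esub> v" if v: "v \<in> carrier E" for v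
  proof -
    have "h v = h (finsum E (\<lambda>i. f i v \<odot>\<^bsub>E\<^esub> x i) I)" using b(5) v by simp
    also have "\<dots> = finsum E (\<lambda>i. h (f i v \<odot>\<^bsub>E\<^esub> x i)) I"
      by (rule module_hom_finsum[OF E E h]) (auto simp: b v)
    also have "\<dots> = finsum E (\<lambda>i. r i \<odot>\<^bsub>E\<^esub> v) I"
      by (rule E.M.finsum_cong') (auto simp: b r v module_hom_smult[OF h])
    also have "\<dots> = finsum R r I \<odot>\<^bsub>E\<^esub> v"
      by (rule E.smult_finsum_left[symmetric]) (auto simp: r v)
    finally show ?thesis .
  qed
  then show "\<exists>r\<in>carrier R. \<forall>v\<in>carrier E. h v = r \<odot>\<^bsub>E\<^esub> v"
    using r(1) by (intro bexI[of _ "finsum R r I"]) auto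
qed

lemma scalar_endosD:
  assumes E: "module R E" and "scalar_endos R E" "f \<in> dual R E" "w \<in> carrier E"
  shows "\<exists>r\<in>carrier R. \<forall>v\<in>carrier E. f v \<odot>\<^bsub>E\<^esub> w = r \<odot>\<^bsub>E\<^esub> v"
proof -
  interpret E: module R E by fact
  have "(\<lambda>v. f v \<odot>\<^bsub>E\<^esub> w) \<in> module_homs R E E"
    by (rule module_homI)
       (use assms(4) module_hom_closed[OF assms(3)] in
         \<open>auto simp: module_hom_add[OF assms(3)] module_hom_smult[OF assms(3)] E.smult_l_distr E.smult_assoc1\<close>)
  with assms(2) show ?thesis unfolding scalar_endos_def by (rule bspec)
qed

text \<open>
  For the functional \<open>f \<otimes> g\<close> of the dual basis and \<open>w = u' \<otimes> v'\<close>, the endomorphism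
  \<open>t \<mapsto> (f \<otimes> g)(t) w\<close> is the tensor product of \<open>u \<mapsto> f(u) u'\<close> and \<open>v \<mapsto> g(v) v'\<close>. These are
  multiplication by some \<open>r\<close> and \<open>s\<close>, so it is multiplication by \<open>r s\<close>.
\<close>

lemma picS_tensor:
  fixes E :: "('a, 'm) module" and F :: "('a, 'n) module"
  assumes pE: "picS_module R E" and pF: "picS_module R F" and T: "is_tensor R E F T b"
  shows "picS_module R T"
proof -
  note E = picS_moduleD[OF pE] and F = picS_moduleD[OF pF]
  obtain I :: "'m set" and x f where bE: "dual_basis R E I x f"
    using picS_moduleE[OF pE] by metis
  obtain J :: "'n set" and y g where bF: "dual_basis R F J y g"
    using picS_moduleE[OF pF] by metis
  obtain k where bT: "dual_basis R T (I \<times> J) (\<lambda>p. b (x (fst p)) (y (snd p))) k"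
    and k: "\<And>p u v. \<lbrakk>p \<in> I \<times> J; u \<in> carrier E; v \<in> carrier F\<rbrakk> \<Longrightarrow> k p (b u v) = f (fst p) u \<otimes>\<^bsub>R\<^esub> g (snd p) v"
    by (rule tensor_dual_basis[OF E(1) F(1) T bE bF]) (erule that, simp)
  interpret E: module R E by (rule E)
  interpret F: module R F by (rule F)
  interpret T: module R T by (rule is_tensorD(1)[OF T])
  note kd = dual_basisD(3)[OF bT] and kc = dual_basisD(4)[OF bT]
  note bc = is_tensorD(3)[OF T] and b2 = bilinearD[OF is_tensorD(2)[OF T]]
  have "\<exists>r\<in>carrier R. \<forall>t\<in>carrier T. k p t \<odot>\<^bsub>T\<^esub> w = r \<odot>\<^bsub>T\<^esub> t"
    if p: "p \<in> I \<times> J" and w: "w \<in> carrier T" for p w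
    using w
  proof (rule tensor_induct[OF T])
    fix u' v' assume uv': "u' \<in> carrier E" "v' \<in> carrier F"
    have "f (fst p) \<in> dual R E" "g (snd p) \<in> dual R F"
      using p dual_basisD(3)[OF bE] dual_basisD(3)[OF bF] by auto
    then obtain r s where r: "r \<in> carrier R" "\<forall>u\<in>carrier E. f (fst p) u \<odot>\<^bsub>E\<^esub> u' = r \<odot>\<^bsub>E\<^esub> u"
      and s: "s \<in> carrier R" "\<forall>v\<in>carrier F. g (snd p) v \<odot>\<^bsub>F\<^esub> v' = s \<odot>\<^bsub>F\<^esub> v"
      using scalar_endosD[OF E _ uv'(1)] scalar_endosD[OF F _ uv'(2)] by metis
    have smult2: "(a \<otimes>\<^bsub>R\<^esub> c) \<odot>\<^bsub>T\<^esub> b u v = b (a \<odot>\<^bsub>E\<^esub> u) (c \<odot>\<^bsub>F\<^esub> v)"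
      if "a \<in> carrier R" "c \<in> carrier R" "u \<in> carrier E" "v \<in> carrier F" for a c u v
      using that by (simp add: T.smult_assoc1[symmetric] E.m_comm bc module_hom_smult[OF b2(1)] module_hom_smult[OF b2(2)])
    have "k p t \<odot>\<^bsub>T\<^esub> b u' v' = (r \<otimes>\<^bsub>R\<^esub> s) \<odot>\<^bsub>T\<^esub> t" if t: "t \<in> carrier T" for t
      using t
    proof (rule tensor_induct[OF T])
      fix u v assume uv: "u \<in> carrier E" "v \<in> carrier F"
      have "f (fst p) u \<in> carrier R" "g (snd p) v \<in> carrier R"
        using p uv dual_basisD(4)[OF bE] dual_basisD(4)[OF bF] by auto
      then show "k p (b u v) \<odot>\<^bsub>T\<^esub> b u' v' = (r \<otimes>\<^bsub>R\<^esub> s) \<odot>\<^bsub>T\<^esub> b u v"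
        using uv uv' r s p by (simp add: k smult2)
    next
      fix t t' assume "t \<in> carrier T" "t' \<in> carrier T" "k p t \<odot>\<^bsub>T\<^esub> b u' v' = (r \<otimes>\<^bsub>R\<^esub> s) \<odot>\<^bsub>T\<^esub> t"
        "k p t' \<odot>\<^bsub>T\<^esub> b u' v' = (r \<otimes>\<^bsub>R\<^esub> s) \<odot>\<^bsub>T\<^esub> t'"
      then show "k p (t \<oplus>\<^bsub>T\<^esub> t') \<odot>\<^bsub>T\<^esub> b u' v' = (r \<otimes>\<^bsub>R\<^esub> s) \<odot>\<^bsub>T\<^esub> (t \<oplus>\<^bsub>T\<^esub> t')"
        using p uv' r(1) s(1)
        by (simp add: module_hom_add[OF kd] kc bc T.smult_l_distr T.smult_r_distr)
    qed
    then show "\<exists>r\<in>carrier R. \<forall>t\<in>carrier T. k p t \<odot>\<^bsub>T\<^esub> b u' v' = r \<odot>\<^bsub>T\<^esub> t"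
      using r(1) s(1) by (intro bexI[of _ "r \<otimes>\<^bsub>R\<^esub> s"]) auto
  next
    fix w w' assume w: "w \<in> carrier T" "w' \<in> carrier T"
      and "\<exists>r\<in>carrier R. \<forall>t\<in>carrier T. k p t \<odot>\<^bsub>T\<^esub> w = r \<odot>\<^bsub>T\<^esub> t"
      and "\<exists>r\<in>carrier R. \<forall>t\<in>carrier T. k p t \<odot>\<^bsub>T\<^esub> w' = r \<odot>\<^bsub>T\<^esub> t"
    then obtain r r' where "r \<in> carrier R" "r' \<in> carrier R"
      "\<forall>t\<in>carrier T. k p t \<odot>\<^bsub>T\<^esub> w = r \<odot>\<^bsub>T\<^esub> t" "\<forall>t\<in>carrier T. k p t \<odot>\<^bsub>T\<^esub> w' = r' \<odot>\<^bsub>T\<^esub> t"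
      by blast
    then show "\<exists>r\<in>carrier R. \<forall>t\<in>carrier T. k p t \<odot>\<^bsub>T\<^esub> (w \<oplus>\<^bsub>T\<^esub> w') = r \<odot>\<^bsub>T\<^esub> t"
      using w p by (intro bexI[of _ "r \<oplus>\<^bsub>R\<^esub> r'"]) (auto simp: kc T.smult_l_distr T.smult_r_distr)
  qed
  then have "scalar_endos R T"
    by (intro scalar_endos_of_dual_basis[OF is_tensorD(1)[OF T] bT])
  with is_tensorD(1)[OF T] bT show ?thesis by (rule picS_module_of_dual_basis)
qed

section \<open>The tensor product as a quotient of a free module\<close>

lemma gen_submodule_is_submodule:
  assumes M: "module R M" and S: "S \<subseteq> carrier M"
  shows "submodule (gen_submodule R M S) R M"
proof -
  interpret module R M by fact
  have sub: "N \<subseteq> carrier M" "\<zero>\<^bsub>M\<^esub> \<in> N" if "submodule N R M" for N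
    using submoduleE(1)[OF that] submodule_finsum[OF that, of "{}" "\<lambda>_. \<zero>\<^bsub>M\<^esub>"] by auto
  show ?thesis
    unfolding gen_submodule_def
  proof (rule submoduleI)
    show "\<Inter> {N. submodule N R M \<and> S \<subseteq> N} \<subseteq> carrier M"
      using carrier_is_submodule S by blast
  qed (auto dest: sub submoduleE(3-5))
qed

lemma kernel_is_submodule:
  assumes M: "module R M" and W: "module R W" and h: "h \<in> module_homs R M W"
  shows "submodule {v \<in> carrier M. h v = \<zero>\<^bsub>W\<^esub>} R M"
proof -
  interpret W: module R W by fact
  interpret M: module R M by fact
  show ?thesis
  proof (rule M.submoduleI)
    show "\<ominus>\<^bsub>M\<^esub> a \<in> {v \<in> carrier M. h v = \<zero>\<^bsub>W\<^esub>}" if "a \<in> {v \<in> carrier M. h v = \<zero>\<^bsub>W\<^esub>}" for a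
      using that M.smult_l_minus[of "\<one>\<^bsub>R\<^esub>" a] module_hom_smult[OF h, of "\<ominus>\<^bsub>R\<^esub> \<one>\<^bsub>R\<^esub>" a] by auto
  qed (auto simp: module_hom_zero[OF M W h] module_hom_add[OF h] module_hom_smult[OF h])
qed

context
  fixes R :: "('a, 'b) ring_scheme" and M :: "('a, 'm) module" and N :: "'m set"
  assumes M: "module R M" and N: "submodule N R M"
begin

interpretation M: module R M by (rule M)

interpretation N: abelian_subgroup N M
  using N by (intro abelian_subgroupI3 additive_subgroupI M.abelian_group_axioms)
    (simp add: submodule_def)

lemma quot_module_simps:
  "carrier (quot_module M N) = (\<lambda>v. N +>\<^bsub>M\<^esub> v) ` carrier M" "\<zero>\<^bsub>quot_module M N\<^esub> = N"
  "\<And>v w. \<lbrakk>v \<in> carrier M; w \<in> carrier M\<rbrakk> \<Longrightarrow>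
     (N +>\<^bsub>M\<^esub> v) \<oplus>\<^bsub>quot_module M N\<^esub> (N +>\<^bsub>M\<^esub> w) = N +>\<^bsub>M\<^esub> (v \<oplus>\<^bsub>M\<^esub> w)"
  "\<And>r v. \<lbrakk>r \<in> carrier R; v \<in> carrier M\<rbrakk> \<Longrightarrow>
     r \<odot>\<^bsub>quot_module M N\<^esub> (N +>\<^bsub>M\<^esub> v) = N +>\<^bsub>M\<^esub> (r \<odot>\<^bsub>M\<^esub> v)"
proof -
  show "carrier (quot_module M N) = (\<lambda>v. N +>\<^bsub>M\<^esub> v) ` carrier M"
    by (auto simp: quot_module_def A_RCOSETS_def')
  show "\<zero>\<^bsub>quot_module M N\<^esub> = N" by (simp add: quot_module_def)
  show "(N +>\<^bsub>M\<^esub> v) \<oplus>\<^bsub>quot_module M N\<^esub> (N +>\<^bsub>M\<^esub> w) = N +>\<^bsub>M\<^esub> (v \<oplus>\<^bsub>M\<^esub> w)"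
    if "v \<in> carrier M" "w \<in> carrier M" for v w
    using that by (simp add: quot_module_def N.a_rcos_sum)
  show "r \<odot>\<^bsub>quot_module M N\<^esub> (N +>\<^bsub>M\<^esub> v) = N +>\<^bsub>M\<^esub> (r \<odot>\<^bsub>M\<^esub> v)"
    if r: "r \<in> carrier R" and v: "v \<in> carrier M" for r v
  proof -
    have "N +>\<^bsub>M\<^esub> (r \<odot>\<^bsub>M\<^esub> w) = N +>\<^bsub>M\<^esub> (r \<odot>\<^bsub>M\<^esub> v)" if "w \<in> N +>\<^bsub>M\<^esub> v" for w
    proof -
      obtain n where n: "n \<in> N" "w = n \<oplus>\<^bsub>M\<^esub> v" using \<open>w \<in> N +>\<^bsub>M\<^esub> v\<close> by (auto simp: a_r_coset_def')
      have "r \<odot>\<^bsub>M\<^esub> w = r \<odot>\<^bsub>M\<^esub> n \<oplus>\<^bsub>M\<^esub> r \<odot>\<^bsub>M\<^esub> v"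
        unfolding n(2) by (rule M.smult_r_distr) (use n(1) r v N.a_subset in auto)
      then have "r \<odot>\<^bsub>M\<^esub> w \<in> N +>\<^bsub>M\<^esub> (r \<odot>\<^bsub>M\<^esub> v)"
        using M.submoduleE(4)[OF N r n(1)] by (auto simp: a_r_coset_def')
      then show ?thesis using r v by (intro N.a_repr_independence'[symmetric]) auto
    qed
    moreover have "v \<in> N +>\<^bsub>M\<^esub> v" using v by (rule N.a_rcos_self)
    ultimately have "(\<Union>w\<in>N +>\<^bsub>M\<^esub> v. N +>\<^bsub>M\<^esub> (r \<odot>\<^bsub>M\<^esub> w)) = N +>\<^bsub>M\<^esub> (r \<odot>\<^bsub>M\<^esub> v)"
      by (intro UN_constant_eq ballI)
    then show ?thesis by (simp add: quot_module_def)
  qed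
qed

lemma quot_module_is_module: "module R (quot_module M N)"
proof (rule moduleI)
  show "abelian_group (quot_module M N)"
  proof (rule abelian_groupI)
    show "\<zero>\<^bsub>quot_module M N\<^esub> \<in> carrier (quot_module M N)"
      using imageI[OF M.M.zero_closed, of "\<lambda>v. N +>\<^bsub>M\<^esub> v"] N.a_subset by (simp add: quot_module_simps)
  next
    fix A assume "A \<in> carrier (quot_module M N)"
    then obtain v where v: "v \<in> carrier M" "A = N +>\<^bsub>M\<^esub> v" by (auto simp: quot_module_simps)
    have N0: "N = N +>\<^bsub>M\<^esub> \<zero>\<^bsub>M\<^esub>" using N.a_subset by simp
    show "\<zero>\<^bsub>quot_module M N\<^esub> \<oplus>\<^bsub>quot_module M N\<^esub> A = A"
      using quot_module_simps(3)[OF M.M.zero_closed v(1)] v N0 by (simp add: quot_module_simps)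
    show "\<exists>B\<in>carrier (quot_module M N). B \<oplus>\<^bsub>quot_module M N\<^esub> A = \<zero>\<^bsub>quot_module M N\<^esub>"
      using v N0 by (intro bexI[of _ "N +>\<^bsub>M\<^esub> (\<ominus>\<^bsub>M\<^esub> v)"]) (auto simp: quot_module_simps M.M.l_neg)
  qed (auto simp: quot_module_simps M.M.a_ac)
qed (auto simp: quot_module_simps M.is_cring M.smult_l_distr M.smult_r_distr M.smult_assoc1)

lemma quot_projection_hom: "(\<lambda>v. N +>\<^bsub>M\<^esub> v) \<in> module_homs R M (quot_module M N)"
  by (rule module_homI) (auto simp: quot_module_simps)

lemma quot_module_factor:
  assumes W: "module R W" and h: "h \<in> module_homs R M W" and hN: "\<And>n. n \<in> N \<Longrightarrow> h n = \<zero>\<^bsub>W\<^esub>"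
  obtains k where "k \<in> module_homs R (quot_module M N) W"
    "\<And>v. v \<in> carrier M \<Longrightarrow> k (N +>\<^bsub>M\<^esub> v) = h v"
proof -
  interpret W: module R W by fact
  have const: "h w = h v" if "v \<in> carrier M" "w \<in> N +>\<^bsub>M\<^esub> v" for v w
  proof -
    obtain n where n: "n \<in> N" "w = n \<oplus>\<^bsub>M\<^esub> v" using \<open>w \<in> N +>\<^bsub>M\<^esub> v\<close> by (auto simp: a_r_coset_def')
    then have "h w = h n \<oplus>\<^bsub>W\<^esub> h v"
      using that N.a_subset by (auto simp: module_hom_add[OF h])
    then show ?thesis using hN n that module_hom_closed[OF h] by simp
  qed
  define k where "k A = h (SOME v. v \<in> A)" for A
  have k: "k (N +>\<^bsub>M\<^esub> v) = h v" if "v \<in> carrier M" for v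
    unfolding k_def by (rule const[OF that], rule someI[of _ v], rule N.a_rcos_self[OF that])
  have "k \<in> module_homs R (quot_module M N) W"
    by (rule module_homI)
       (auto simp: quot_module_simps k module_hom_closed[OF h] module_hom_add[OF h] module_hom_smult[OF h])
  then show thesis using that k by blast
qed

end

lemma (in cring) free_module_functional:
  assumes c: "\<And>s. s \<in> S \<Longrightarrow> c s \<in> carrier R"
  obtains h where "h \<in> dual R (free_module R S)" "\<And>s. s \<in> S \<Longrightarrow> h (free_basis R s) = c s"
proof -
  define h where "h = (\<lambda>v. finsum R (\<lambda>s. v s \<otimes> c s) {s. v s \<noteq> \<zero>})"
  have h_eq: "h v = finsum R (\<lambda>s. v s \<otimes> c s) I"
    if "v \<in> carrier (free_module R S)" "finite I" "I \<subseteq> S" "{s. v s \<noteq> \<zero>} \<subseteq> I" for v I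
    unfolding h_def using that c
    by (intro add.finprod_mono_neutral_cong_left) auto
  have supp: "{s. v s \<noteq> \<zero>} \<subseteq> S" "finite {s. v s \<noteq> \<zero>}" "\<And>s. v s \<in> carrier R"
    if "v \<in> carrier (free_module R S)" for v
    using that by auto
  interpret F: module R "free_module R S" by (rule free_module_is_module)
  have "h \<in> dual R (free_module R S)"
  proof (rule module_homI, simp_all del: free_module_simps)
    fix v assume v: "v \<in> carrier (free_module R S)"
    show "h v \<in> carrier R"
      unfolding h_def by (rule finsum_closed) (use supp[OF v] c in auto)
    fix w assume w: "w \<in> carrier (free_module R S)"
    let ?I = "{s. v s \<noteq> \<zero>} \<union> {s. w s \<noteq> \<zero>}"
    have I: "finite ?I" "?I \<subseteq> S" using supp[OF v] supp[OF w] by auto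
    have "h (v \<oplus>\<^bsub>free_module R S\<^esub> w) = finsum R (\<lambda>s. (v \<oplus>\<^bsub>free_module R S\<^esub> w) s \<otimes> c s) ?I"
      by (rule h_eq[OF F.M.add.m_closed[OF v w] I]) auto
    also have "\<dots> = finsum R (\<lambda>s. v s \<otimes> c s) ?I \<oplus> finsum R (\<lambda>s. w s \<otimes> c s) ?I"
      using I c supp[OF v] supp[OF w]
      by (intro trans[OF finsum_cong' finsum_addf]) (auto simp: l_distr)
    also have "\<dots> = h v \<oplus> h w"
      using h_eq[OF v I] h_eq[OF w I] by auto
    finally show "h (v \<oplus>\<^bsub>free_module R S\<^esub> w) = h v \<oplus> h w" .
  next
    fix r v assume r: "r \<in> carrier R" and v: "v \<in> carrier (free_module R S)"
    let ?I = "{s. v s \<noteq> \<zero>}"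
    note I = supp(2,1)[OF v]
    have "h (r \<odot>\<^bsub>free_module R S\<^esub> v) = finsum R (\<lambda>s. (r \<odot>\<^bsub>free_module R S\<^esub> v) s \<otimes> c s) ?I"
      by (rule h_eq[OF F.smult_closed[OF r v] I]) (use r in auto)
    also have "\<dots> = finsum R (\<lambda>s. r \<otimes> (v s \<otimes> c s)) ?I"
      using I c r supp[OF v] by (intro finsum_cong') (auto simp: m_assoc)
    also have "\<dots> = r \<otimes> h v"
      unfolding h_def using I c r supp[OF v] by (intro finsum_rdistr[symmetric]) auto
    finally show "h (r \<odot>\<^bsub>free_module R S\<^esub> v) = r \<otimes> h v" .
  qed
  moreover have "h (free_basis R s) = c s" if "s \<in> S" for s
  proof -
    have "h (free_basis R s) = finsum R (\<lambda>t. free_basis R s t \<otimes> c t) {s}"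
      by (rule h_eq[OF free_basis_closed[OF that]]) (use that in \<open>auto simp: free_basis_def\<close>)
    then show ?thesis using c[OF that] by (simp add: free_basis_def)
  qed
  ultimately show thesis using that by blast
qed

text \<open>
  The coset of the basis vector \<open>(x, y)\<close> in the quotient that defines the tensor product.
\<close>

definition pure_tensor ::
    "('a, 'b) ring_scheme \<Rightarrow> ('a, 'm) module \<Rightarrow> ('a, 'n) module \<Rightarrow> 'm \<Rightarrow> 'n \<Rightarrow> ('m \<times> 'n \<Rightarrow> 'a) set" where
  "pure_tensor R E F x y =
     gen_submodule R (free_module R (carrier E \<times> carrier F)) (tensor_relations R E F)
       +>\<^bsub>free_module R (carrier E \<times> carrier F)\<^esub> free_basis R (x, y)"

text \<open>
  The functional on the free module that sends the basis vector \<open>(x, y)\<close> to \<open>f(x) g(y)\<close> vanishes on the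
  tensor relations, so it descends to \<open>f \<otimes> g\<close> on the quotient.
\<close>

lemma tensor_module_is_tensor:
  fixes E :: "('a, 'm) module" and F :: "('a, 'n) module"
  assumes E: "module R E" and F: "module R F"
  shows "is_tensor R E F (tensor_module R E F) (pure_tensor R E F)"
proof -
  interpret E: module R E by fact
  interpret F: module R F by fact
  define L where "L = free_module R (carrier E \<times> carrier F)"
  have LM: "module R L" unfolding L_def by (rule E.free_module_is_module)
  interpret L: module R L by (rule LM)
  define e where "e x y = free_basis R (x, y)" for x :: 'm and y :: 'n
  have e: "e x y \<in> carrier L" if "x \<in> carrier E" "y \<in> carrier F" for x y
    unfolding e_def L_def using that by (intro E.free_basis_closed) auto
  define S where "S = tensor_relations R E F"
  have S_eq: "S =
       {e (x \<oplus>\<^bsub>E\<^esub> x') y \<ominus>\<^bsub>L\<^esub> (e x y \<oplus>\<^bsub>L\<^esub> e x' y) | x x' y.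
          x \<in> carrier E \<and> x' \<in> carrier E \<and> y \<in> carrier F} \<union>
       {e x (y \<oplus>\<^bsub>F\<^esub> y') \<ominus>\<^bsub>L\<^esub> (e x y \<oplus>\<^bsub>L\<^esub> e x y') | x y y'.
          x \<in> carrier E \<and> y \<in> carrier F \<and> y' \<in> carrier F} \<union>
       {e (r \<odot>\<^bsub>E\<^esub> x) y \<ominus>\<^bsub>L\<^esub> (r \<odot>\<^bsub>L\<^esub> e x y) | r x y.
          r \<in> carrier R \<and> x \<in> carrier E \<and> y \<in> carrier F} \<union>
       {e x (r \<odot>\<^bsub>F\<^esub> y) \<ominus>\<^bsub>L\<^esub> (r \<odot>\<^bsub>L\<^esub> e x y) | r x y.
          r \<in> carrier R \<and> x \<in> carrier E \<and> y \<in> carrier F}"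
    unfolding S_def tensor_relations_def Let_def L_def e_def by (rule refl)
  have SL: "S \<subseteq> carrier L"
    unfolding S_eq by (auto simp: e)
  define N where "N = gen_submodule R L S"
  have N: "submodule N R L" unfolding N_def by (rule gen_submodule_is_submodule[OF LM SL])
  have SN: "S \<subseteq> N" by (auto simp: N_def gen_submodule_def)
  define T where "T = quot_module L N"
  have T_eq: "tensor_module R E F = T"
    by (simp add: tensor_module_def Let_def T_def N_def S_def L_def)
  have TM: "module R T" unfolding T_def by (rule quot_module_is_module[OF LM N])
  interpret T: module R T by (rule TM)
  define q where "q v = N +>\<^bsub>L\<^esub> v" for v
  have q: "q \<in> module_homs R L T"
    unfolding q_def T_def by (rule quot_projection_hom[OF LM N])
  define b where "b x y = q (e x y)" for x y
  have b_eq: "pure_tensor R E F = b"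
    by (simp add: fun_eq_iff pure_tensor_def b_def q_def e_def N_def S_def L_def)
  have bc: "b x y \<in> carrier T" if "x \<in> carrier E" "y \<in> carrier F" for x y
    unfolding b_def using e that module_hom_closed[OF q] by blast
  have qN: "q v = q w" if "v \<ominus>\<^bsub>L\<^esub> w \<in> S" "v \<in> carrier L" "w \<in> carrier L" for v w
  proof -
    interpret N: abelian_subgroup N L
      using N by (intro abelian_subgroupI3 additive_subgroupI L.abelian_group_axioms) (simp add: submodule_def)
    have "v \<ominus>\<^bsub>L\<^esub> w \<in> N" using that SN by auto
    moreover have "v = (v \<ominus>\<^bsub>L\<^esub> w) \<oplus>\<^bsub>L\<^esub> w"
      using that(2,3) by (simp add: a_minus_def L.M.a_assoc L.M.l_neg)
    ultimately have "v \<in> N +>\<^bsub>L\<^esub> w" by (auto simp: a_r_coset_def')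
    then show ?thesis
      unfolding q_def using that(2,3) by (intro N.a_repr_independence'[symmetric])
  qed
  have bil: "bilinear R E F T b"
    unfolding bilinear_def
  proof (intro conjI ballI module_homI)
    fix x x' y assume c: "y \<in> carrier F" "x \<in> carrier E" "x' \<in> carrier E"
    then have "e (x \<oplus>\<^bsub>E\<^esub> x') y \<ominus>\<^bsub>L\<^esub> (e x y \<oplus>\<^bsub>L\<^esub> e x' y) \<in> S"
      unfolding S_eq by blast
    from qN[OF this] c show "b (x \<oplus>\<^bsub>E\<^esub> x') y = b x y \<oplus>\<^bsub>T\<^esub> b x' y"
      unfolding b_def by (simp add: e module_hom_add[OF q, symmetric])
  next
    fix x y y' assume c: "x \<in> carrier E" "y \<in> carrier F" "y' \<in> carrier F"
    then have "e x (y \<oplus>\<^bsub>F\<^esub> y') \<ominus>\<^bsub>L\<^esub> (e x y \<oplus>\<^bsub>L\<^esub> e x y') \<in> S"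
      unfolding S_eq by blast
    from qN[OF this] c show "b x (y \<oplus>\<^bsub>F\<^esub> y') = b x y \<oplus>\<^bsub>T\<^esub> b x y'"
      unfolding b_def by (simp add: e module_hom_add[OF q, symmetric])
  next
    fix r x y assume c: "y \<in> carrier F" "r \<in> carrier R" "x \<in> carrier E"
    then have "e (r \<odot>\<^bsub>E\<^esub> x) y \<ominus>\<^bsub>L\<^esub> (r \<odot>\<^bsub>L\<^esub> e x y) \<in> S"
      unfolding S_eq by blast
    from qN[OF this] c show "b (r \<odot>\<^bsub>E\<^esub> x) y = r \<odot>\<^bsub>T\<^esub> b x y"
      unfolding b_def by (simp add: e module_hom_smult[OF q, symmetric])
  next
    fix r x y assume c: "x \<in> carrier E" "r \<in> carrier R" "y \<in> carrier F"
    then have "e x (r \<odot>\<^bsub>F\<^esub> y) \<ominus>\<^bsub>L\<^esub> (r \<odot>\<^bsub>L\<^esub> e x y) \<in> S"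
      unfolding S_eq by blast
    from qN[OF this] c show "b x (r \<odot>\<^bsub>F\<^esub> y) = r \<odot>\<^bsub>T\<^esub> b x y"
      unfolding b_def by (simp add: e module_hom_smult[OF q, symmetric])
  qed (auto intro: bc)
  have span: "P t" if P: "\<forall>x\<in>carrier E. \<forall>y\<in>carrier F. P (b x y)"
    "\<forall>s\<in>carrier T. \<forall>t\<in>carrier T. P s \<longrightarrow> P t \<longrightarrow> P (s \<oplus>\<^bsub>T\<^esub> t)" and t: "t \<in> carrier T" for P t
  proof -
    have P0: "P \<zero>\<^bsub>T\<^esub>"
      using P(1)[rule_format, of "\<zero>\<^bsub>E\<^esub>" "\<zero>\<^bsub>F\<^esub>"] module_hom_zero[OF F TM bilinearD(1)[OF bil]] by simp
    have Psum: "P (finsum T g I)" if "\<And>i. i \<in> I \<Longrightarrow> g i \<in> carrier T" "\<And>i. i \<in> I \<Longrightarrow> P (g i)"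
      for g and I :: "('m \<times> 'n) set"
      using that
    proof (induction I rule: infinite_finite_induct)
      case (insert i I)
      then have "finsum T g (insert i I) = g i \<oplus>\<^bsub>T\<^esub> finsum T g I"
        by (intro T.M.finsum_insert) auto
      then show ?case using insert P(2) by (auto intro!: T.M.finsum_closed)
    qed (simp_all add: P0)
    obtain v where v: "v \<in> carrier L" "t = q v"
      using t by (auto simp: T_def quot_module_simps[OF LM N] q_def)
    let ?I = "{s. v s \<noteq> \<zero>\<^bsub>R\<^esub>}"
    have I: "finite ?I" "?I \<subseteq> carrier E \<times> carrier F" "\<And>s. v s \<in> carrier R"
      using v(1) by (auto simp: L_def)
    have bas: "free_basis R s \<in> carrier L" if "s \<in> ?I" for s
      unfolding L_def using that I(2) by (intro E.free_basis_closed) auto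
    have "v = finsum L (\<lambda>s. v s \<odot>\<^bsub>L\<^esub> free_basis R s) ?I"
      using E.free_module_expansion[of v "carrier E \<times> carrier F" ?I] v(1) I unfolding L_def by blast
    then have "t = q (finsum L (\<lambda>s. v s \<odot>\<^bsub>L\<^esub> free_basis R s) ?I)" using v(2) by simp
    also have "\<dots> = finsum T (\<lambda>s. q (v s \<odot>\<^bsub>L\<^esub> free_basis R s)) ?I"
      by (rule module_hom_finsum[OF LM TM q]) (use bas I in auto)
    finally have t_eq: "t = finsum T (\<lambda>s. q (v s \<odot>\<^bsub>L\<^esub> free_basis R s)) ?I" .
    show "P t"
      unfolding t_eq
    proof (rule Psum)
      fix s assume s: "s \<in> ?I"
      obtain x y where xy: "s = (x, y)" "x \<in> carrier E" "y \<in> carrier F" using s I(2) by auto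
      show "q (v s \<odot>\<^bsub>L\<^esub> free_basis R s) \<in> carrier T"
        using bas[OF s] I(3) module_hom_closed[OF q] by blast
      have "q (v s \<odot>\<^bsub>L\<^esub> free_basis R s) = v s \<odot>\<^bsub>T\<^esub> b x y"
        using bas[OF s] I(3) module_hom_smult[OF q] by (simp add: xy b_def e_def)
      also have "\<dots> = b (v s \<odot>\<^bsub>E\<^esub> x) y"
        using module_hom_smult[OF bilinearD(2)[OF bil xy(3)] I(3) xy(2)] by simp
      finally show "P (q (v s \<odot>\<^bsub>L\<^esub> free_basis R s))"
        using P(1) xy I(3) by simp
    qed
  qed
  have func: "\<exists>k\<in>dual R T. \<forall>x\<in>carrier E. \<forall>y\<in>carrier F. k (b x y) = f x \<otimes>\<^bsub>R\<^esub> g y"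
    if f: "f \<in> dual R E" and g: "g \<in> dual R F" for f g
  proof -
    have fc: "f x \<in> carrier R" if "x \<in> carrier E" for x using module_hom_closed[OF f that] by simp
    have gc: "g x \<in> carrier R" if "x \<in> carrier F" for x using module_hom_closed[OF g that] by simp
    have fg: "f (fst s) \<otimes>\<^bsub>R\<^esub> g (snd s) \<in> carrier R" if "s \<in> carrier E \<times> carrier F" for s
      using that fc gc by auto
    obtain h where h: "h \<in> dual R L"
      "\<And>s. s \<in> carrier E \<times> carrier F \<Longrightarrow> h (free_basis R s) = f (fst s) \<otimes>\<^bsub>R\<^esub> g (snd s)"
      by (rule E.free_module_functional[of "carrier E \<times> carrier F" "\<lambda>s. f (fst s) \<otimes>\<^bsub>R\<^esub> g (snd s)",
            OF fg, folded L_def], assumption, erule that, simp)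
    have he: "h (e x y) = f x \<otimes>\<^bsub>R\<^esub> g y" if "x \<in> carrier E" "y \<in> carrier F" for x y
      unfolding e_def using h(2) that by simp
    have hm: "h (v \<ominus>\<^bsub>L\<^esub> w) = \<zero>\<^bsub>R\<^esub>" if "v \<in> carrier L" "w \<in> carrier L" "h v = h w" for v w
    proof -
      have "\<ominus>\<^bsub>L\<^esub> w = (\<ominus>\<^bsub>R\<^esub> \<one>\<^bsub>R\<^esub>) \<odot>\<^bsub>L\<^esub> w" using that L.smult_l_minus[of "\<one>\<^bsub>R\<^esub>" w] by simp
      then show ?thesis
        using that module_hom_closed[OF h(1) that(2)]
        by (simp add: a_minus_def module_hom_add[OF h(1)] module_hom_smult[OF h(1)] E.R.l_minus E.R.r_neg)
    qed
    have "S \<subseteq> {v \<in> carrier L. h v = \<zero>\<^bsub>ideal_module R (carrier R)\<^esub>}"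
      unfolding S_eq
      by (auto simp: e he fc gc module_hom_add[OF h(1)] module_hom_smult[OF h(1)]
          module_hom_add[OF f] module_hom_add[OF g] module_hom_smult[OF f] module_hom_smult[OF g]
          E.l_distr E.r_distr E.m_assoc E.m_lcomm intro!: hm)
    then have "N \<subseteq> {v \<in> carrier L. h v = \<zero>\<^bsub>ideal_module R (carrier R)\<^esub>}"
      using kernel_is_submodule[OF LM E.regular_module_is_module h(1)]
      unfolding N_def gen_submodule_def by blast
    then obtain k where "k \<in> dual R T" "\<And>v. v \<in> carrier L \<Longrightarrow> k (N +>\<^bsub>L\<^esub> v) = h v"
      using quot_module_factor[OF LM N E.regular_module_is_module h(1)] unfolding T_def by blast
    then show ?thesis by (intro bexI[of _ k]) (auto simp: b_def q_def e he)
  qed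
  show ?thesis
    unfolding is_tensor_def T_eq b_eq using TM bil span func by (intro conjI allI impI ballI)
qed

section \<open>The monoid of isomorphism classes\<close>

lemma module_transport:
  fixes E :: "('a, 'm) module" and \<phi> :: "'m \<Rightarrow> 'n"
  assumes E: "module R E" and inj: "inj_on \<phi> (carrier E)"
  obtains M :: "('a, 'n) module" where "module R M" "module_isomorphic R M E"
proof -
  interpret E: module R E by fact
  define \<psi> where "\<psi> = the_inv_into (carrier E) \<phi>"
  have \<psi>: "\<psi> (\<phi> x) = x" if "x \<in> carrier E" for x
    using inj that by (simp add: \<psi>_def the_inv_into_f_f)
  define M :: "('a, 'n) module" where "M = \<lparr>carrier = \<phi> ` carrier E, mult = undefined, one = undefined, zero = \<phi> \<zero>\<^bsub>E\<^esub>,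
    add = (\<lambda>a b. \<phi> (\<psi> a \<oplus>\<^bsub>E\<^esub> \<psi> b)), smult = (\<lambda>r a. \<phi> (r \<odot>\<^bsub>E\<^esub> \<psi> a))\<rparr>"
  have M: "module R M"
  proof (rule moduleI)
    show "abelian_group M"
    proof (rule abelian_groupI)
      fix a assume "a \<in> carrier M"
      then obtain x where "x \<in> carrier E" "a = \<phi> x" by (auto simp: M_def)
      then show "\<exists>b\<in>carrier M. b \<oplus>\<^bsub>M\<^esub> a = \<zero>\<^bsub>M\<^esub>"
        by (intro bexI[of _ "\<phi> (\<ominus>\<^bsub>E\<^esub> x)"]) (auto simp: M_def \<psi> E.M.l_neg)
    qed (auto simp: M_def \<psi> E.M.a_ac)
  qed (auto simp: M_def \<psi> E.is_cring E.smult_l_distr E.smult_r_distr E.smult_assoc1)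
  moreover have "module_isomorphic R M E"
    by (rule module_isomorphicI[where h = \<psi> and k = \<phi>]) (auto simp: M_def \<psi> intro!: module_homI)
  ultimately show thesis by (rule that)
qed

text \<open>
  A vector is determined by its coordinates, so a module with a dual basis has a copy whose
  elements are lists over \<open>R\<close>.
\<close>

lemma list_representative:
  fixes E :: "('a, 'm) module"
  assumes E: "module R E" and b: "dual_basis R E I x f"
  obtains M :: "('a, 'a list) module" where "module R M" "module_isomorphic R M E"
proof -
  interpret E: module R E by fact
  note b = dual_basisD[OF b]
  obtain xs where xs: "set xs = I" using finite_list[OF b(1)] by blast
  have "inj_on (\<lambda>v. map (\<lambda>i. f i v) xs) (carrier E)"
  proof (rule inj_onI)
    fix v w assume v: "v \<in> carrier E" and w: "w \<in> carrier E"
      and eq: "map (\<lambda>i. f i v) xs = map (\<lambda>i. f i w) xs"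
    have "f i v = f i w" if "i \<in> I" for i using eq that xs by auto
    then have "finsum E (\<lambda>i. f i v \<odot>\<^bsub>E\<^esub> x i) I = finsum E (\<lambda>i. f i w \<odot>\<^bsub>E\<^esub> x i) I"
      by (intro E.M.finsum_cong') (auto simp: b w)
    then show "v = w" using b(5) v w by simp
  qed
  then show thesis using module_transport[OF E] that by metis
qed

text \<open>
  If \<open>e\<close> is an endomorphism of \<open>E'\<close>, then its conjugate by the isomorphism is a scalar on \<open>E\<close>, and the
  same scalar gives \<open>e\<close>.
\<close>

lemma picS_module_iso:
  fixes E :: "('a, 'm) module"
  assumes pE: "picS_module R E" and iso: "module_isomorphic R E E'" and E': "module R E'"
  shows "picS_module R E'"
proof -
  note E = picS_moduleD[OF pE]
  interpret E: module R E by (rule E(1))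
  interpret E': module R E' by fact
  obtain I :: "'m set" and x f where bE: "dual_basis R E I x f"
    using picS_moduleE[OF pE] by metis
  note b = dual_basisD[OF bE]
  obtain h k where h: "h \<in> module_homs R E E'" and k: "k \<in> module_homs R E' E"
    and kh: "\<And>x. x \<in> carrier E \<Longrightarrow> k (h x) = x" and hk: "\<And>x. x \<in> carrier E' \<Longrightarrow> h (k x) = x"
    using module_isomorphicE[OF iso E(1)] by metis
  note hc = module_hom_closed[OF h] and kc = module_hom_closed[OF k]
  have "dual_basis R E' I (\<lambda>i. h (x i)) (\<lambda>i v. f i (k v))"
    unfolding dual_basis_def
  proof (intro conjI ballI)
    show "(\<lambda>i v. f i (k v)) \<in> I \<rightarrow> dual R E'"
      using module_hom_compose[OF k b(3)] by auto
    fix v assume v: "v \<in> carrier E'"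
    have "v = h (finsum E (\<lambda>i. f i (k v) \<odot>\<^bsub>E\<^esub> x i) I)"
      using b(5)[OF kc[OF v]] hk[OF v] by simp
    also have "\<dots> = finsum E' (\<lambda>i. h (f i (k v) \<odot>\<^bsub>E\<^esub> x i)) I"
      by (rule module_hom_finsum[OF E(1) E' h]) (auto simp: b kc[OF v])
    also have "\<dots> = finsum E' (\<lambda>i. f i (k v) \<odot>\<^bsub>E'\<^esub> h (x i)) I"
      by (rule E'.M.finsum_cong') (auto simp: b kc[OF v] hc module_hom_smult[OF h])
    finally show "v = finsum E' (\<lambda>i. f i (k v) \<odot>\<^bsub>E'\<^esub> h (x i)) I" .
  qed (auto simp: b hc)
  moreover have "scalar_endos R E'"
    unfolding scalar_endos_def
  proof
    fix e assume e: "e \<in> module_homs R E' E'"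
    from module_hom_compose[OF module_hom_compose[OF h e] k] E(2)
    obtain r where r: "r \<in> carrier R" "\<forall>v\<in>carrier E. k (e (h v)) = r \<odot>\<^bsub>E\<^esub> v"
      unfolding scalar_endos_def by metis
    have "e v = r \<odot>\<^bsub>E'\<^esub> v" if v: "v \<in> carrier E'" for v
    proof -
      have "e v = h (k (e (h (k v))))" using v by (simp add: hk module_hom_closed[OF e])
      also have "\<dots> = h (r \<odot>\<^bsub>E\<^esub> k v)" using r(2) kc[OF v] by simp
      also have "\<dots> = r \<odot>\<^bsub>E'\<^esub> v" using r(1) v by (simp add: module_hom_smult[OF h] kc hk)
      finally show ?thesis .
    qed
    with r(1) show "\<exists>r\<in>carrier R. \<forall>v\<in>carrier E'. e v = r \<odot>\<^bsub>E'\<^esub> v" by blast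
  qed
  ultimately show ?thesis by (rule picS_module_of_dual_basis[OF E'])
qed

lemma module_class_eq:
  assumes "module R E" "module_isomorphic R E E'"
  shows "module_class R E = module_class R E'"
proof -
  have "module_isomorphic R M E \<longleftrightarrow> module_isomorphic R M E'" for M :: "('a, 'a list) module"
    using assms module_isomorphic_trans module_isomorphic_sym by metis
  then show ?thesis unfolding module_class_def by simp
qed

lemma module_class_iff:
  fixes E :: "('a, 'a list) module"
  assumes "module R E"
  shows "module_class R E = module_class R E' \<longleftrightarrow> module_isomorphic R E E'"
proof
  assume "module_class R E = module_class R E'"
  moreover have "E \<in> module_class R E"
    using assms by (simp add: module_class_def module_isomorphic_refl)
  ultimately show "module_isomorphic R E E'" by (simp add: module_class_def)
qed (use assms in \<open>rule module_class_eq\<close>)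

lemma picS_representative:
  fixes E :: "('a, 'm) module"
  assumes "picS_module R E"
  obtains M :: "('a, 'a list) module" where "picS_module R M" "module_isomorphic R M E"
    "module_class R M = module_class R E"
proof -
  note E = picS_moduleD(1)[OF assms]
  obtain I :: "'m set" and x f where bE: "dual_basis R E I x f"
    using picS_moduleE[OF assms] by metis
  obtain M :: "('a, 'a list) module" where M: "module R M" "module_isomorphic R M E"
    using list_representative[OF E bE] by metis
  have "picS_module R M"
    using assms module_isomorphic_sym[OF M(2,1)] M(1) by (rule picS_module_iso)
  then show thesis using that M module_class_eq[OF M] by blast
qed

lemma PicS_carrierI: "picS_module R E \<Longrightarrow> module_class R E \<in> carrier (PicS R)"
  using picS_representative[of R E] unfolding PicS_def by (simp, metis)

lemma PicS_carrierE:
  assumes "c \<in> carrier (PicS R)"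
  obtains E :: "('a, 'a list) module" where "picS_module R E" "c = module_class R E"
  using assms unfolding PicS_def by auto

text \<open>
  By \<open>tensor_unique\<close>, the tensor products of all representatives of the two classes are isomorphic
  to \<open>T\<close>, so the union in the definition of the product is a union of copies of one set. It is not
  empty because the classes have representatives over lists.
\<close>

lemma PicS_mult:
  fixes E :: "('a, 'm) module" and F :: "('a, 'n) module"
  assumes pE: "picS_module R E" and pF: "picS_module R F" and T: "is_tensor R E F T b"
  shows "module_class R E \<otimes>\<^bsub>PicS R\<^esub> module_class R F = module_class R T"
proof -
  note E = picS_moduleD(1)[OF pE] and F = picS_moduleD(1)[OF pF]
  have eq: "module_class R (tensor_module R E' F') = module_class R T"
    if E': "E' \<in> module_class R E" and F': "F' \<in> module_class R F" for E' F'
  proof -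
    have E'm: "module R E'" "module_isomorphic R E' E" using E' by (auto simp: module_class_def)
    have F'm: "module R F'" "module_isomorphic R F' F" using F' by (auto simp: module_class_def)
    have pE': "picS_module R E'"
      using pE module_isomorphic_sym[OF E'm(2,1)] E'm(1) by (rule picS_module_iso)
    have pF': "picS_module R F'"
      using pF module_isomorphic_sym[OF F'm(2,1)] F'm(1) by (rule picS_module_iso)
    obtain I :: "'a list set" and x f where bE: "dual_basis R E' I x f"
      using picS_moduleE[OF pE'] by metis
    obtain J :: "'a list set" and y g where bF: "dual_basis R F' J y g"
      using picS_moduleE[OF pF'] by metis
    obtain b1 where T1: "is_tensor R E' F T b1"
      using tensor_iso_left[OF E'm(2,1) T] by metis
    obtain b2 where T2: "is_tensor R E' F' T b2"
      using tensor_iso_right[OF E'm(1) F'm(2,1) T1] by metis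
    note T3 = tensor_module_is_tensor[OF E'm(1) F'm(1)]
    show ?thesis
      by (rule module_class_eq[OF is_tensorD(1)[OF T3] tensor_unique[OF E'm(1) F'm(1) bE bF T3 T2]])
  qed
  obtain M :: "('a, 'a list) module" where "picS_module R M" "module_isomorphic R M E"
    using picS_representative[OF pE] by metis
  then have M: "M \<in> module_class R E" by (simp add: module_class_def picS_moduleD)
  obtain N :: "('a, 'a list) module" where "picS_module R N" "module_isomorphic R N F"
    using picS_representative[OF pF] by metis
  then have N: "N \<in> module_class R F" by (simp add: module_class_def picS_moduleD)
  have "module_class R E \<otimes>\<^bsub>PicS R\<^esub> module_class R F
    = (\<Union>E'\<in>module_class R E. \<Union>F'\<in>module_class R F. module_class R (tensor_module R E' F'))"
    by (simp add: PicS_def)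
  also have "\<dots> = (\<Union>E'\<in>module_class R E. \<Union>F'\<in>module_class R F. module_class R T)"
    using eq by simp
  also have "\<dots> = module_class R T" using M N by auto
  finally show ?thesis .
qed

lemma PicS_mult_tensor_module:
  assumes "picS_module R E" "picS_module R F"
  shows "module_class R E \<otimes>\<^bsub>PicS R\<^esub> module_class R F = module_class R (tensor_module R E F)"
    and "picS_module R (tensor_module R E F)"
  using PicS_mult[OF assms] picS_tensor[OF assms] tensor_module_is_tensor picS_moduleD(1)[OF assms(1)]
    picS_moduleD(1)[OF assms(2)] by metis+

lemma (in cring) PIdl_idempotent_iff:
  assumes "e \<in> carrier R" "e \<otimes> e = e"
  shows "x \<in> PIdl e \<longleftrightarrow> x \<in> carrier R \<and> x \<otimes> e = x"
  using assms by (auto simp: cgenideal_def m_assoc intro: sym)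

lemma (in cring) picS_idempotent_ideal:
  assumes e: "e \<in> carrier R" "e \<otimes> e = e"
  shows "picS_module R (ideal_module R (PIdl e))"
proof -
  note iff = PIdl_idempotent_iff[OF e]
  have D: "module R (ideal_module R (PIdl e))"
    by (rule ideal_module_is_module, rule cgenideal_ideal, rule e)
  have "dual_basis R (ideal_module R (PIdl e)) {()} (\<lambda>_. e) (\<lambda>_ v. v)"
  proof -
    interpret D: module R "ideal_module R (PIdl e)" by (rule D)
    have "finsum (ideal_module R (PIdl e)) (\<lambda>i. v \<otimes> e) {()} = v" if "v \<in> PIdl e" for v
      using D.M.finsum_insert[of "{}" "()" "\<lambda>_. v \<otimes> e"] that e by (simp add: iff)
    then show ?thesis
      using e by (auto simp: dual_basis_def iff intro!: module_homI)
  qed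
  then show ?thesis
    using e by (intro picS_module_of_dual_basis scalar_endos_of_dual_basis D) (auto simp: iff m_comm)
qed

definition acts_trivially :: "'a \<Rightarrow> ('a, 'm) module \<Rightarrow> bool" where
  "acts_trivially e E \<longleftrightarrow> (\<forall>x\<in>carrier E. e \<odot>\<^bsub>E\<^esub> x = x)"

lemma unital_for_iff:
  assumes E: "module R E" and e: "e \<in> carrier R" "e \<otimes>\<^bsub>R\<^esub> e = e"
  shows "unital_for e E \<longleftrightarrow> acts_trivially e E"
proof -
  interpret module R E by fact
  show ?thesis
    unfolding unital_for_def acts_trivially_def
  proof
    assume eE: "carrier E = (\<lambda>x. e \<odot>\<^bsub>E\<^esub> x) ` carrier E"
    show "\<forall>x\<in>carrier E. e \<odot>\<^bsub>E\<^esub> x = x"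
    proof
      fix x assume "x \<in> carrier E"
      then obtain y where "y \<in> carrier E" "x = e \<odot>\<^bsub>E\<^esub> y" using eE by blast
      then show "e \<odot>\<^bsub>E\<^esub> x = x" using e smult_assoc1[of e e y] by simp
    qed
  next
    assume "\<forall>x\<in>carrier E. e \<odot>\<^bsub>E\<^esub> x = x"
    then have "(\<lambda>x. e \<odot>\<^bsub>E\<^esub> x) ` carrier E = (\<lambda>x. x) ` carrier E" by (intro image_cong) auto
    then show "carrier E = (\<lambda>x. e \<odot>\<^bsub>E\<^esub> x) ` carrier E" by simp
  qed
qed

lemma tensor_acts_trivially:
  assumes e: "e \<in> carrier R" and eE: "acts_trivially e E" and T: "is_tensor R E F T b"
  shows "acts_trivially e T"
  unfolding acts_trivially_def
proof
  interpret T: module R T by (rule is_tensorD(1)[OF T])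
  fix t assume "t \<in> carrier T"
  then show "e \<odot>\<^bsub>T\<^esub> t = t"
  proof (rule tensor_induct[OF T])
    fix x y assume "x \<in> carrier E" "y \<in> carrier F"
    then show "e \<odot>\<^bsub>T\<^esub> b x y = b x y"
      using module_hom_smult[OF bilinearD(2)[OF is_tensorD(2)[OF T]], of y e x] eE e
      by (simp add: acts_trivially_def)
  qed (simp add: T.smult_r_distr e)
qed

text \<open>
  For \<open>e = 1\<close> this is the unit law of \<open>PicS\<close>. A functional \<open>f\<close> on \<open>Re\<close> satisfies \<open>f(r) = r f(e)\<close>, so
  \<open>f \<otimes> g\<close> can only be \<open>x \<mapsto> f(e) g(x)\<close>.
\<close>

lemma (in cring) idempotent_ideal_tensor:
  assumes E: "module R E" and e: "e \<in> carrier R" "e \<otimes> e = e"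
    and eE: "\<And>x. x \<in> carrier E \<Longrightarrow> e \<odot>\<^bsub>E\<^esub> x = x"
  shows "is_tensor R (ideal_module R (PIdl e)) E E (\<lambda>r x. r \<odot>\<^bsub>E\<^esub> x)"
  unfolding is_tensor_def
proof (intro conjI allI impI ballI)
  interpret E: module R E by fact
  note iff = PIdl_idempotent_iff[OF e]
  have ee: "e \<in> PIdl e" using e by (simp add: iff)
  show "bilinear R (ideal_module R (PIdl e)) E E (\<odot>\<^bsub>E\<^esub>)"
    unfolding bilinear_def
    by (auto intro!: module_homI simp: iff E.smult_l_distr E.smult_r_distr E.smult_assoc1)
       (simp add: E.smult_assoc1[symmetric] m_comm)
  show "P t" if "\<forall>r\<in>carrier (ideal_module R (PIdl e)). \<forall>x\<in>carrier E. P (r \<odot>\<^bsub>E\<^esub> x)" "t \<in> carrier E" for P t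
    using that(1)[rule_format, of e t] that(2) ee eE by simp
  fix f g assume f: "f \<in> dual R (ideal_module R (PIdl e))" and g: "g \<in> dual R E"
  have fc: "f r \<in> carrier R" if "r \<in> PIdl e" for r using module_hom_closed[OF f] that by simp
  have gc: "g x \<in> carrier R" if "x \<in> carrier E" for x using module_hom_closed[OF g] that by simp
  have "(\<lambda>x. f e \<otimes> g x) \<in> dual R E"
    using fc[OF ee] gc
    by (auto intro!: module_homI simp: module_hom_add[OF g] module_hom_smult[OF g] r_distr m_lcomm)
  moreover have "f e \<otimes> g (r \<odot>\<^bsub>E\<^esub> x) = f r \<otimes> g x" if r: "r \<in> PIdl e" and x: "x \<in> carrier E" for r x
  proof -
    have "f r = r \<otimes> f e" using module_hom_smult[OF f, of r e] r ee by (simp add: iff)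
    then show ?thesis
      using r x fc[OF ee] gc[OF x] by (simp add: iff module_hom_smult[OF g] m_ac)
  qed
  ultimately show "\<exists>k\<in>dual R E. \<forall>r\<in>carrier (ideal_module R (PIdl e)). \<forall>x\<in>carrier E.
      k (r \<odot>\<^bsub>E\<^esub> x) = f r \<otimes> g x"
    by (intro bexI[of _ "\<lambda>x. f e \<otimes> g x"]) auto
qed (rule E)

lemma (in cring) PicS_mult_idempotent_ideal:
  assumes "picS_module R E" and e: "e \<in> carrier R" "e \<otimes> e = e"
    and eE: "\<And>x. x \<in> carrier E \<Longrightarrow> e \<odot>\<^bsub>E\<^esub> x = x"
  shows "module_class R (ideal_module R (PIdl e)) \<otimes>\<^bsub>PicS R\<^esub> module_class R E = module_class R E"
  using assms(1)
  by (intro PicS_mult[OF picS_idempotent_ideal[OF e] _ idempotent_ideal_tensor[OF _ e eE]] picS_moduleD(1))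

lemma (in cring) PicS_comm_monoid: "comm_monoid (PicS R)"
proof (rule comm_monoidI)
  have R: "PIdl \<one> = carrier R" by (auto simp: cgenideal_def intro!: exI r_one[symmetric])
  have pR: "picS_module R (ideal_module R (carrier R))"
    using picS_idempotent_ideal[of \<one>] R by simp
  have one: "\<one>\<^bsub>PicS R\<^esub> = module_class R (ideal_module R (carrier R))"
    by (simp add: PicS_def)
  show "\<one>\<^bsub>PicS R\<^esub> \<in> carrier (PicS R)"
    unfolding one by (rule PicS_carrierI[OF pR])
  fix c assume "c \<in> carrier (PicS R)"
  then obtain E :: "('a, 'a list) module" where E: "picS_module R E" "c = module_class R E"
    by (rule PicS_carrierE)
  interpret E: module R E by (rule picS_moduleD(1)[OF E(1)])
  show "\<one>\<^bsub>PicS R\<^esub> \<otimes>\<^bsub>PicS R\<^esub> c = c"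
    using PicS_mult_idempotent_ideal[OF E(1), of \<one>] by (simp add: one E(2) R)
  fix d assume "d \<in> carrier (PicS R)"
  then obtain F :: "('a, 'a list) module" where F: "picS_module R F" "d = module_class R F"
    by (rule PicS_carrierE)
  interpret F: module R F by (rule picS_moduleD(1)[OF F(1)])
  note EF = PicS_mult_tensor_module[OF E(1) F(1)]
  show "c \<otimes>\<^bsub>PicS R\<^esub> d \<in> carrier (PicS R)"
    unfolding E(2) F(2) EF(1) by (rule PicS_carrierI[OF EF(2)])
  note tEF = tensor_module_is_tensor[OF E.module_axioms F.module_axioms]
  show "c \<otimes>\<^bsub>PicS R\<^esub> d = d \<otimes>\<^bsub>PicS R\<^esub> c"
    unfolding E(2) F(2)
    by (simp add: PicS_mult[OF E(1) F(1) tEF] PicS_mult[OF F(1) E(1) tensor_flip[OF E.module_axioms tEF]])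
  fix a assume "a \<in> carrier (PicS R)"
  then obtain L :: "('a, 'a list) module" where L: "picS_module R L" "a = module_class R L"
    by (rule PicS_carrierE)
  interpret L: module R L by (rule picS_moduleD(1)[OF L(1)])
  note tFL = tensor_module_is_tensor[OF F.module_axioms L.module_axioms]
  note FL = PicS_mult_tensor_module[OF F(1) L(1)]
  note tEFL = tensor_module_is_tensor[OF picS_moduleD(1)[OF EF(2)] L.module_axioms]
  note tEFL' = tensor_module_is_tensor[OF E.module_axioms picS_moduleD(1)[OF FL(2)]]
  obtain I :: "'a list set" and x f where bE: "dual_basis R E I x f"
    using picS_moduleE[OF E(1)] by metis
  obtain J :: "'a list set" and y g where bF: "dual_basis R F J y g"
    using picS_moduleE[OF F(1)] by metis
  obtain K :: "'a list set" and z l where bL: "dual_basis R L K z l"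
    using picS_moduleE[OF L(1)] by metis
  show "c \<otimes>\<^bsub>PicS R\<^esub> d \<otimes>\<^bsub>PicS R\<^esub> a = c \<otimes>\<^bsub>PicS R\<^esub> (d \<otimes>\<^bsub>PicS R\<^esub> a)"
    unfolding E(2) F(2) L(2) EF(1) FL(1) PicS_mult_tensor_module(1)[OF EF(2) L(1)]
      PicS_mult_tensor_module(1)[OF E(1) FL(2)]
    by (rule module_class_eq[OF is_tensorD(1)[OF tEFL]])
       (rule tensor_assoc[OF E.module_axioms F.module_axioms L.module_axioms bE bF bL tEF tEFL tFL tEFL'])
qed

section \<open>Restriction of scalars between two corners of a ring\<close>

text \<open>
  Mutually inverse ring isomorphisms \<open>\<rho>: Re' \<rightarrow> Re\<close> and \<open>\<sigma>: Re \<rightarrow> Re'\<close>, extended to all of \<open>R\<close> by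
  \<open>\<rho>(r) = \<rho>(r e')\<close> and \<open>\<sigma>(r) = \<sigma>(r e)\<close>. The extensions are ring homomorphisms except that they send
  \<open>1\<close> to \<open>e\<close> and \<open>e'\<close>, which is harmless for modules on which these act as the identity.
\<close>

locale corner_iso = cring R for R :: "('a, 'b) ring_scheme" (structure) +
  fixes \<rho> \<sigma> :: "'a \<Rightarrow> 'a" and e e' :: 'a
  assumes e_closed [simp]: "e \<in> carrier R" and e'_closed [simp]: "e' \<in> carrier R"
    and \<rho>_closed [simp]: "r \<in> carrier R \<Longrightarrow> \<rho> r \<in> carrier R"
    and \<sigma>_closed [simp]: "r \<in> carrier R \<Longrightarrow> \<sigma> r \<in> carrier R"
    and \<rho>_add: "\<lbrakk>r \<in> carrier R; s \<in> carrier R\<rbrakk> \<Longrightarrow> \<rho> (r \<oplus> s) = \<rho> r \<oplus> \<rho> s"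
    and \<sigma>_add: "\<lbrakk>r \<in> carrier R; s \<in> carrier R\<rbrakk> \<Longrightarrow> \<sigma> (r \<oplus> s) = \<sigma> r \<oplus> \<sigma> s"
    and \<rho>_mult: "\<lbrakk>r \<in> carrier R; s \<in> carrier R\<rbrakk> \<Longrightarrow> \<rho> (r \<otimes> s) = \<rho> r \<otimes> \<rho> s"
    and \<sigma>_mult: "\<lbrakk>r \<in> carrier R; s \<in> carrier R\<rbrakk> \<Longrightarrow> \<sigma> (r \<otimes> s) = \<sigma> r \<otimes> \<sigma> s"
    and \<rho>_one: "\<rho> \<one> = e" and \<sigma>_one: "\<sigma> \<one> = e'"
    and \<rho>_\<sigma>: "r \<in> carrier R \<Longrightarrow> \<rho> (\<sigma> r) = r \<otimes> e"
    and \<sigma>_\<rho>: "r \<in> carrier R \<Longrightarrow> \<sigma> (\<rho> r) = r \<otimes> e'"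
begin

lemma \<sigma>_e': "r \<in> carrier R \<Longrightarrow> \<sigma> r \<otimes> e' = \<sigma> r"
  using \<sigma>_mult[of r \<one>] by (simp add: \<sigma>_one)

lemma \<rho>_e: "r \<in> carrier R \<Longrightarrow> \<rho> r \<otimes> e = \<rho> r"
  using \<rho>_mult[of r \<one>] by (simp add: \<rho>_one)

end

definition restrict_scalars :: "('a \<Rightarrow> 'a) \<Rightarrow> ('a, 'm) module \<Rightarrow> ('a, 'm) module" where
  "restrict_scalars \<rho> E = E\<lparr>smult := (\<lambda>r x. \<rho> r \<odot>\<^bsub>E\<^esub> x)\<rparr>"

lemma restrict_scalars_simps [simp]:
  "carrier (restrict_scalars \<rho> E) = carrier E" "add (restrict_scalars \<rho> E) = add E"
  "zero (restrict_scalars \<rho> E) = zero E" "smult (restrict_scalars \<rho> E) = (\<lambda>r x. \<rho> r \<odot>\<^bsub>E\<^esub> x)"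
  "finsum (restrict_scalars \<rho> E) = finsum E"
  by (simp_all add: restrict_scalars_def finsum_def fun_eq_iff)

context corner_iso
begin

lemma restrict_scalars_module:
  assumes E: "module R E" and eE: "acts_trivially e E"
  shows "module R (restrict_scalars \<rho> E)"
proof -
  interpret E: module R E by fact
  show ?thesis
  proof (rule moduleI)
    show "abelian_group (restrict_scalars \<rho> E)"
    proof (rule abelian_groupI)
      fix x assume "x \<in> carrier (restrict_scalars \<rho> E)"
      then show "\<exists>y\<in>carrier (restrict_scalars \<rho> E).
          y \<oplus>\<^bsub>restrict_scalars \<rho> E\<^esub> x = \<zero>\<^bsub>restrict_scalars \<rho> E\<^esub>"
        by (intro bexI[of _ "\<ominus>\<^bsub>E\<^esub> x"]) (auto simp: E.M.l_neg)
    qed (auto simp: E.M.a_ac)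
  qed (use eE in \<open>auto simp: is_cring acts_trivially_def \<rho>_one \<rho>_add \<rho>_mult
        E.smult_l_distr E.smult_r_distr E.smult_assoc1\<close>)
qed

lemma restrict_scalars_hom:
  "h \<in> module_homs R E F \<Longrightarrow> h \<in> module_homs R (restrict_scalars \<rho> E) (restrict_scalars \<rho> F)"
  by (auto simp: module_homs_def)

lemma restrict_scalars_iso:
  "module_isomorphic R E F \<Longrightarrow> module_isomorphic R (restrict_scalars \<rho> E) (restrict_scalars \<rho> F)"
  unfolding module_isomorphic_def using restrict_scalars_hom by fastforce

lemma smult_\<rho>_\<sigma>:
  assumes "module R E" "acts_trivially e E" "r \<in> carrier R" "x \<in> carrier E"
  shows "\<rho> (\<sigma> r) \<odot>\<^bsub>E\<^esub> x = r \<odot>\<^bsub>E\<^esub> x"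
proof -
  interpret E: module R E by fact
  show ?thesis using assms by (simp add: \<rho>_\<sigma> E.smult_assoc1 acts_trivially_def)
qed

text \<open>Since \<open>\<rho>\<close> maps onto \<open>Re\<close>, which is all that acts on \<open>E\<close>, no homomorphisms are added.\<close>

lemma restrict_scalars_hom_iff:
  assumes E: "module R E" "acts_trivially e E" and F: "module R F" "acts_trivially e F"
  shows "h \<in> module_homs R (restrict_scalars \<rho> E) (restrict_scalars \<rho> F) \<longleftrightarrow> h \<in> module_homs R E F"
proof
  assume h: "h \<in> module_homs R (restrict_scalars \<rho> E) (restrict_scalars \<rho> F)"
  show "h \<in> module_homs R E F"
  proof (rule module_homI)
    fix r x assume r: "r \<in> carrier R" and x: "x \<in> carrier E"
    have "h (r \<odot>\<^bsub>E\<^esub> x) = h (\<rho> (\<sigma> r) \<odot>\<^bsub>E\<^esub> x)" using smult_\<rho>_\<sigma>[OF E r x] by simp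
    also have "\<dots> = \<rho> (\<sigma> r) \<odot>\<^bsub>F\<^esub> h x" using module_hom_smult[OF h, of "\<sigma> r" x] r x by simp
    also have "\<dots> = r \<odot>\<^bsub>F\<^esub> h x" using smult_\<rho>_\<sigma>[OF F r] module_hom_closed[OF h] x by simp
    finally show "h (r \<odot>\<^bsub>E\<^esub> x) = r \<odot>\<^bsub>F\<^esub> h x" .
  qed (use module_hom_closed[OF h] module_hom_add[OF h] in auto)
qed (rule restrict_scalars_hom)

text \<open>Functionals on \<open>E\<close> and on its restriction correspond along \<open>\<sigma>\<close> and \<open>\<rho>\<close>.\<close>

lemma restrict_scalars_dual:
  assumes f: "f \<in> dual R E"
  shows "(\<lambda>x. \<sigma> (f x)) \<in> dual R (restrict_scalars \<rho> E)"
proof (rule module_homI, simp_all)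
  have fc: "f x \<in> carrier R" if "x \<in> carrier E" for x using module_hom_closed[OF f that] by simp
  show "\<sigma> (f x) \<in> carrier R" if "x \<in> carrier E" for x using fc[OF that] by simp
  show "\<sigma> (f (x \<oplus>\<^bsub>E\<^esub> y)) = \<sigma> (f x) \<oplus> \<sigma> (f y)" if "x \<in> carrier E" "y \<in> carrier E" for x y
    using that fc by (simp add: module_hom_add[OF f] \<sigma>_add)
  fix r x assume r: "r \<in> carrier R" and x: "x \<in> carrier E"
  have "\<sigma> (f (\<rho> r \<odot>\<^bsub>E\<^esub> x)) = \<sigma> (\<rho> r) \<otimes> \<sigma> (f x)"
    using r x fc by (simp add: module_hom_smult[OF f] \<sigma>_mult)
  also have "\<dots> = r \<otimes> (\<sigma> (f x) \<otimes> e')"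
    using r fc[OF x] by (simp add: \<sigma>_\<rho> m_ac)
  finally show "\<sigma> (f (\<rho> r \<odot>\<^bsub>E\<^esub> x)) = r \<otimes> \<sigma> (f x)"
    using fc[OF x] by (simp add: \<sigma>_e')
qed

lemma restrict_scalars_dual':
  assumes E: "module R E" "acts_trivially e E" and f: "f \<in> dual R (restrict_scalars \<rho> E)"
  shows "(\<lambda>x. \<rho> (f x)) \<in> dual R E" and "\<And>x. x \<in> carrier E \<Longrightarrow> \<sigma> (\<rho> (f x)) = f x"
proof -
  have fc: "f x \<in> carrier R" if "x \<in> carrier E" for x using module_hom_closed[OF f] that by simp
  show "(\<lambda>x. \<rho> (f x)) \<in> dual R E"
  proof (rule module_homI, simp_all)
    show "\<rho> (f x) \<in> carrier R" if "x \<in> carrier E" for x using fc[OF that] by simp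
    show "\<rho> (f (x \<oplus>\<^bsub>E\<^esub> y)) = \<rho> (f x) \<oplus> \<rho> (f y)" if "x \<in> carrier E" "y \<in> carrier E" for x y
      using that fc module_hom_add[OF f, of x y] by (simp add: \<rho>_add)
    fix r x assume r: "r \<in> carrier R" and x: "x \<in> carrier E"
    have "\<rho> (f (r \<odot>\<^bsub>E\<^esub> x)) = \<rho> (f (\<rho> (\<sigma> r) \<odot>\<^bsub>E\<^esub> x))"
      using smult_\<rho>_\<sigma>[OF E r x] by simp
    also have "f (\<rho> (\<sigma> r) \<odot>\<^bsub>E\<^esub> x) = \<sigma> r \<otimes> f x"
      using module_hom_smult[OF f, of "\<sigma> r" x] r x by simp
    also have "\<rho> (\<sigma> r \<otimes> f x) = r \<otimes> (\<rho> (f x) \<otimes> e)"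
      using r fc[OF x] by (simp add: \<rho>_mult \<rho>_\<sigma> m_ac)
    finally show "\<rho> (f (r \<odot>\<^bsub>E\<^esub> x)) = r \<otimes> \<rho> (f x)"
      using fc[OF x] by (simp add: \<rho>_e)
  qed
  fix x assume x: "x \<in> carrier E"
  have "\<rho> e' = e" using \<rho>_\<sigma>[of \<one>] by (simp add: \<sigma>_one)
  then have "e' \<otimes> f x = f x"
    using module_hom_smult[OF f, of e' x] x E(2) by (simp add: acts_trivially_def)
  then show "\<sigma> (\<rho> (f x)) = f x" using fc[OF x] by (simp add: \<sigma>_\<rho> m_comm)
qed

text \<open>
  The vectors of a dual basis stay, and the functionals become \<open>\<sigma> \<circ> f\<^sub>i\<close>; then \<open>\<rho>(\<sigma>(f\<^sub>i(v)))\<close> acts like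
  \<open>f\<^sub>i(v)\<close>.
\<close>

lemma restrict_scalars_picS:
  fixes E :: "('a, 'm) module"
  assumes pE: "picS_module R E" and eE: "acts_trivially e E"
  shows "picS_module R (restrict_scalars \<rho> E)"
proof -
  note E = picS_moduleD[OF pE]
  interpret E: module R E by (rule E(1))
  obtain I :: "'m set" and x f where bE: "dual_basis R E I x f"
    using picS_moduleE[OF pE] by metis
  note b = dual_basisD[OF bE]
  have "dual_basis R (restrict_scalars \<rho> E) I x (\<lambda>i v. \<sigma> (f i v))"
    unfolding dual_basis_def
  proof (intro conjI ballI)
    show "(\<lambda>i v. \<sigma> (f i v)) \<in> I \<rightarrow> dual R (restrict_scalars \<rho> E)"
      using restrict_scalars_dual[OF b(3)] by auto
    fix v assume v: "v \<in> carrier (restrict_scalars \<rho> E)"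
    have "finsum E (\<lambda>i. \<rho> (\<sigma> (f i v)) \<odot>\<^bsub>E\<^esub> x i) I = finsum E (\<lambda>i. f i v \<odot>\<^bsub>E\<^esub> x i) I"
      by (rule E.M.finsum_cong') (use v in \<open>auto simp: b smult_\<rho>_\<sigma>[OF E(1) eE]\<close>)
    then show "v = finsum (restrict_scalars \<rho> E) (\<lambda>i. \<sigma> (f i v) \<odot>\<^bsub>restrict_scalars \<rho> E\<^esub> x i) I"
      using v b(5) by simp
  qed (auto simp: b)
  moreover have "scalar_endos R (restrict_scalars \<rho> E)"
    unfolding scalar_endos_def
  proof
    fix h assume "h \<in> module_homs R (restrict_scalars \<rho> E) (restrict_scalars \<rho> E)"
    then have "h \<in> module_homs R E E" by (simp only: restrict_scalars_hom_iff[OF E(1) eE E(1) eE])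
    then obtain r where r: "r \<in> carrier R" "\<forall>v\<in>carrier E. h v = r \<odot>\<^bsub>E\<^esub> v"
      using E(2) unfolding scalar_endos_def by metis
    then show "\<exists>r\<in>carrier R. \<forall>v\<in>carrier (restrict_scalars \<rho> E). h v = r \<odot>\<^bsub>restrict_scalars \<rho> E\<^esub> v"
      by (intro bexI[of _ "\<sigma> r"]) (auto simp: smult_\<rho>_\<sigma>[OF E(1) eE])
  qed
  ultimately show ?thesis
    by (rule picS_module_of_dual_basis[OF restrict_scalars_module[OF E(1) eE]])
qed

text \<open>
  Bilinearity and generation are inherited because the additive groups do not change. Functionals
  \<open>f\<close>, \<open>g\<close> for the new action come from \<open>\<rho> \<circ> f\<close>, \<open>\<rho> \<circ> g\<close>, and \<open>\<sigma> \<circ> (\<rho>f \<otimes> \<rho>g)\<close> serves as \<open>f \<otimes> g\<close>.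
\<close>

lemma restrict_scalars_tensor:
  assumes E: "module R E" "acts_trivially e E" and F: "module R F" "acts_trivially e F"
    and T: "is_tensor R E F T b"
  shows "is_tensor R (restrict_scalars \<rho> E) (restrict_scalars \<rho> F) (restrict_scalars \<rho> T) b"
  unfolding is_tensor_def
proof (intro conjI allI impI ballI)
  note TD = is_tensorD[OF T]
  show "module R (restrict_scalars \<rho> T)"
    using TD(1) tensor_acts_trivially[OF e_closed E(2) T] by (rule restrict_scalars_module)
  show "bilinear R (restrict_scalars \<rho> E) (restrict_scalars \<rho> F) (restrict_scalars \<rho> T) b"
    using restrict_scalars_hom[OF bilinearD(1)[OF TD(2)]] restrict_scalars_hom[OF bilinearD(2)[OF TD(2)]]
    unfolding bilinear_def by simp
  show "P t" if P: "\<forall>x\<in>carrier (restrict_scalars \<rho> E). \<forall>y\<in>carrier (restrict_scalars \<rho> F). P (b x y)"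
    "\<forall>s\<in>carrier (restrict_scalars \<rho> T). \<forall>t\<in>carrier (restrict_scalars \<rho> T).
        P s \<longrightarrow> P t \<longrightarrow> P (s \<oplus>\<^bsub>restrict_scalars \<rho> T\<^esub> t)"
    and t: "t \<in> carrier (restrict_scalars \<rho> T)" for P t
  proof -
    from t have "t \<in> carrier T" by simp
    then show ?thesis
      by (rule tensor_induct[OF T]) (use P in simp_all)
  qed
  fix f g assume f: "f \<in> dual R (restrict_scalars \<rho> E)" and g: "g \<in> dual R (restrict_scalars \<rho> F)"
  note f' = restrict_scalars_dual'[OF E f] and g' = restrict_scalars_dual'[OF F g]
  obtain k where k: "k \<in> dual R T"
    "\<forall>x\<in>carrier E. \<forall>y\<in>carrier F. k (b x y) = \<rho> (f x) \<otimes> \<rho> (g y)"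
    using TD(4)[OF f'(1) g'(1)] by metis
  have fc: "f x \<in> carrier R" if "x \<in> carrier E" for x using module_hom_closed[OF f] that by simp
  have gc: "g x \<in> carrier R" if "x \<in> carrier F" for x using module_hom_closed[OF g] that by simp
  show "\<exists>k\<in>dual R (restrict_scalars \<rho> T). \<forall>x\<in>carrier (restrict_scalars \<rho> E).
      \<forall>y\<in>carrier (restrict_scalars \<rho> F). k (b x y) = f x \<otimes> g y"
    using k(2) by (intro bexI[OF _ restrict_scalars_dual[OF k(1)]]) (simp add: \<sigma>_mult fc gc f'(2) g'(2))
qed

end

section \<open>Classes of modules on which an idempotent acts as the identity\<close>

definition unital_classes :: "('a, 'b) ring_scheme \<Rightarrow> 'a \<Rightarrow> 'a module_class set" where
  "unital_classes R e =
     {module_class R E | E :: ('a, 'a list) module. picS_module R E \<and> acts_trivially e E}"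

lemma acts_trivially_iso:
  assumes iso: "module_isomorphic R E F" and E: "module R E" and e: "e \<in> carrier R"
    and eE: "acts_trivially e E"
  shows "acts_trivially e F"
proof -
  obtain h k where h: "h \<in> module_homs R E F" and k: "k \<in> module_homs R F E"
    and hk: "\<And>x. x \<in> carrier F \<Longrightarrow> h (k x) = x"
    using module_isomorphicE[OF iso E] by metis
  show ?thesis
    unfolding acts_trivially_def
  proof
    fix x assume x: "x \<in> carrier F"
    then have "k x \<in> carrier E" by (rule module_hom_closed[OF k])
    then show "e \<odot>\<^bsub>F\<^esub> x = x"
      using module_hom_smult[OF h e, of "k x"] eE hk[OF x] by (simp add: acts_trivially_def)
  qed
qed

text \<open>
  Membership can be tested on a module of any element type, although the classes are defined by
  representatives over lists.
\<close>

lemma unital_classesI: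
  assumes pE: "picS_module R E" and eE: "acts_trivially e E" and e: "e \<in> carrier R"
  shows "module_class R E \<in> unital_classes R e"
proof -
  obtain M :: "('a, 'a list) module" where M: "picS_module R M" "module_isomorphic R M E"
    "module_class R M = module_class R E"
    using picS_representative[OF pE] by metis
  have "acts_trivially e M"
    using acts_trivially_iso[OF module_isomorphic_sym[OF M(2) picS_moduleD(1)[OF M(1)]]
        picS_moduleD(1)[OF pE] e eE] .
  then show ?thesis unfolding unital_classes_def using M by auto
qed

lemma unital_classesD:
  assumes c: "module_class R E \<in> unital_classes R e" and pE: "picS_module R E" and e: "e \<in> carrier R"
  shows "acts_trivially e E"
proof -
  obtain F :: "('a, 'a list) module" where F: "picS_module R F" "acts_trivially e F"
    "module_class R F = module_class R E"
    using c by (auto simp: unital_classes_def)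
  then show ?thesis
    using module_class_iff[OF picS_moduleD(1)[OF F(1)]] acts_trivially_iso[OF _ picS_moduleD(1)[OF F(1)] e]
    by metis
qed

lemma unital_classesE:
  assumes "c \<in> unital_classes R e"
  obtains E :: "('a, 'a list) module" where "picS_module R E" "acts_trivially e E" "c = module_class R E"
  using assms by (auto simp: unital_classes_def)

lemma unital_classes_carrier: "unital_classes R e \<subseteq> carrier (PicS R)"
  by (auto simp: unital_classes_def PicS_carrierI)

context cring
begin

lemma unital_classes_ideal:
  assumes e: "e \<in> carrier R" and c: "c \<in> carrier (PicS R)" and d: "d \<in> unital_classes R e"
  shows "c \<otimes>\<^bsub>PicS R\<^esub> d \<in> unital_classes R e" "d \<otimes>\<^bsub>PicS R\<^esub> c \<in> unital_classes R e"
proof -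
  interpret P: comm_monoid "PicS R" by (rule PicS_comm_monoid)
  obtain E :: "('a, 'a list) module" where E: "picS_module R E" "c = module_class R E"
    using c by (rule PicS_carrierE)
  obtain F :: "('a, 'a list) module" where F: "picS_module R F" "acts_trivially e F" "d = module_class R F"
    using d by (rule unital_classesE)
  note T = tensor_module_is_tensor[OF picS_moduleD(1)[OF F(1)] picS_moduleD(1)[OF E(1)]]
  have "acts_trivially e (tensor_module R F E)"
    using e F(2) T by (rule tensor_acts_trivially)
  then show "d \<otimes>\<^bsub>PicS R\<^esub> c \<in> unital_classes R e"
    unfolding E(2) F(3) PicS_mult_tensor_module(1)[OF F(1) E(1)]
    by (intro unital_classesI PicS_mult_tensor_module(2)[OF F(1) E(1)] e)
  then show "c \<otimes>\<^bsub>PicS R\<^esub> d \<in> unital_classes R e"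
    using P.m_comm[OF c subsetD[OF unital_classes_carrier d]] by simp
qed

context
  fixes e assumes e: "e \<in> carrier R" "e \<otimes> e = e"
begin

lemma idempotent_class_mem: "module_class R (ideal_module R (PIdl e)) \<in> unital_classes R e"
  using e by (intro unital_classesI picS_idempotent_ideal)
    (auto simp: acts_trivially_def PIdl_idempotent_iff m_comm)

lemma idempotent_class_mult:
  assumes "c \<in> unital_classes R e"
  shows "module_class R (ideal_module R (PIdl e)) \<otimes>\<^bsub>PicS R\<^esub> c = c"
proof -
  obtain E :: "('a, 'a list) module" where E: "picS_module R E" "acts_trivially e E" "c = module_class R E"
    using assms by (rule unital_classesE)
  show ?thesis
    unfolding E(3) by (rule PicS_mult_idempotent_ideal[OF E(1) e]) (use E(2) in \<open>simp add: acts_trivially_def\<close>)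
qed

lemma idempotent_class_coset:
  "module_class R (ideal_module R (PIdl e)) <#\<^bsub>PicS R\<^esub> carrier (PicS R) = unital_classes R e"
proof
  interpret P: comm_monoid "PicS R" by (rule PicS_comm_monoid)
  show "module_class R (ideal_module R (PIdl e)) <#\<^bsub>PicS R\<^esub> carrier (PicS R) \<subseteq> unital_classes R e"
    using unital_classes_ideal(2)[OF e(1) _ idempotent_class_mem] by (auto simp: l_coset_def)
  show "unital_classes R e \<subseteq> module_class R (ideal_module R (PIdl e)) <#\<^bsub>PicS R\<^esub> carrier (PicS R)"
  proof
    fix c assume c: "c \<in> unital_classes R e"
    then have "c = module_class R (ideal_module R (PIdl e)) \<otimes>\<^bsub>PicS R\<^esub> c" "c \<in> carrier (PicS R)"
      using idempotent_class_mult[OF c] subsetD[OF unital_classes_carrier c] by simp_all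
    then show "c \<in> module_class R (ideal_module R (PIdl e)) <#\<^bsub>PicS R\<^esub> carrier (PicS R)"
      unfolding l_coset_def by blast
  qed
qed

text \<open>
  A class \<open>c\<close> in the intersection is the product \<open>[Re] c\<close>.
\<close>

lemma unital_classes_product:
  assumes f: "f \<in> carrier R"
  shows "unital_classes R e <#>\<^bsub>PicS R\<^esub> unital_classes R f = unital_classes R e \<inter> unital_classes R f"
proof
  show "unital_classes R e <#>\<^bsub>PicS R\<^esub> unital_classes R f \<subseteq> unital_classes R e \<inter> unital_classes R f"
  proof
    fix c assume "c \<in> unital_classes R e <#>\<^bsub>PicS R\<^esub> unital_classes R f"
    then obtain a b where ab: "a \<in> unital_classes R e" "b \<in> unital_classes R f" "c = a \<otimes>\<^bsub>PicS R\<^esub> b"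
      unfolding set_mult_def by blast
    then show "c \<in> unital_classes R e \<inter> unital_classes R f"
      using unital_classes_ideal(2)[OF e(1) subsetD[OF unital_classes_carrier ab(2)] ab(1)]
        unital_classes_ideal(1)[OF f subsetD[OF unital_classes_carrier ab(1)] ab(2)] by simp
  qed
  show "unital_classes R e \<inter> unital_classes R f \<subseteq> unital_classes R e <#>\<^bsub>PicS R\<^esub> unital_classes R f"
  proof
    fix c assume c: "c \<in> unital_classes R e \<inter> unital_classes R f"
    then have "c = module_class R (ideal_module R (PIdl e)) \<otimes>\<^bsub>PicS R\<^esub> c"
      using idempotent_class_mult by simp
    then show "c \<in> unital_classes R e <#>\<^bsub>PicS R\<^esub> unital_classes R f"
      unfolding set_mult_def using c idempotent_class_mem by blast
  qed
qed

end

end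

section \<open>The partial action on isomorphism classes\<close>

context unital_partial_action
begin

text \<open>
  The scalar \<open>\<rho>\<^sub>g(r)\<close> by which \<open>r\<close> acts on \<open>E\<^sub>g\<close>.
\<close>

definition twist_scalar :: "'g \<Rightarrow> 'a \<Rightarrow> 'a" where
  "twist_scalar g r = \<alpha> (inv\<^bsub>G\<^esub> g) (r \<otimes>\<^bsub>R\<^esub> u g)"

lemma twist_module_eq: "twist_module G R u \<alpha> g E = restrict_scalars (twist_scalar g) E"
  by (simp add: twist_module_def restrict_scalars_def twist_scalar_def)

lemma D_iff: "g \<in> carrier G \<Longrightarrow> x \<in> D g \<longleftrightarrow> x \<in> carrier R \<and> x \<otimes>\<^bsub>R\<^esub> u g = x"
  by (simp add: dom_def R.PIdl_idempotent_iff unit_closed unit_idem)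

lemma D_prod:
  assumes "g \<in> carrier G" "h \<in> carrier G"
  shows "D g \<cdot>\<^bsub>R\<^esub> D h = PIdl\<^bsub>R\<^esub> (u g \<otimes>\<^bsub>R\<^esub> u h)"
proof -
  have g: "u g \<in> carrier R" and h: "u h \<in> carrier R" using assms unit_closed by auto
  show ?thesis
  proof
    have "ideal (PIdl\<^bsub>R\<^esub> (u g \<otimes>\<^bsub>R\<^esub> u h)) R" using g h by (simp add: R.cgenideal_ideal)
    then interpret I: ideal "PIdl\<^bsub>R\<^esub> (u g \<otimes>\<^bsub>R\<^esub> u h)" R .
    show "D g \<cdot>\<^bsub>R\<^esub> D h \<subseteq> PIdl\<^bsub>R\<^esub> (u g \<otimes>\<^bsub>R\<^esub> u h)"
    proof
      fix x assume "x \<in> D g \<cdot>\<^bsub>R\<^esub> D h"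
      then show "x \<in> PIdl\<^bsub>R\<^esub> (u g \<otimes>\<^bsub>R\<^esub> u h)"
      proof induction
        case (prod i j)
        then have "i \<otimes>\<^bsub>R\<^esub> j = i \<otimes>\<^bsub>R\<^esub> j \<otimes>\<^bsub>R\<^esub> (u g \<otimes>\<^bsub>R\<^esub> u h)" "i \<otimes>\<^bsub>R\<^esub> j \<in> carrier R"
          using assms g h by (simp_all add: D_iff) (metis R.m_assoc R.m_closed R.m_comm)
        then show ?case unfolding cgenideal_def by blast
      qed (rule I.a_closed)
    qed
    show "PIdl\<^bsub>R\<^esub> (u g \<otimes>\<^bsub>R\<^esub> u h) \<subseteq> D g \<cdot>\<^bsub>R\<^esub> D h"
    proof
      fix x assume "x \<in> PIdl\<^bsub>R\<^esub> (u g \<otimes>\<^bsub>R\<^esub> u h)"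
      then obtain r where r: "r \<in> carrier R" "x = r \<otimes>\<^bsub>R\<^esub> (u g \<otimes>\<^bsub>R\<^esub> u h)"
        unfolding cgenideal_def by blast
      have "(r \<otimes>\<^bsub>R\<^esub> u g) \<otimes>\<^bsub>R\<^esub> u h \<in> D g \<cdot>\<^bsub>R\<^esub> D h"
        using r(1) assms g h by (intro ideal_prod.prod) (simp_all add: D_iff unit_idem R.m_assoc)
      then show "x \<in> D g \<cdot>\<^bsub>R\<^esub> D h" using r g h by (simp add: R.m_assoc)
    qed
  qed
qed

lemma D_prod_iff:
  assumes "g \<in> carrier G" "h \<in> carrier G"
  shows "x \<in> D g \<cdot>\<^bsub>R\<^esub> D h \<longleftrightarrow> x \<in> carrier R \<and> x \<otimes>\<^bsub>R\<^esub> (u g \<otimes>\<^bsub>R\<^esub> u h) = x"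
proof -
  have "(u g \<otimes>\<^bsub>R\<^esub> u h) \<otimes>\<^bsub>R\<^esub> (u g \<otimes>\<^bsub>R\<^esub> u h) = (u g \<otimes>\<^bsub>R\<^esub> u g) \<otimes>\<^bsub>R\<^esub> (u h \<otimes>\<^bsub>R\<^esub> u h)"
    using assms unit_closed by (simp add: R.m_ac)
  then show ?thesis
    using assms by (simp add: D_prod R.PIdl_idempotent_iff unit_closed unit_idem)
qed

lemma act_hom:
  assumes "g \<in> carrier G"
  shows "\<And>x. x \<in> D (inv\<^bsub>G\<^esub> g) \<Longrightarrow> \<alpha> g x \<in> D g"
    and "\<And>x y. \<lbrakk>x \<in> D (inv\<^bsub>G\<^esub> g); y \<in> D (inv\<^bsub>G\<^esub> g)\<rbrakk> \<Longrightarrow> \<alpha> g (x \<otimes>\<^bsub>R\<^esub> y) = \<alpha> g x \<otimes>\<^bsub>R\<^esub> \<alpha> g y"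
    and "\<And>x y. \<lbrakk>x \<in> D (inv\<^bsub>G\<^esub> g); y \<in> D (inv\<^bsub>G\<^esub> g)\<rbrakk> \<Longrightarrow> \<alpha> g (x \<oplus>\<^bsub>R\<^esub> y) = \<alpha> g x \<oplus>\<^bsub>R\<^esub> \<alpha> g y"
    and "\<alpha> g (u (inv\<^bsub>G\<^esub> g)) = u g"
  using ring_iso_memE[OF act_iso[OF assms]] by simp_all

lemma u_one: "u \<one>\<^bsub>G\<^esub> = \<one>\<^bsub>R\<^esub>"
  using D_iff[of "\<one>\<^bsub>G\<^esub>" "\<one>\<^bsub>R\<^esub>"] dom_one unit_closed[of "\<one>\<^bsub>G\<^esub>"] by simp

text \<open>
  The map \<open>\<alpha>\<^sub>g\<close> carries the ideal generated by the idempotent \<open>1\<^bsub>g\<inverse>\<^esub> 1\<^sub>h\<close> onto the ideal generated by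
  \<open>1\<^sub>g 1\<^bsub>gh\<^esub>\<close>. A multiplicative surjection sends the unit of the first ideal to the unit of the second.
\<close>

lemma act_unit_mult:
  assumes g: "g \<in> carrier G" and h: "h \<in> carrier G"
  shows "\<alpha> g (u (inv\<^bsub>G\<^esub> g) \<otimes>\<^bsub>R\<^esub> u h) = u g \<otimes>\<^bsub>R\<^esub> u (g \<otimes>\<^bsub>G\<^esub> h)"
proof -
  define a where "a = u (inv\<^bsub>G\<^esub> g) \<otimes>\<^bsub>R\<^esub> u h"
  define b where "b = u g \<otimes>\<^bsub>R\<^esub> u (g \<otimes>\<^bsub>G\<^esub> h)"
  have c: "u (inv\<^bsub>G\<^esub> g) \<in> carrier R" "u h \<in> carrier R" "u g \<in> carrier R" "u (g \<otimes>\<^bsub>G\<^esub> h) \<in> carrier R"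
    using g h unit_closed by simp_all
  have idem: "u (inv\<^bsub>G\<^esub> g) \<otimes>\<^bsub>R\<^esub> u (inv\<^bsub>G\<^esub> g) = u (inv\<^bsub>G\<^esub> g)" "u h \<otimes>\<^bsub>R\<^esub> u h = u h"
    "u g \<otimes>\<^bsub>R\<^esub> u g = u g" "u (g \<otimes>\<^bsub>G\<^esub> h) \<otimes>\<^bsub>R\<^esub> u (g \<otimes>\<^bsub>G\<^esub> h) = u (g \<otimes>\<^bsub>G\<^esub> h)"
    using g h unit_idem by simp_all
  have aa: "a \<otimes>\<^bsub>R\<^esub> a = a" "a \<in> carrier R"
    unfolding a_def using c idem by (simp_all add: R.m_ac) (metis R.m_assoc R.m_comm R.m_closed)
  have bb: "b \<otimes>\<^bsub>R\<^esub> b = b" "b \<in> carrier R"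
    unfolding b_def using c idem by (simp_all add: R.m_ac) (metis R.m_assoc R.m_comm R.m_closed)
  have im: "\<alpha> g ` {x \<in> carrier R. x \<otimes>\<^bsub>R\<^esub> a = x} = {x \<in> carrier R. x \<otimes>\<^bsub>R\<^esub> b = x}"
  proof -
    have "D k \<cdot>\<^bsub>R\<^esub> D l = {x \<in> carrier R. x \<otimes>\<^bsub>R\<^esub> (u k \<otimes>\<^bsub>R\<^esub> u l) = x}"
      if "k \<in> carrier G" "l \<in> carrier G" for k l
      using D_prod_iff[OF that] by blast
    then show ?thesis
      using act_dom[OF g h] g h unfolding a_def b_def by simp
  qed
  have sub: "x \<in> D (inv\<^bsub>G\<^esub> g)" if "x \<in> carrier R" "x \<otimes>\<^bsub>R\<^esub> a = x" for x
  proof -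
    have "x \<otimes>\<^bsub>R\<^esub> u (inv\<^bsub>G\<^esub> g) = (x \<otimes>\<^bsub>R\<^esub> a) \<otimes>\<^bsub>R\<^esub> u (inv\<^bsub>G\<^esub> g)" using that by simp
    also have "\<dots> = x \<otimes>\<^bsub>R\<^esub> (u (inv\<^bsub>G\<^esub> g) \<otimes>\<^bsub>R\<^esub> u (inv\<^bsub>G\<^esub> g) \<otimes>\<^bsub>R\<^esub> u h)"
      unfolding a_def using that(1) c by (simp add: R.m_ac)
    also have "\<dots> = x" using that unfolding a_def idem by simp
    finally show ?thesis using that g by (simp add: D_iff)
  qed
  have "\<alpha> g a \<in> {x \<in> carrier R. x \<otimes>\<^bsub>R\<^esub> b = x}"
    unfolding im[symmetric] using aa by blast
  then have 1: "\<alpha> g a \<otimes>\<^bsub>R\<^esub> b = \<alpha> g a" "\<alpha> g a \<in> carrier R" by auto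
  have "b \<in> {x \<in> carrier R. x \<otimes>\<^bsub>R\<^esub> b = x}" using bb by blast
  then obtain z where z: "z \<in> carrier R" "z \<otimes>\<^bsub>R\<^esub> a = z" "b = \<alpha> g z"
    unfolding im[symmetric] by blast
  have "b = b \<otimes>\<^bsub>R\<^esub> \<alpha> g a"
    using act_hom(2)[OF g sub[OF z(1,2)] sub[OF aa(2,1)]] z by simp
  then show ?thesis
    using 1 bb unfolding a_def b_def by (metis R.m_comm)
qed

lemma twist_scalar_unit:
  assumes g: "g \<in> carrier G" and h: "h \<in> carrier G"
  shows "twist_scalar g (u h) = u (inv\<^bsub>G\<^esub> g) \<otimes>\<^bsub>R\<^esub> u (inv\<^bsub>G\<^esub> g \<otimes>\<^bsub>G\<^esub> h)"
  using act_unit_mult[of "inv\<^bsub>G\<^esub> g" h] g h unfolding twist_scalar_def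
  by (simp add: R.m_comm unit_closed)

lemma mult_unit_mem:
  assumes "g \<in> carrier G" "r \<in> carrier R"
  shows "r \<otimes>\<^bsub>R\<^esub> u g \<in> D g"
  using assms by (simp add: D_iff R.m_assoc unit_closed unit_idem)

lemma act_inverse:
  assumes g: "g \<in> carrier G" and x: "x \<in> D (inv\<^bsub>G\<^esub> g)"
  shows "\<alpha> (inv\<^bsub>G\<^esub> g) (\<alpha> g x) = x"
proof -
  have "x \<in> D (inv\<^bsub>G\<^esub> g) \<cdot>\<^bsub>R\<^esub> D (inv\<^bsub>G\<^esub> (inv\<^bsub>G\<^esub> g \<otimes>\<^bsub>G\<^esub> g))"
    using g x D_iff[of "inv\<^bsub>G\<^esub> g" x] by (simp add: D_prod_iff u_one unit_closed)
  then show ?thesis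
    using act_act[of "inv\<^bsub>G\<^esub> g" g x] g x by (simp add: act_one D_iff)
qed

lemma corner_iso_twist_scalar:
  assumes g: "g \<in> carrier G"
  shows "corner_iso R (twist_scalar g) (twist_scalar (inv\<^bsub>G\<^esub> g)) (u (inv\<^bsub>G\<^esub> g)) (u g)"
proof -
  have inD: "r \<otimes>\<^bsub>R\<^esub> u g \<in> D (inv\<^bsub>G\<^esub> (inv\<^bsub>G\<^esub> g))" if "r \<in> carrier R" "g \<in> carrier G" for r g
    using that mult_unit_mem by simp
  have mem: "twist_scalar g r \<in> D (inv\<^bsub>G\<^esub> g)" if "g \<in> carrier G" "r \<in> carrier R" for g r
    unfolding twist_scalar_def using that inD by (intro act_hom(1)) auto
  have closed: "twist_scalar g r \<in> carrier R" if "g \<in> carrier G" "r \<in> carrier R" for g r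
    using mem[OF that] that by (simp add: D_iff)
  have add: "twist_scalar g (r \<oplus>\<^bsub>R\<^esub> s) = twist_scalar g r \<oplus>\<^bsub>R\<^esub> twist_scalar g s"
    if "g \<in> carrier G" "r \<in> carrier R" "s \<in> carrier R" for g r s
    unfolding twist_scalar_def using that
    by (simp add: R.l_distr unit_closed act_hom(3)[of "inv\<^bsub>G\<^esub> g"] mult_unit_mem)
  have mult: "twist_scalar g (r \<otimes>\<^bsub>R\<^esub> s) = twist_scalar g r \<otimes>\<^bsub>R\<^esub> twist_scalar g s"
    if "g \<in> carrier G" "r \<in> carrier R" "s \<in> carrier R" for g r s
  proof -
    have "(r \<otimes>\<^bsub>R\<^esub> u g) \<otimes>\<^bsub>R\<^esub> (s \<otimes>\<^bsub>R\<^esub> u g) = r \<otimes>\<^bsub>R\<^esub> s \<otimes>\<^bsub>R\<^esub> (u g \<otimes>\<^bsub>R\<^esub> u g)"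
      using that unit_closed[of g] by (simp add: R.m_ac)
    then have "r \<otimes>\<^bsub>R\<^esub> s \<otimes>\<^bsub>R\<^esub> u g = (r \<otimes>\<^bsub>R\<^esub> u g) \<otimes>\<^bsub>R\<^esub> (s \<otimes>\<^bsub>R\<^esub> u g)"
      using that unit_idem by simp
    then show ?thesis
      unfolding twist_scalar_def using that inD by (simp add: act_hom(2)[of "inv\<^bsub>G\<^esub> g"])
  qed
  have one: "twist_scalar g \<one>\<^bsub>R\<^esub> = u (inv\<^bsub>G\<^esub> g)" if "g \<in> carrier G" for g
    unfolding twist_scalar_def using that act_hom(4)[of "inv\<^bsub>G\<^esub> g"] by (simp add: unit_closed)
  have inverse: "twist_scalar g (twist_scalar (inv\<^bsub>G\<^esub> g) r) = r \<otimes>\<^bsub>R\<^esub> u (inv\<^bsub>G\<^esub> g)"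
    if "g \<in> carrier G" "r \<in> carrier R" for g r
  proof -
    have "twist_scalar (inv\<^bsub>G\<^esub> g) r \<otimes>\<^bsub>R\<^esub> u g = twist_scalar (inv\<^bsub>G\<^esub> g) r"
      using mem[of "inv\<^bsub>G\<^esub> g" r] that by (simp add: D_iff)
    then show ?thesis
      using that act_inverse[of g "r \<otimes>\<^bsub>R\<^esub> u (inv\<^bsub>G\<^esub> g)"] mult_unit_mem[of "inv\<^bsub>G\<^esub> g" r]
      by (simp add: twist_scalar_def)
  qed
  show ?thesis
    using g closed add mult one inverse[of g] inverse[of "inv\<^bsub>G\<^esub> g"]
    by unfold_locales (simp_all add: unit_closed)
qed

text \<open>
  Insert the idempotents needed to land in the domain where the action is associative: for
  \<open>t = r 1\<^bsub>gh\<^esub> 1\<^sub>g\<close> both sides equal \<open>\<alpha>\<^bsub>h\<inverse>\<^esub>(\<alpha>\<^bsub>g\<inverse>\<^esub>(t)) = \<alpha>\<^bsub>(gh)\<inverse>\<^esub>(t)\<close>. The idempotents come out again by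
  \<open>twist_scalar_unit\<close>.
\<close>

lemma twist_scalar_compose:
  assumes g: "g \<in> carrier G" and h: "h \<in> carrier G" and r: "r \<in> carrier R"
  shows "twist_scalar h (twist_scalar g r) = twist_scalar (g \<otimes>\<^bsub>G\<^esub> h) r \<otimes>\<^bsub>R\<^esub> u (inv\<^bsub>G\<^esub> h)"
proof -
  interpret g: corner_iso R "twist_scalar g" "twist_scalar (inv\<^bsub>G\<^esub> g)" "u (inv\<^bsub>G\<^esub> g)" "u g"
    by (rule corner_iso_twist_scalar[OF g])
  have gh: "g \<otimes>\<^bsub>G\<^esub> h \<in> carrier G" using g h by simp
  interpret gh: corner_iso R "twist_scalar (g \<otimes>\<^bsub>G\<^esub> h)" "twist_scalar (inv\<^bsub>G\<^esub> (g \<otimes>\<^bsub>G\<^esub> h))"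
      "u (inv\<^bsub>G\<^esub> (g \<otimes>\<^bsub>G\<^esub> h))" "u (g \<otimes>\<^bsub>G\<^esub> h)"
    by (rule corner_iso_twist_scalar[OF gh])
  have c: "u g \<in> carrier R" "u h \<in> carrier R" "u (g \<otimes>\<^bsub>G\<^esub> h) \<in> carrier R" "u (inv\<^bsub>G\<^esub> h) \<in> carrier R"
    "u (inv\<^bsub>G\<^esub> g) \<in> carrier R" "u (inv\<^bsub>G\<^esub> (g \<otimes>\<^bsub>G\<^esub> h)) \<in> carrier R"
    using g h unit_closed by simp_all
  define t where "t = r \<otimes>\<^bsub>R\<^esub> u (g \<otimes>\<^bsub>G\<^esub> h) \<otimes>\<^bsub>R\<^esub> u g"
  have ig: "inv\<^bsub>G\<^esub> g \<otimes>\<^bsub>G\<^esub> (g \<otimes>\<^bsub>G\<^esub> h) = h"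
    using g h by (simp add: G.m_assoc[symmetric])
  have igh: "inv\<^bsub>G\<^esub> (g \<otimes>\<^bsub>G\<^esub> h) \<otimes>\<^bsub>G\<^esub> g = inv\<^bsub>G\<^esub> h"
    using g h by (simp add: G.inv_mult_group G.m_assoc)
  have "\<alpha> (inv\<^bsub>G\<^esub> g) t = twist_scalar g (r \<otimes>\<^bsub>R\<^esub> u (g \<otimes>\<^bsub>G\<^esub> h))"
    by (simp add: twist_scalar_def t_def)
  also have "\<dots> = twist_scalar g r \<otimes>\<^bsub>R\<^esub> (u (inv\<^bsub>G\<^esub> g) \<otimes>\<^bsub>R\<^esub> u h)"
    using twist_scalar_unit[OF g gh] ig r c by (simp add: g.\<rho>_mult)
  also have "\<dots> = twist_scalar g r \<otimes>\<^bsub>R\<^esub> u h"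
    using r c g.\<rho>_e[OF r] by (simp add: R.m_assoc[symmetric])
  finally have "twist_scalar h (twist_scalar g r) = \<alpha> (inv\<^bsub>G\<^esub> h) (\<alpha> (inv\<^bsub>G\<^esub> g) t)"
    by (simp add: twist_scalar_def)
  also have "\<dots> = \<alpha> (inv\<^bsub>G\<^esub> h \<otimes>\<^bsub>G\<^esub> inv\<^bsub>G\<^esub> g) t"
  proof (rule act_act)
    have "t \<otimes>\<^bsub>R\<^esub> (u g \<otimes>\<^bsub>R\<^esub> u (g \<otimes>\<^bsub>G\<^esub> h))
      = r \<otimes>\<^bsub>R\<^esub> (u (g \<otimes>\<^bsub>G\<^esub> h) \<otimes>\<^bsub>R\<^esub> u (g \<otimes>\<^bsub>G\<^esub> h)) \<otimes>\<^bsub>R\<^esub> (u g \<otimes>\<^bsub>R\<^esub> u g)"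
      unfolding t_def using r c by (simp add: R.m_ac)
    also have "\<dots> = t" using g gh by (simp add: t_def unit_idem)
    finally have "t \<in> D g \<cdot>\<^bsub>R\<^esub> D (g \<otimes>\<^bsub>G\<^esub> h)"
      using g gh r c by (simp add: D_prod_iff t_def)
    then show "t \<in> D (inv\<^bsub>G\<^esub> (inv\<^bsub>G\<^esub> g)) \<cdot>\<^bsub>R\<^esub> D (inv\<^bsub>G\<^esub> (inv\<^bsub>G\<^esub> h \<otimes>\<^bsub>G\<^esub> inv\<^bsub>G\<^esub> g))"
      using g h by (simp add: G.inv_mult_group)
  qed (use g h in auto)
  also have "\<dots> = twist_scalar (g \<otimes>\<^bsub>G\<^esub> h) (r \<otimes>\<^bsub>R\<^esub> u g)"
    using g h r c by (simp add: twist_scalar_def t_def G.inv_mult_group R.m_ac)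
  also have "\<dots> = twist_scalar (g \<otimes>\<^bsub>G\<^esub> h) r \<otimes>\<^bsub>R\<^esub> (u (inv\<^bsub>G\<^esub> (g \<otimes>\<^bsub>G\<^esub> h)) \<otimes>\<^bsub>R\<^esub> u (inv\<^bsub>G\<^esub> h))"
    using twist_scalar_unit[OF gh g] igh r c by (simp add: gh.\<rho>_mult)
  also have "\<dots> = twist_scalar (g \<otimes>\<^bsub>G\<^esub> h) r \<otimes>\<^bsub>R\<^esub> u (inv\<^bsub>G\<^esub> h)"
    using r c gh.\<rho>_e[OF r] by (simp add: R.m_assoc[symmetric])
  finally show ?thesis .
qed

lemma picS_dom_eq: "g \<in> carrier G \<Longrightarrow> picS_dom R D g = unital_classes R (u g)"
  unfolding picS_dom_def by (simp add: dom_def R.idempotent_class_coset unit_closed unit_idem)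

lemma picS_act_eq:
  assumes g: "g \<in> carrier G" and pE: "picS_module R E" and eE: "acts_trivially (u (inv\<^bsub>G\<^esub> g)) E"
  shows "picS_act G R u \<alpha> g (module_class R E) = module_class R (restrict_scalars (twist_scalar g) E)"
proof -
  interpret g: corner_iso R "twist_scalar g" "twist_scalar (inv\<^bsub>G\<^esub> g)" "u (inv\<^bsub>G\<^esub> g)" "u g"
    by (rule corner_iso_twist_scalar[OF g])
  have "module_class R (restrict_scalars (twist_scalar g) M)
      = module_class R (restrict_scalars (twist_scalar g) E)"
    if "M \<in> module_class R E" for M
  proof -
    have M: "module R M" "module_isomorphic R M E" using that by (auto simp: module_class_def)
    have "acts_trivially (u (inv\<^bsub>G\<^esub> g)) M"
      using acts_trivially_iso[OF module_isomorphic_sym[OF M(2,1)] picS_moduleD(1)[OF pE] g.e_closed eE] .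
    with M show ?thesis
      by (intro module_class_eq g.restrict_scalars_module g.restrict_scalars_iso)
  qed
  moreover obtain M :: "('a, 'a list) module" where "picS_module R M" "module_isomorphic R M E"
    using picS_representative[OF pE] by metis
  then have "M \<in> module_class R E" by (simp add: module_class_def picS_moduleD)
  ultimately show ?thesis
    unfolding picS_act_def twist_module_eq by blast
qed

text \<open>
  The identity map is an isomorphism as soon as both scalars act in the same way. This absorbs the
  extra idempotent in \<open>twist_scalar_compose\<close>.
\<close>

lemma restrict_scalars_class_cong:
  assumes "module R (restrict_scalars \<rho> E)"
    and "\<And>r x. \<lbrakk>r \<in> carrier R; x \<in> carrier E\<rbrakk> \<Longrightarrow> \<rho> r \<odot>\<^bsub>E\<^esub> x = \<rho>' r \<odot>\<^bsub>E\<^esub> x"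
  shows "module_class R (restrict_scalars \<rho> E) = module_class R (restrict_scalars \<rho>' E)"
  using assms
  by (intro module_class_eq module_isomorphicI[where h = "\<lambda>x. x" and k = "\<lambda>x. x"]) (auto intro!: module_homI)

text \<open>
  On \<open>E\<^sub>g\<close> the idempotent \<open>1\<^sub>h\<close> acts by \<open>\<rho>\<^sub>g(1\<^sub>h) = 1\<^bsub>g\<inverse>\<^esub> 1\<^bsub>g\<inverse>h\<^esub>\<close>.
\<close>

lemma twist_acts_trivially:
  assumes g: "g \<in> carrier G" and h: "h \<in> carrier G" and E: "module R E"
    and "acts_trivially (u (inv\<^bsub>G\<^esub> g)) E" "acts_trivially (u (inv\<^bsub>G\<^esub> g \<otimes>\<^bsub>G\<^esub> h)) E"
  shows "acts_trivially (u h) (restrict_scalars (twist_scalar g) E)"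
proof -
  interpret E: module R E by fact
  show ?thesis
    using assms by (simp add: acts_trivially_def twist_scalar_unit E.smult_assoc1 unit_closed)
qed

lemma picS_act_compose:
  assumes g: "g \<in> carrier G" and h: "h \<in> carrier G"
    and c: "c \<in> unital_classes R (u (inv\<^bsub>G\<^esub> h))" "c \<in> unital_classes R (u (inv\<^bsub>G\<^esub> (g \<otimes>\<^bsub>G\<^esub> h)))"
  shows "picS_act G R u \<alpha> g (picS_act G R u \<alpha> h c) = picS_act G R u \<alpha> (g \<otimes>\<^bsub>G\<^esub> h) c"
proof -
  have gh: "g \<otimes>\<^bsub>G\<^esub> h \<in> carrier G" using g h by simp
  interpret g: corner_iso R "twist_scalar g" "twist_scalar (inv\<^bsub>G\<^esub> g)" "u (inv\<^bsub>G\<^esub> g)" "u g"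
    by (rule corner_iso_twist_scalar[OF g])
  interpret h: corner_iso R "twist_scalar h" "twist_scalar (inv\<^bsub>G\<^esub> h)" "u (inv\<^bsub>G\<^esub> h)" "u h"
    by (rule corner_iso_twist_scalar[OF h])
  interpret gh: corner_iso R "twist_scalar (g \<otimes>\<^bsub>G\<^esub> h)" "twist_scalar (inv\<^bsub>G\<^esub> (g \<otimes>\<^bsub>G\<^esub> h))"
      "u (inv\<^bsub>G\<^esub> (g \<otimes>\<^bsub>G\<^esub> h))" "u (g \<otimes>\<^bsub>G\<^esub> h)"
    by (rule corner_iso_twist_scalar[OF gh])
  obtain E :: "('a, 'a list) module" where E: "picS_module R E" "acts_trivially (u (inv\<^bsub>G\<^esub> h)) E"
    "c = module_class R E"
    using c(1) by (rule unital_classesE)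
  have E': "acts_trivially (u (inv\<^bsub>G\<^esub> (g \<otimes>\<^bsub>G\<^esub> h))) E"
    using c(2) E by (auto intro: unital_classesD)
  note m = picS_moduleD(1)[OF E(1)]
  interpret E: module R E by (rule m)
  define Eh where "Eh = restrict_scalars (twist_scalar h) E"
  have Eh: "picS_module R Eh" unfolding Eh_def using E(1,2) by (rule h.restrict_scalars_picS)
  have Eh_g: "acts_trivially (u (inv\<^bsub>G\<^esub> g)) Eh"
    unfolding Eh_def using g h m E(2) E'
    by (intro twist_acts_trivially) (simp_all add: G.inv_mult_group)
  have compose: "restrict_scalars (twist_scalar g) Eh = restrict_scalars (\<lambda>r. twist_scalar h (twist_scalar g r)) E"
    by (simp add: Eh_def restrict_scalars_def)
  have "picS_act G R u \<alpha> g (picS_act G R u \<alpha> h c) = module_class R (restrict_scalars (twist_scalar g) Eh)"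
    unfolding E(3) picS_act_eq[OF h E(1,2)] Eh_def[symmetric] by (rule picS_act_eq[OF g Eh Eh_g])
  also have "\<dots> = module_class R (restrict_scalars (twist_scalar (g \<otimes>\<^bsub>G\<^esub> h)) E)"
    unfolding compose
  proof (rule restrict_scalars_class_cong)
    show "module R (restrict_scalars (\<lambda>r. twist_scalar h (twist_scalar g r)) E)"
      unfolding compose[symmetric] using picS_moduleD(1)[OF Eh] Eh_g by (rule g.restrict_scalars_module)
    show "twist_scalar h (twist_scalar g r) \<odot>\<^bsub>E\<^esub> x = twist_scalar (g \<otimes>\<^bsub>G\<^esub> h) r \<odot>\<^bsub>E\<^esub> x"
      if "r \<in> carrier R" "x \<in> carrier E" for r x
      using that E(2) by (simp add: twist_scalar_compose[OF g h] E.smult_assoc1 acts_trivially_def)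
  qed
  also have "\<dots> = picS_act G R u \<alpha> (g \<otimes>\<^bsub>G\<^esub> h) c"
    unfolding E(3) picS_act_eq[OF gh E(1) E'] ..
  finally show ?thesis .
qed

lemma unital_classes_one: "unital_classes R \<one>\<^bsub>R\<^esub> = carrier (PicS R)"
proof -
  have "acts_trivially \<one>\<^bsub>R\<^esub> E" if "picS_module R E" for E :: "('a, 'a list) module"
    using module.smult_one[OF picS_moduleD(1)[OF that]] by (simp add: acts_trivially_def)
  then show ?thesis by (auto simp: unital_classes_def PicS_def)
qed

lemma picS_act_one:
  assumes "c \<in> carrier (PicS R)"
  shows "picS_act G R u \<alpha> \<one>\<^bsub>G\<^esub> c = c"
proof -
  obtain E :: "('a, 'a list) module" where E: "picS_module R E" "c = module_class R E"
    using assms by (rule PicS_carrierE)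
  interpret E: module R E by (rule picS_moduleD(1)[OF E(1)])
  have triv: "acts_trivially (u (inv\<^bsub>G\<^esub> \<one>\<^bsub>G\<^esub>)) E" by (simp add: u_one acts_trivially_def)
  have "restrict_scalars (\<lambda>r. r) E = E" by (simp add: restrict_scalars_def)
  then have "module_class R (restrict_scalars (twist_scalar \<one>\<^bsub>G\<^esub>) E) = module_class R E"
    using restrict_scalars_class_cong[of "\<lambda>r. r" E "twist_scalar \<one>\<^bsub>G\<^esub>"] E.module_axioms
    by (simp add: twist_scalar_def u_one act_one)
  then show ?thesis
    unfolding E(2) by (simp add: picS_act_eq[OF _ E(1) triv])
qed

text \<open>
  By \<open>picS_act_compose\<close>, since \<open>g\<inverse>g = 1\<close> acts as the identity.
\<close>

lemma picS_act_inverse: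
  assumes g: "g \<in> carrier G" and c: "c \<in> unital_classes R (u (inv\<^bsub>G\<^esub> g))"
  shows "picS_act G R u \<alpha> (inv\<^bsub>G\<^esub> g) (picS_act G R u \<alpha> g c) = c"
  using picS_act_compose[of "inv\<^bsub>G\<^esub> g" g c] assms unital_classes_carrier[of R "u (inv\<^bsub>G\<^esub> g)"]
  by (auto simp: u_one unital_classes_one picS_act_one)

lemma picS_act_mem:
  assumes g: "g \<in> carrier G" and h: "h \<in> carrier G"
    and c: "c \<in> unital_classes R (u (inv\<^bsub>G\<^esub> g))" "c \<in> unital_classes R (u (inv\<^bsub>G\<^esub> g \<otimes>\<^bsub>G\<^esub> h))"
  shows "picS_act G R u \<alpha> g c \<in> unital_classes R (u h)"
proof -
  interpret g: corner_iso R "twist_scalar g" "twist_scalar (inv\<^bsub>G\<^esub> g)" "u (inv\<^bsub>G\<^esub> g)" "u g"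
    by (rule corner_iso_twist_scalar[OF g])
  obtain E :: "('a, 'a list) module" where E: "picS_module R E" "acts_trivially (u (inv\<^bsub>G\<^esub> g)) E"
    "c = module_class R E"
    using c(1) by (rule unital_classesE)
  have "acts_trivially (u (inv\<^bsub>G\<^esub> g \<otimes>\<^bsub>G\<^esub> h)) E"
    using c(2) E g h by (auto intro: unital_classesD simp: unit_closed)
  then have "acts_trivially (u h) (restrict_scalars (twist_scalar g) E)"
    using twist_acts_trivially[OF g h picS_moduleD(1)[OF E(1)] E(2)] by simp
  then show ?thesis
    unfolding E(3) picS_act_eq[OF g E(1,2)]
    using h by (intro unital_classesI g.restrict_scalars_picS E) (auto simp: unit_closed)
qed

lemma picS_act_mem_self:
  assumes g: "g \<in> carrier G" and c: "c \<in> unital_classes R (u (inv\<^bsub>G\<^esub> g))"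
  shows "picS_act G R u \<alpha> g c \<in> unital_classes R (u g)"
  using picS_act_mem[OF g g c] g subsetD[OF unital_classes_carrier c]
  by (simp add: u_one unital_classes_one)

lemma picS_act_mult:
  assumes g: "g \<in> carrier G"
    and c: "c \<in> unital_classes R (u (inv\<^bsub>G\<^esub> g))" and d: "d \<in> unital_classes R (u (inv\<^bsub>G\<^esub> g))"
  shows "picS_act G R u \<alpha> g (c \<otimes>\<^bsub>PicS R\<^esub> d) = picS_act G R u \<alpha> g c \<otimes>\<^bsub>PicS R\<^esub> picS_act G R u \<alpha> g d"
proof -
  interpret g: corner_iso R "twist_scalar g" "twist_scalar (inv\<^bsub>G\<^esub> g)" "u (inv\<^bsub>G\<^esub> g)" "u g"
    by (rule corner_iso_twist_scalar[OF g])
  obtain E :: "('a, 'a list) module" where E: "picS_module R E" "acts_trivially (u (inv\<^bsub>G\<^esub> g)) E"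
    "c = module_class R E"
    using c by (rule unital_classesE)
  obtain F :: "('a, 'a list) module" where F: "picS_module R F" "acts_trivially (u (inv\<^bsub>G\<^esub> g)) F"
    "d = module_class R F"
    using d by (rule unital_classesE)
  note m = picS_moduleD(1)[OF E(1)] picS_moduleD(1)[OF F(1)]
  note EF = PicS_mult_tensor_module[OF E(1) F(1)]
  note T = tensor_module_is_tensor[OF m]
  have "picS_act G R u \<alpha> g (c \<otimes>\<^bsub>PicS R\<^esub> d)
      = module_class R (restrict_scalars (twist_scalar g) (tensor_module R E F))"
    unfolding E(3) F(3) EF(1)
    by (rule picS_act_eq[OF g EF(2) tensor_acts_trivially[OF g.e_closed E(2) T]])
  also have "\<dots> = module_class R (restrict_scalars (twist_scalar g) E)
      \<otimes>\<^bsub>PicS R\<^esub> module_class R (restrict_scalars (twist_scalar g) F)"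
    by (rule PicS_mult[symmetric, OF _ _ g.restrict_scalars_tensor[OF m(1) E(2) m(2) F(2) T]])
       (intro g.restrict_scalars_picS E F)+
  also have "\<dots> = picS_act G R u \<alpha> g c \<otimes>\<^bsub>PicS R\<^esub> picS_act G R u \<alpha> g d"
    unfolding E(3) F(3) picS_act_eq[OF g E(1,2)] picS_act_eq[OF g F(1,2)] ..
  finally show ?thesis .
qed

lemma picS_dom_product:
  assumes "g \<in> carrier G" "h \<in> carrier G"
  shows "picS_dom R D g <#>\<^bsub>PicS R\<^esub> picS_dom R D h = unital_classes R (u g) \<inter> unital_classes R (u h)"
  using assms by (simp add: picS_dom_eq R.unital_classes_product unit_closed unit_idem)

lemma picS_monoid_partial_action:
  "monoid_partial_action G (PicS R) (picS_dom R D) (picS_act G R u \<alpha>)"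
proof -
  interpret P: comm_monoid "PicS R" by (rule R.PicS_comm_monoid)
  show ?thesis
  proof (unfold_locales)
    fix g assume g: "g \<in> carrier G"
    have g': "inv\<^bsub>G\<^esub> g \<in> carrier G" using g by simp
    note dom = picS_dom_eq[OF g] picS_dom_eq[OF g']
    show "picS_dom R D g \<subseteq> carrier (PicS R)"
      unfolding dom by (rule unital_classes_carrier)
    show "picS_dom R D g \<noteq> {}"
      unfolding dom using R.idempotent_class_mem[OF unit_closed[OF g] unit_idem[OF g]] by blast
    show "t \<otimes>\<^bsub>PicS R\<^esub> x \<in> picS_dom R D g" if "t \<in> carrier (PicS R)" "x \<in> picS_dom R D g" for t x
      using R.unital_classes_ideal(1)[OF unit_closed[OF g] that(1)] that(2) unfolding dom by simp
    show "picS_act G R u \<alpha> g \<in> iso (PicS R\<lparr>carrier := picS_dom R D (inv\<^bsub>G\<^esub> g)\<rparr>)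
        (PicS R\<lparr>carrier := picS_dom R D g\<rparr>)"
      unfolding iso_def dom
    proof (intro CollectI conjI)
      show "picS_act G R u \<alpha> g \<in> hom (PicS R\<lparr>carrier := unital_classes R (u (inv\<^bsub>G\<^esub> g))\<rparr>)
          (PicS R\<lparr>carrier := unital_classes R (u g)\<rparr>)"
        by (rule homI) (simp_all add: picS_act_mem_self[OF g] picS_act_mult[OF g])
      show "bij_betw (picS_act G R u \<alpha> g) (carrier (PicS R\<lparr>carrier := unital_classes R (u (inv\<^bsub>G\<^esub> g))\<rparr>))
          (carrier (PicS R\<lparr>carrier := unital_classes R (u g)\<rparr>))"
        using picS_act_inverse[OF g] picS_act_inverse[OF g'] picS_act_mem_self[OF g]
          picS_act_mem_self[OF g'] g
        by (intro bij_betw_byWitness[where f' = "picS_act G R u \<alpha> (inv\<^bsub>G\<^esub> g)"]) auto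
    qed
    fix h assume h: "h \<in> carrier G"
    have gh: "g \<otimes>\<^bsub>G\<^esub> h \<in> carrier G" using g h by simp
    have h': "inv\<^bsub>G\<^esub> h \<in> carrier G" and gh': "inv\<^bsub>G\<^esub> (g \<otimes>\<^bsub>G\<^esub> h) \<in> carrier G" using g h by simp_all
    have assoc: "inv\<^bsub>G\<^esub> g \<otimes>\<^bsub>G\<^esub> (g \<otimes>\<^bsub>G\<^esub> h) = h"
      using g h by (simp add: G.m_assoc[symmetric])
    show "picS_act G R u \<alpha> g ` (picS_dom R D (inv\<^bsub>G\<^esub> g) <#>\<^bsub>PicS R\<^esub> picS_dom R D h)
        = picS_dom R D g <#>\<^bsub>PicS R\<^esub> picS_dom R D (g \<otimes>\<^bsub>G\<^esub> h)"
      unfolding picS_dom_product[OF g' h] picS_dom_product[OF g gh]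
    proof
      show "picS_act G R u \<alpha> g ` (unital_classes R (u (inv\<^bsub>G\<^esub> g)) \<inter> unital_classes R (u h))
          \<subseteq> unital_classes R (u g) \<inter> unital_classes R (u (g \<otimes>\<^bsub>G\<^esub> h))"
        using picS_act_mem_self[OF g] picS_act_mem[OF g gh, unfolded assoc] by auto
      show "unital_classes R (u g) \<inter> unital_classes R (u (g \<otimes>\<^bsub>G\<^esub> h))
          \<subseteq> picS_act G R u \<alpha> g ` (unital_classes R (u (inv\<^bsub>G\<^esub> g)) \<inter> unital_classes R (u h))"
      proof
        fix d assume d: "d \<in> unital_classes R (u g) \<inter> unital_classes R (u (g \<otimes>\<^bsub>G\<^esub> h))"
        let ?c = "picS_act G R u \<alpha> (inv\<^bsub>G\<^esub> g) d"
        have "?c \<in> unital_classes R (u (inv\<^bsub>G\<^esub> g))" "?c \<in> unital_classes R (u h)"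
          using picS_act_mem_self[OF g'] picS_act_mem[OF g' h] g d by simp_all
        moreover have "d = picS_act G R u \<alpha> g ?c"
          using picS_act_inverse[OF g'] g d by simp
        ultimately show "d \<in> picS_act G R u \<alpha> g ` (unital_classes R (u (inv\<^bsub>G\<^esub> g)) \<inter> unital_classes R (u h))"
          by blast
      qed
    qed
    show "picS_act G R u \<alpha> g (picS_act G R u \<alpha> h t) = picS_act G R u \<alpha> (g \<otimes>\<^bsub>G\<^esub> h) t"
      if "t \<in> picS_dom R D (inv\<^bsub>G\<^esub> h) <#>\<^bsub>PicS R\<^esub> picS_dom R D (inv\<^bsub>G\<^esub> (g \<otimes>\<^bsub>G\<^esub> h))" for t
      using that unfolding picS_dom_product[OF h' gh'] by (intro picS_act_compose[OF g h]) auto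
  next
    show "picS_dom R D \<one>\<^bsub>G\<^esub> = carrier (PicS R)"
      by (simp add: picS_dom_eq u_one unital_classes_one)
  qed (rule picS_act_one)
qed

end

theorem theorem4p3:
  fixes G :: "('g, 'x) monoid_scheme" and R :: "('a, 'b) ring_scheme"
    and D :: "'g \<Rightarrow> 'a set" and u :: "'g \<Rightarrow> 'a" and \<alpha> :: "'g \<Rightarrow> 'a \<Rightarrow> 'a"
  assumes "unital_partial_action G R D u \<alpha>"
  shows "(\<forall>g\<in>carrier G.
            module_class R (ideal_module R (D g)) \<in> carrier (PicS R) \<and>
            picS_dom R D g =
              {module_class R E | E :: ('a, 'a list) module. picS_module R E \<and> unital_for (u g) E}) \<and>
         (\<forall>g\<in>carrier G. \<forall>E :: ('a, 'm) module.
            picS_module R E \<and> unital_for (u (inv\<^bsub>G\<^esub> g)) E \<longrightarrow>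
            picS_act G R u \<alpha> g (module_class R E) = module_class R (twist_module G R u \<alpha> g E)) \<and>
         monoid_partial_action G (PicS R) (picS_dom R D) (picS_act G R u \<alpha>)"
proof (intro conjI ballI allI impI)
  interpret unital_partial_action G R D u \<alpha> by fact
  have unital: "unital_for (u g) E \<longleftrightarrow> acts_trivially (u g) E"
    if "picS_module R E" "g \<in> carrier G" for g and E :: "('a, 'n) module"
    using unital_for_iff[OF picS_moduleD(1)[OF that(1)]] unit_closed unit_idem that(2)
    by (simp add: acts_trivially_def)
  fix g assume g: "g \<in> carrier G"
  show "module_class R (ideal_module R (D g)) \<in> carrier (PicS R)"
    using g by (simp add: dom_def PicS_carrierI R.picS_idempotent_ideal unit_closed unit_idem)
  show "picS_dom R D g =
      {module_class R E | E :: ('a, 'a list) module. picS_module R E \<and> unital_for (u g) E}"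
    unfolding picS_dom_eq[OF g] unital_classes_def using unital g by metis
next
  interpret unital_partial_action G R D u \<alpha> by fact
  fix g and E :: "('a, 'm) module"
  assume g: "g \<in> carrier G" and E: "picS_module R E \<and> unital_for (u (inv\<^bsub>G\<^esub> g)) E"
  have "acts_trivially (u (inv\<^bsub>G\<^esub> g)) E"
    using E g unital_for_iff[OF picS_moduleD(1), of R E "u (inv\<^bsub>G\<^esub> g)"] unit_closed unit_idem
    by (simp add: acts_trivially_def)
  then show "picS_act G R u \<alpha> g (module_class R E) = module_class R (twist_module G R u \<alpha> g E)"
    using E g by (simp add: picS_act_eq twist_module_eq)
next
  interpret unital_partial_action G R D u \<alpha> by fact
  show "monoid_partial_action G (PicS R) (picS_dom R D) (picS_act G R u \<alpha>)"
    by (rule picS_monoid_partial_action)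
qed

end
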